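(* Let $\mathbb{K}$ be a field and let $I\subset S=\mathbb{K}[x_1,x_2,x_3]$ be an equigenerated monomial ideal of degree $d$. Then the following statements are equivalent: (1) $\operatorname{reg}(I)=d$; (2) $I$ has a linear resolution; (3) $I$ has linear quotients.
   Context: $S$ carries the standard grading ($\deg x_i=1$). A monomial ideal is equigenerated of degree $d$ if all its minimal monomial generators have degree $d$. $\operatorname{reg}(I)=\max\{j-i\mid \beta_{i,j}(I)\neq 0\}$ is the Castelnuovo–Mumford regularity, where $\beta_{i,j}(I)$ are the graded Betti numbers of $I$ as a graded $S$-module. An ideal $I$ generated in degree $d$ has a linear resolution if $\beta_{i,j}(I)=0$ for all $i$ and all $j\neq i+d$. Let $\mathcal{G}(I)$ be the unique minimal set of monomial generators of $I$. The ideal $I$ has linear quotients if there is an ordering $u_1,\ldots,u_m$ of $\mathcal{G}(I)$ such that for each $i=1,\ldots,m-1$ the colon ideal $(u_1,\ldots,u_i):u_{i+1}$ is generated by a subset of the variables. *)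

theory Defs
  imports
    "HOL-Library.Poly_Mapping"
    "HOL-Library.Numeral_Type"
    "Jordan_Normal_Form.Matrix_Kernel"
begin

text \<open>
  The polynomial ring \<open>S = K[x\<^sub>1, x\<^sub>2, x\<^sub>3]\<close>: exponent vectors are functions on the three-element
  type \<^typ>\<open>3\<close>, and a polynomial is a finitely supported function from exponent vectors to
  coefficients, with convolution as multiplication.
\<close>

type_synonym expo = "3 \<Rightarrow>\<^sub>0 nat"
type_synonym 'k poly3 = "expo \<Rightarrow>\<^sub>0 'k"

definition monomial :: "expo \<Rightarrow> 'k::field poly3" where
  "monomial m = Poly_Mapping.single m 1"

definition Var :: "3 \<Rightarrow> 'k::field poly3" where
  "Var i = monomial (Poly_Mapping.single i 1)"

definition mdeg :: "expo \<Rightarrow> nat" where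
  "mdeg m = (\<Sum>i\<in>UNIV. Poly_Mapping.lookup m i)"

text \<open>The ideal generated by \<open>B\<close>: the span of \<open>B\<close> in the ring regarded as a module over itself.\<close>

abbreviation ideal_gen :: "'k::field poly3 set \<Rightarrow> 'k poly3 set" where
  "ideal_gen B \<equiv> Modules.module.span (*) B"

definition monomial_ideal :: "'k::field poly3 set \<Rightarrow> bool" where
  "monomial_ideal I \<longleftrightarrow> (\<exists>M. I = ideal_gen (monomial ` M))"

definition min_mono_gens :: "'k::field poly3 set \<Rightarrow> 'k poly3 set" where
  "min_mono_gens I =
    (THE G. G \<subseteq> range monomial \<and> ideal_gen G = I \<and> (\<forall>H. H \<subset> G \<longrightarrow> ideal_gen H \<noteq> I))"

definition equigenerated :: "'k::field poly3 set \<Rightarrow> nat \<Rightarrow> bool" where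
  "equigenerated I d \<longleftrightarrow> (\<forall>m. monomial m \<in> min_mono_gens I \<longrightarrow> mdeg m = d)"

definition colon_ideal :: "'k::field poly3 set \<Rightarrow> 'k poly3 \<Rightarrow> 'k poly3 set" where
  "colon_ideal J f = {g. g * f \<in> J}"

text \<open>List positions start at 0, so \<open>us ! i\<close> is \<open>u\<^bsub>i+1\<^esub>\<close> and \<open>take i us\<close> is \<open>u\<^sub>1, \<dots>, u\<^sub>i\<close>.\<close>

definition linear_quotients :: "'k::field poly3 set \<Rightarrow> bool" where
  "linear_quotients I \<longleftrightarrow>
    (\<exists>us. distinct us \<and> set us = min_mono_gens I \<and>
      (\<forall>i. 1 \<le> i \<and> i < length us \<longrightarrow>
        (\<exists>X. colon_ideal (ideal_gen (set (take i us))) (us ! i) = ideal_gen (Var ` X))))"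

text \<open>
  A list \<open>[b\<^sub>1, \<dots>, b\<^sub>n]\<close> of integers stands for the graded free module
  \<open>S(-b\<^sub>1) \<oplus> \<cdots> \<oplus> S(-b\<^sub>n)\<close>, whose basis elements have degrees \<open>b\<^sub>1, \<dots>, b\<^sub>n\<close>.
  A matrix is a degree-preserving map \<open>\<Oplus>\<^sub>l S(-b\<^sub>l) \<rightarrow> \<Oplus>\<^sub>k S(-a\<^sub>k)\<close> if its \<open>(k,l)\<close> entry is
  homogeneous of degree \<open>b\<^sub>l - a\<^sub>k\<close> (hence zero when that number is negative).
\<close>

definition graded_map :: "int list \<Rightarrow> int list \<Rightarrow> 'k::field poly3 mat \<Rightarrow> bool" where
  "graded_map as bs A \<longleftrightarrow> A \<in> carrier_mat (length as) (length bs) \<and>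
    (\<forall>k < length as. \<forall>l < length bs. \<forall>m \<in> Poly_Mapping.keys (A $$ (k, l)).
      as ! k + int (mdeg m) = bs ! l)"

definition mat_image :: "'k::field poly3 mat \<Rightarrow> 'k poly3 vec set" where
  "mat_image A = {A *\<^sub>v v | v. v \<in> carrier_vec (dim_col A)}"

text \<open>
  A graded free resolution \<open>\<cdots> \<rightarrow> F\<^sub>2 \<rightarrow> F\<^sub>1 \<rightarrow> F\<^sub>0 \<rightarrow> I \<rightarrow> 0\<close> of \<open>I\<close>: \<open>a i\<close> lists the degrees of the
  basis of \<open>F\<^sub>i\<close>, the matrix \<open>D (Suc i)\<close> is the differential \<open>F\<^bsub>i+1\<^esub> \<rightarrow> F\<^sub>i\<close>, and \<open>D 0\<close>, which has
  one row, is the augmentation \<open>F\<^sub>0 \<rightarrow> I \<subseteq> S\<close>.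
\<close>

definition graded_free_resolution ::
    "'k::field poly3 set \<Rightarrow> (nat \<Rightarrow> int list) \<Rightarrow> (nat \<Rightarrow> 'k poly3 mat) \<Rightarrow> bool" where
  "graded_free_resolution I a D \<longleftrightarrow>
    graded_map [0] (a 0) (D 0) \<and>
    (\<forall>i. graded_map (a i) (a (Suc i)) (D (Suc i))) \<and>
    mat_image (D 0) = {v \<in> carrier_vec 1. v $ 0 \<in> I} \<and>
    (\<forall>i. mat_image (D (Suc i)) = mat_kernel (D i))"

text \<open>Minimality: the differentials have all their entries in \<open>(x\<^sub>1, x\<^sub>2, x\<^sub>3)\<close>; this does not
  concern the augmentation \<open>D 0\<close>.\<close>

definition minimal_graded_free_resolution ::
    "'k::field poly3 set \<Rightarrow> (nat \<Rightarrow> int list) \<Rightarrow> (nat \<Rightarrow> 'k poly3 mat) \<Rightarrow> bool" where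
  "minimal_graded_free_resolution I a D \<longleftrightarrow>
    graded_free_resolution I a D \<and>
    (\<forall>i. elements_mat (D (Suc i)) \<subseteq> ideal_gen (range Var))"

text \<open>\<open>\<beta>\<^bsub>i,j\<^esub>(I)\<close>, the number of summands \<open>S(-j)\<close> of \<open>F\<^sub>i\<close> in the minimal graded free resolution
  of \<open>I\<close>, which exists and is unique up to isomorphism for every graded ideal \<open>I\<close>.\<close>

definition betti :: "'k::field poly3 set \<Rightarrow> nat \<Rightarrow> int \<Rightarrow> nat" where
  "betti I i j =
    count_list ((SOME a. \<exists>D. minimal_graded_free_resolution I a D) i) j"

definition reg :: "'k::field poly3 set \<Rightarrow> int" where
  "reg I = Max {j - int i | i j. betti I i j \<noteq> 0}"

definition linear_resolution :: "'k::field poly3 set \<Rightarrow> nat \<Rightarrow> bool" where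
  "linear_resolution I d \<longleftrightarrow> (\<forall>i j. j \<noteq> int i + int d \<longrightarrow> betti I i j = 0)"

end

theory Submission
  imports Defs "HOL-Library.Function_Algebras"
begin

text \<open>Let \<open>G\<close> be the set of exponents of the minimal generators, all of degree \<open>d\<close>. Chasing Koszul cycles of
  \<open>I\<close> through an arbitrary minimal graded resolution shows that \<open>F\<^sub>1\<close> has a generator in degree \<open>g\<close> iff
  the first Koszul homology of \<open>I\<close> is nonzero in degree \<open>g\<close>, that \<open>F\<^sub>2\<close> has one iff \<open>S/I\<close> has socle in
  degree \<open>g - 3\<close>, and that \<open>F\<^sub>3 = 0\<close>. Therefore the resolution is linear iff (A) any \<open>u, v \<in> G\<close> dividing
  a monomial \<open>a\<close> are joined by a path of generators dividing \<open>a\<close> in which consecutive ones differ by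
  exchanging one variable, and (B) \<open>S/I\<close> has no socle in degrees \<open>\<ge> d\<close>.

  Linear quotients imply (A) and (B) by adding one generator at a time. Conversely, (A) always makes
  the colon ideal of the remaining generators by a generator \<open>v\<close> linear, so it suffices to find \<open>v\<close>
  whose removal preserves (A) and (B). Take \<open>v\<close> at the end with largest \<open>x\<close>-exponent of the row of
  lowest \<open>z\<close>-exponent. Removing it destroys (A) only if \<open>v y/x\<close> and \<open>v z/y\<close> are generators and
  \<open>v z/x\<close> is not; then (B) excludes all generators with \<open>x\<close>-exponent below and \<open>y\<close>-exponent at most
  that of \<open>v\<close>. This cannot also happen with \<open>y\<close> and \<open>z\<close> interchanged.\<close>

section \<open>The Koszul chase through a minimal graded resolution\<close>

text \<open>\<open>betti\<close> reads the degrees off one chosen resolution. The chase therefore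
  runs in an arbitrary minimal resolution and compares it with data of \<open>I\<close> alone, and
  existence is proved so that the choice is meaningful; the construction takes place in the finer
  grading by exponent vectors, where matrix entries are single terms. What is compared are two
  computations of Tor(\<open>I\<close>, K), by the resolution and by the Koszul complex. In
  multidegree \<open>a\<close> the latter is the reduced homology of a simplicial complex on three
  vertices: degree 0 is connectivity of a graph, degree 1 asks for an empty triangle, that is, a
  socle monomial. Hence (A) and (B) do not see K. The obstacle in the combinatorial half is that
  removing a generator may cut the paths through it. At the end of an extremal row only the
  neighbours v y/x, v z/x and v z/y can occur, and the second is adjacent to both others; only its
  absence can do harm.\<close>

text \<open>Here \<open>H p g\<close> stands for the degree \<open>g\<close> part of the \<open>p\<close>-th module of \<open>\<dots> \<rightarrow> F\<^sub>1 \<rightarrow> F\<^sub>0 \<rightarrow> S\<close>, so that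
  \<open>H 0\<close> belongs to \<open>S\<close> and \<open>H (p + 1)\<close> to \<open>F\<^sub>p\<close>, and \<open>T p\<close> is the map from module \<open>p + 1\<close> to module \<open>p\<close>.
  Exactness is not assumed at \<open>S\<close>.\<close>

locale koszul_resolution =
  fixes H :: "nat \<Rightarrow> int \<Rightarrow> 'v::comm_ring_1 set"
    and T :: "nat \<Rightarrow> 'v \<Rightarrow> 'v"
    and x y z :: 'v
  assumes H_add: "u \<in> H p g \<Longrightarrow> v \<in> H p g \<Longrightarrow> u + v \<in> H p g"
    and H_diff: "u \<in> H p g \<Longrightarrow> v \<in> H p g \<Longrightarrow> u - v \<in> H p g"
    and H_var: "u \<in> H p (g - 1) \<Longrightarrow> x * u \<in> H p g \<and> y * u \<in> H p g \<and> z * u \<in> H p g"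
    and T_add: "T p (u + v) = T p u + T p v"
    and T_var: "T p (x * u) = x * T p u" "T p (y * u) = y * T p u" "T p (z * u) = z * T p u"
    and T_H: "u \<in> H (Suc p) g \<Longrightarrow> T p u \<in> H p g"
    and complex: "u \<in> H (Suc (Suc p)) g \<Longrightarrow> T p (T (Suc p) u) = 0"
    and exact: "u \<in> H (Suc p) g \<Longrightarrow> T p u = 0 \<Longrightarrow> \<exists>w \<in> H (Suc (Suc p)) g. T (Suc p) w = u"
    and minimal: "u \<in> H (Suc (Suc p)) g \<Longrightarrow>
      \<exists>a \<in> H (Suc p) (g - 1). \<exists>b \<in> H (Suc p) (g - 1). \<exists>c \<in> H (Suc p) (g - 1).
        T (Suc p) u = x * a + y * b + z * c"
    and cancel: "x * u = 0 \<Longrightarrow> u = 0" "y * u = 0 \<Longrightarrow> u = 0" "z * u = 0 \<Longrightarrow> u = 0"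
    and coprime: "a \<in> H p g \<Longrightarrow> b \<in> H p g \<Longrightarrow> x * a = y * b \<Longrightarrow> \<exists>c \<in> H p (g - 1). a = y * c"
      "a \<in> H p g \<Longrightarrow> b \<in> H p g \<Longrightarrow> y * a = z * b \<Longrightarrow> \<exists>c \<in> H p (g - 1). a = z * c"
    and koszul: "a \<in> H p g \<Longrightarrow> b \<in> H p g \<Longrightarrow> c \<in> H p g \<Longrightarrow> x * a + y * b + z * c = 0 \<Longrightarrow>
      \<exists>r \<in> H p (g - 1). \<exists>s \<in> H p (g - 1). \<exists>t \<in> H p (g - 1).
        a = y * r + z * s \<and> b = z * t - x * r \<and> c = - x * s - y * t"
begin

text \<open>This is the degree \<open>g\<close> part of (x, y, z) times module \<open>p\<close>. By
  graded Nakayama, \<open>H p g\<close> lies in it iff module \<open>p\<close> has no basis element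
  of degree \<open>g\<close>; for actual resolutions this is \<open>gens_degs\<close>.\<close>

definition mH :: "nat \<Rightarrow> int \<Rightarrow> 'v set" where
  "mH p g = {x * a + y * b + z * c | a b c. a \<in> H p (g - 1) \<and> b \<in> H p (g - 1) \<and> c \<in> H p (g - 1)}"

definition Im :: "int \<Rightarrow> 'v set" where
  "Im g = T 0 ` H 1 g"

lemma mH_I: "a \<in> H p (g - 1) \<Longrightarrow> b \<in> H p (g - 1) \<Longrightarrow> c \<in> H p (g - 1) \<Longrightarrow> x * a + y * b + z * c \<in> mH p g"
  unfolding mH_def by blast

lemma mH_add: assumes "u \<in> mH p g" "v \<in> mH p g" shows "u + v \<in> mH p g"
proof -
  obtain a b c a' b' c' where m: "a \<in> H p (g - 1)" "b \<in> H p (g - 1)" "c \<in> H p (g - 1)"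
     "a' \<in> H p (g - 1)" "b' \<in> H p (g - 1)" "c' \<in> H p (g - 1)"
    and e: "u = x * a + y * b + z * c" "v = x * a' + y * b' + z * c'"
    using assms unfolding mH_def by blast
  have "u + v = x * (a + a') + y * (b + b') + z * (c + c')"
    using e by (simp add: algebra_simps)
  then show ?thesis using m H_add mH_I by simp
qed

lemma mH_H: "u \<in> mH p g \<Longrightarrow> u \<in> H p g"
  unfolding mH_def using H_var H_add by auto

lemma T_0: "T p 0 = 0"
  using T_add[of p 0 0] by simp

lemma T_uminus: "T p (- u) = - T p u"
  using T_add[of p u "- u"] by (simp add: T_0 eq_neg_iff_add_eq_0 add.commute)

lemma T_diff: "T p (u - v) = T p u - T p v"
  using T_add[of p u "- v"] by (simp add: T_uminus)

lemmas T_simps = T_add T_var T_diff T_uminus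

lemma minimal': "u \<in> H (Suc (Suc p)) g \<Longrightarrow> T (Suc p) u \<in> mH (Suc p) g"
  using minimal[of u p g] unfolding mH_def by blast

text \<open>The difference of \<open>e\<close> and the given combination is a cycle, hence a
  boundary, and minimality puts boundaries into \<open>mH\<close>.\<close>

lemma mem_mH_of_image:
  assumes "e \<in> H (Suc (Suc p)) g" "q1 \<in> H (Suc (Suc p)) (g - 1)" "q2 \<in> H (Suc (Suc p)) (g - 1)"
    "q3 \<in> H (Suc (Suc p)) (g - 1)"
    and "T (Suc p) e = T (Suc p) (x * q1 + y * q2 + z * q3)"
  shows "e \<in> mH (Suc (Suc p)) g"
proof -
  let ?q = "x * q1 + y * q2 + z * q3"
  have q: "?q \<in> mH (Suc (Suc p)) g" using assms mH_I by blast
  have "e - ?q \<in> H (Suc (Suc p)) g" using assms mH_H[OF q] H_diff by blast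
  moreover have "T (Suc p) (e - ?q) = 0" using assms(5) by (simp add: T_diff)
  ultimately obtain w where "w \<in> H (Suc (Suc (Suc p))) g" "T (Suc (Suc p)) w = e - ?q"
    using exact by blast
  then have "e - ?q \<in> mH (Suc (Suc p)) g" using minimal' by metis
  then have "(e - ?q) + ?q \<in> mH (Suc (Suc p)) g" using q mH_add by blast
  then show ?thesis by simp
qed

text \<open>Module 1 and the ideal agree modulo (x, y, z), because the kernel of \<open>T 0\<close>
  consists of boundaries and so lies in \<open>mH\<close>.\<close>

lemma gens_module_1:
  "H 1 g \<subseteq> mH 1 g \<longleftrightarrow>
    (\<forall>u \<in> Im g. \<exists>a \<in> Im (g - 1). \<exists>b \<in> Im (g - 1). \<exists>c \<in> Im (g - 1). u = x * a + y * b + z * c)"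
  (is "_ \<longleftrightarrow> ?R")
proof
  assume L: "H 1 g \<subseteq> mH 1 g"
  show ?R
  proof
    fix u assume "u \<in> Im g"
    then obtain e where e: "e \<in> H 1 g" "u = T 0 e" unfolding Im_def by blast
    then obtain a b c where "a \<in> H 1 (g - 1)" "b \<in> H 1 (g - 1)" "c \<in> H 1 (g - 1)"
      "e = x * a + y * b + z * c" using L unfolding mH_def by blast
    moreover from this have "u = x * T 0 a + y * T 0 b + z * T 0 c" using e by (simp add: T_simps)
    ultimately show "\<exists>a \<in> Im (g - 1). \<exists>b \<in> Im (g - 1). \<exists>c \<in> Im (g - 1). u = x * a + y * b + z * c"
      unfolding Im_def by blast
  qed
next
  assume R: ?R
  show "H 1 g \<subseteq> mH 1 g"
  proof
    fix e assume e: "e \<in> H 1 g"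
    then have "T 0 e \<in> Im g" unfolding Im_def by blast
    then obtain a b c where abc: "a \<in> H 1 (g - 1)" "b \<in> H 1 (g - 1)" "c \<in> H 1 (g - 1)"
      "T 0 e = x * T 0 a + y * T 0 b + z * T 0 c"
      using R unfolding Im_def by blast
    let ?q = "x * a + y * b + z * c"
    have q: "?q \<in> mH 1 g" using abc mH_I by blast
    have "e - ?q \<in> H (Suc 0) g" using e mH_H[OF q] H_diff by simp
    moreover have "T 0 (e - ?q) = 0" using abc(4) by (simp add: T_simps)
    ultimately obtain w where "w \<in> H (Suc (Suc 0)) g" "T (Suc 0) w = e - ?q"
      using exact by blast
    then have "e - ?q \<in> mH 1 g" using minimal'[of w 0 g] by simp
    then have "(e - ?q) + ?q \<in> mH 1 g" using q mH_add by blast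
    then show "e \<in> mH 1 g" by simp
  qed
qed

text \<open>The right-hand side says that every Koszul 1-cycle of the ideal in degree
  \<open>g\<close> is a Koszul boundary. Forward, a cycle is lifted to module 1, where the Koszul
  complex is exact; backward, minimality turns \<open>T 1 e\<close> into a Koszul cycle of the
  ideal.\<close>

lemma gens_module_2:
  "H 2 g \<subseteq> mH 2 g \<longleftrightarrow>
    (\<forall>a \<in> Im (g - 1). \<forall>b \<in> Im (g - 1). \<forall>c \<in> Im (g - 1). x * a + y * b + z * c = 0 \<longrightarrow>
      (\<exists>r \<in> Im (g - 2). \<exists>s \<in> Im (g - 2). \<exists>t \<in> Im (g - 2).
        a = y * r + z * s \<and> b = z * t - x * r \<and> c = - x * s - y * t))"
  (is "_ \<longleftrightarrow> ?R")
proof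
  assume L: "H 2 g \<subseteq> mH 2 g"
  show ?R
  proof (intro ballI impI)
    fix a b c assume "a \<in> Im (g - 1)" "b \<in> Im (g - 1)" "c \<in> Im (g - 1)" and 0: "x * a + y * b + z * c = 0"
    then obtain a' b' c' where h: "a' \<in> H 1 (g - 1)" "b' \<in> H 1 (g - 1)" "c' \<in> H 1 (g - 1)"
      and abc: "a = T 0 a'" "b = T 0 b'" "c = T 0 c'" unfolding Im_def by blast
    have "x * a' + y * b' + z * c' \<in> H (Suc 0) g" using h mH_I mH_H by simp
    moreover have "T 0 (x * a' + y * b' + z * c') = 0" using 0 abc by (simp add: T_simps)
    ultimately obtain w where w: "w \<in> H 2 g" "T 1 w = x * a' + y * b' + z * c'"
      using exact[of _ 0] by (auto simp: numeral_2_eq_2)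
    then obtain k l m where k: "k \<in> H 2 (g - 1)" "l \<in> H 2 (g - 1)" "m \<in> H 2 (g - 1)"
      "w = x * k + y * l + z * m" using L unfolding mH_def by blast
    \<comment> \<open>Subtracting the images of the coefficients of \<open>w\<close> leaves a Koszul
      relation inside the free module and changes nothing after \<open>T 0\<close>.\<close>
    have e: "x * (a' - T 1 k) + y * (b' - T 1 l) + z * (c' - T 1 m) = 0"
    proof -
      have "x * a' + y * b' + z * c' = x * T 1 k + y * T 1 l + z * T 1 m"
        using w(2) unfolding k(4) T_simps by simp
      then show ?thesis by (simp add: algebra_simps)
    qed
    have "a' - T 1 k \<in> H 1 (g - 1)" "b' - T 1 l \<in> H 1 (g - 1)" "c' - T 1 m \<in> H 1 (g - 1)"
      using h k H_diff T_H[of _ 1] by (auto simp: numeral_2_eq_2)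
    from koszul[OF this e] obtain r s t where rst: "r \<in> H 1 (g - 2)" "s \<in> H 1 (g - 2)" "t \<in> H 1 (g - 2)"
      and q: "a' - T 1 k = y * r + z * s" "b' - T 1 l = z * t - x * r" "c' - T 1 m = - x * s - y * t"
      by auto
    have T1: "T 0 (T 1 k) = 0" "T 0 (T 1 l) = 0" "T 0 (T 1 m) = 0"
      using k complex[of _ 0] by (auto simp: numeral_2_eq_2)
    have "a = T 0 (a' - T 1 k)" "b = T 0 (b' - T 1 l)" "c = T 0 (c' - T 1 m)"
      using T1 abc by (auto simp: T_simps)
    then have "a = y * T 0 r + z * T 0 s" "b = z * T 0 t - x * T 0 r" "c = - x * T 0 s - y * T 0 t"
      unfolding q by (simp_all add: T_simps)
    then show "\<exists>r \<in> Im (g - 2). \<exists>s \<in> Im (g - 2). \<exists>t \<in> Im (g - 2).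
        a = y * r + z * s \<and> b = z * t - x * r \<and> c = - x * s - y * t"
      unfolding Im_def using rst by blast
  qed
next
  assume R: ?R
  show "H 2 g \<subseteq> mH 2 g"
  proof
    fix e assume "e \<in> H 2 g"
    then have e: "e \<in> H (Suc (Suc 0)) g" by (simp add: numeral_2_eq_2)
    obtain a b c where h: "a \<in> H 1 (g - 1)" "b \<in> H 1 (g - 1)" "c \<in> H 1 (g - 1)"
      and Te: "T 1 e = x * a + y * b + z * c" using minimal[OF e] by auto
    have "T 0 (T 1 e) = 0" using complex[OF e] by simp
    then have 0: "x * T 0 a + y * T 0 b + z * T 0 c = 0" unfolding Te by (simp add: T_simps)
    have "T 0 a \<in> Im (g - 1)" "T 0 b \<in> Im (g - 1)" "T 0 c \<in> Im (g - 1)"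
      using h unfolding Im_def by auto
    with R 0 have "\<exists>r \<in> Im (g - 2). \<exists>s \<in> Im (g - 2). \<exists>t \<in> Im (g - 2).
        T 0 a = y * r + z * s \<and> T 0 b = z * t - x * r \<and> T 0 c = - x * s - y * t" by blast
    then obtain r s t where rst: "r \<in> H 1 (g - 2)" "s \<in> H 1 (g - 2)" "t \<in> H 1 (g - 2)"
      and q: "T 0 a = y * T 0 r + z * T 0 s" "T 0 b = z * T 0 t - x * T 0 r" "T 0 c = - x * T 0 s - y * T 0 t"
      unfolding Im_def by blast
    have g2: "g - 2 = g - 1 - 1" by simp
    have rst': "x * r \<in> H 1 (g - 1)" "x * s \<in> H 1 (g - 1)" "y * r \<in> H 1 (g - 1)" "y * t \<in> H 1 (g - 1)"
      "z * s \<in> H 1 (g - 1)" "z * t \<in> H 1 (g - 1)"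
      using rst H_var unfolding g2 by blast+
    \<comment> \<open>Changing (\<open>a\<close>, \<open>b\<close>, \<open>c\<close>) by a Koszul
      boundary keeps \<open>x * a + y * b + z * c\<close> and makes the three coordinates cycles of
      \<open>T 0\<close>.\<close>
    have "a - (y * r + z * s) \<in> H (Suc 0) (g - 1)" "b - (z * t - x * r) \<in> H (Suc 0) (g - 1)"
       "c + x * s + y * t \<in> H (Suc 0) (g - 1)"
      using rst' h H_add H_diff by simp_all
    moreover have "T 0 (a - (y * r + z * s)) = 0" "T 0 (b - (z * t - x * r)) = 0"
       "T 0 (c + x * s + y * t) = 0" using q by (simp_all add: T_simps)
    ultimately obtain k l m where klm: "k \<in> H (Suc (Suc 0)) (g - 1)" "l \<in> H (Suc (Suc 0)) (g - 1)" "m \<in> H (Suc (Suc 0)) (g - 1)"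
      and Tk: "T (Suc 0) k = a - (y * r + z * s)" "T (Suc 0) l = b - (z * t - x * r)"
        "T (Suc 0) m = c + x * s + y * t"
      using exact by meson
    have "T (Suc 0) e = T (Suc 0) (x * k + y * l + z * m)"
      using Te unfolding T_simps Tk by (simp add: algebra_simps)
    from mem_mH_of_image[OF e klm this] show "e \<in> mH 2 g" by (simp add: numeral_2_eq_2)
  qed
qed

text \<open>The hypotheses make (\<open>T p r\<close>, \<open>T p s\<close>, \<open>T p t\<close>) a
  Koszul 2-cycle, and \<open>u\<close> is its preimage in Koszul degree 3. Coprimality of
  \<open>y\<close> and \<open>z\<close> produces \<open>u\<close>; cancelling \<open>z\<close> gives
  the other two equations.\<close>

lemma T_inverse_boundary:
  assumes H: "r \<in> H (Suc p) g" "s \<in> H (Suc p) g" "t \<in> H (Suc p) g"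
    and rs: "y * T p r + z * T p s = 0" and rt: "z * T p t - x * T p r = 0"
  shows "\<exists>u \<in> H p (g - 1). T p r = z * u \<and> T p s = - y * u \<and> T p t = x * u"
proof -
  have "y * T p r = z * (- T p s)" using rs by (simp add: eq_neg_iff_add_eq_0)
  moreover have "- T p s \<in> H p g"
    using T_H[OF H(2)] H_diff[of "T p s" p g "T p s"] H_diff[of 0 p g "T p s"] by simp
  ultimately obtain u where u: "u \<in> H p (g - 1)" "T p r = z * u"
    using coprime(2) T_H[OF H(1)] by blast
  have "z * (y * u + T p s) = 0" using rs u(2) by (simp add: algebra_simps)
  from cancel(3)[OF this] have "T p s = - y * u" by (simp add: eq_neg_iff_add_eq_0 add.commute)
  moreover have "z * (T p t - x * u) = 0" using rt u(2) by (simp add: algebra_simps)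
  from cancel(3)[OF this] have "T p t = x * u" by simp
  ultimately show ?thesis using u by blast
qed

text \<open>The element \<open>e\<close> is pushed down the resolution and along the Koszul complex,
  through (\<open>a\<close>, \<open>b\<close>, \<open>c\<close>) and (\<open>r\<close>,
  \<open>s\<close>, \<open>t\<close>), to a single \<open>u\<close> that is a socle element of the
  cokernel of \<open>T p\<close>. If \<open>u\<close> vanishes there, corrections run all the way
  back to \<open>e\<close>. For \<open>p = 0\<close> this cokernel is S/I.\<close>

lemma syzygy_in_mH:
  assumes e: "e \<in> H (Suc (Suc (Suc p))) g"
    and soc: "\<And>u. u \<in> H p (g - 3) \<Longrightarrow> x * u \<in> T p ` H (Suc p) (g - 2) \<Longrightarrow> y * u \<in> T p ` H (Suc p) (g - 2) \<Longrightarrow>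
      z * u \<in> T p ` H (Suc p) (g - 2) \<Longrightarrow> u \<in> T p ` H (Suc p) (g - 3)"
  shows "e \<in> mH (Suc (Suc (Suc p))) g"
proof -
  let ?p1 = "Suc p" and ?p2 = "Suc (Suc p)"
  obtain a b c where h: "a \<in> H ?p2 (g - 1)" "b \<in> H ?p2 (g - 1)" "c \<in> H ?p2 (g - 1)"
    and Te: "T ?p2 e = x * a + y * b + z * c" using minimal[OF e] by auto
  have "T ?p1 (T ?p2 e) = 0" using complex[OF e] by simp
  then have 0: "x * T ?p1 a + y * T ?p1 b + z * T ?p1 c = 0" unfolding Te by (simp add: T_simps)
  from koszul[OF h[THEN T_H] this] obtain r s t where
    rst: "r \<in> H ?p1 (g - 2)" "s \<in> H ?p1 (g - 2)" "t \<in> H ?p1 (g - 2)"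
    and q: "T ?p1 a = y * r + z * s" "T ?p1 b = z * t - x * r" "T ?p1 c = - x * s - y * t"
    by auto
  have "T p (T ?p1 a) = 0" "T p (T ?p1 b) = 0" using h complex by blast+
  then have "y * T p r + z * T p s = 0" "z * T p t - x * T p r = 0" unfolding q by (simp_all add: T_simps)
  from T_inverse_boundary[OF rst this] obtain u where u: "u \<in> H p (g - 3)"
    "T p r = z * u" "T p s = - y * u" "T p t = x * u" by auto
  have "- s \<in> H ?p1 (g - 2)" using rst H_diff[of s ?p1 "g - 2" s] H_diff[of 0 ?p1 "g - 2" s] by simp
  then have "y * u \<in> T p ` H ?p1 (g - 2)" using u(3) T_uminus[of p s] by (intro image_eqI[of _ _ "- s"]) auto
  then obtain f where f: "f \<in> H ?p1 (g - 3)" "u = T p f"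
    using soc[OF u(1)] u(2,4) rst by (metis image_iff)
  have g3: "g - 3 = g - 2 - 1" by simp
  have "x * f \<in> H ?p1 (g - 2)" "y * f \<in> H ?p1 (g - 2)" "z * f \<in> H ?p1 (g - 2)"
    using f H_var unfolding g3 by blast+
  \<comment> \<open>Subtracting the Koszul image of \<open>f\<close> turns \<open>r\<close>,
    \<open>s\<close>, \<open>t\<close> into cycles, whose preimages \<open>k\<close>,
    \<open>l\<close>, \<open>m\<close> then correct \<open>a\<close>, \<open>b\<close>,
    \<open>c\<close> in the same way.\<close>
  then have "r - z * f \<in> H ?p1 (g - 2)" "s + y * f \<in> H ?p1 (g - 2)" "t - x * f \<in> H ?p1 (g - 2)"
    using rst H_add H_diff by simp_all
  moreover have "T p (r - z * f) = 0" "T p (s + y * f) = 0" "T p (t - x * f) = 0"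
    using u f by (simp_all add: T_simps)
  ultimately obtain k l m where klm: "k \<in> H ?p2 (g - 2)" "l \<in> H ?p2 (g - 2)" "m \<in> H ?p2 (g - 2)"
    and Tk: "T ?p1 k = r - z * f" "T ?p1 l = s + y * f" "T ?p1 m = t - x * f"
    using exact by meson
  have g2: "g - 2 = g - 1 - 1" by simp
  have "x * k \<in> H ?p2 (g - 1)" "x * l \<in> H ?p2 (g - 1)" "y * k \<in> H ?p2 (g - 1)" "y * m \<in> H ?p2 (g - 1)"
    "z * l \<in> H ?p2 (g - 1)" "z * m \<in> H ?p2 (g - 1)"
    using klm H_var unfolding g2 by blast+
  then have "a - (y * k + z * l) \<in> H ?p2 (g - 1)" "b - (z * m - x * k) \<in> H ?p2 (g - 1)"
    "c + x * l + y * m \<in> H ?p2 (g - 1)"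
    using h H_add H_diff by simp_all
  moreover have "T ?p1 (a - (y * k + z * l)) = 0" "T ?p1 (b - (z * m - x * k)) = 0"
    "T ?p1 (c + x * l + y * m) = 0"
    unfolding T_simps q Tk by (simp_all add: algebra_simps)
  ultimately obtain a' b' c' where "a' \<in> H (Suc ?p2) (g - 1)" "b' \<in> H (Suc ?p2) (g - 1)" "c' \<in> H (Suc ?p2) (g - 1)"
    and T': "T ?p2 a' = a - (y * k + z * l)" "T ?p2 b' = b - (z * m - x * k)" "T ?p2 c' = c + x * l + y * m"
    using exact by meson
  moreover have "T ?p2 e = T ?p2 (x * a' + y * b' + z * c')"
    unfolding Te T_simps T' by (simp add: algebra_simps)
  ultimately show ?thesis using mem_mH_of_image[OF e] by blast
qed

text \<open>The shift by 3 is the degree of xyz, the last term of the Koszul complex. One direction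
  is \<open>syzygy_in_mH\<close>; for the other, a socle element \<open>u\<close> is carried up to
  some \<open>e\<close> in module 3, and a decomposition of \<open>e\<close> is carried back down to
  a preimage of \<open>u\<close>.\<close>

lemma gens_module_3:
  "H 3 g \<subseteq> mH 3 g \<longleftrightarrow>
    (\<forall>u \<in> H 0 (g - 3). x * u \<in> Im (g - 2) \<longrightarrow> y * u \<in> Im (g - 2) \<longrightarrow> z * u \<in> Im (g - 2) \<longrightarrow> u \<in> Im (g - 3))"
  (is "_ \<longleftrightarrow> ?R")
proof
  assume L: "H 3 g \<subseteq> mH 3 g"
  have eq: "(1::nat) = Suc 0" "(2::nat) = Suc (Suc 0)" "(3::nat) = Suc (Suc (Suc 0))" by simp_all
  have g3: "g - 3 = g - 2 - 1" and g2: "g - 2 = g - 1 - 1" by simp_all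
  show ?R
  proof (intro ballI impI)
    fix u assume u: "u \<in> H 0 (g - 3)" "x * u \<in> Im (g - 2)" "y * u \<in> Im (g - 2)" "z * u \<in> Im (g - 2)"
    then obtain a b c where abc: "a \<in> H (Suc 0) (g - 2)" "b \<in> H (Suc 0) (g - 2)" "c \<in> H (Suc 0) (g - 2)"
      and T0: "T 0 a = x * u" "T 0 b = y * u" "T 0 c = z * u" unfolding Im_def One_nat_def by (elim imageE) simp
    have lift: "\<exists>w \<in> H (Suc (Suc 0)) (g - 1). T (Suc 0) w = v - v'"
      if "v \<in> H (Suc 0) (g - 1)" "v' \<in> H (Suc 0) (g - 1)" "T 0 v = T 0 v'" for v v'
      using that exact[OF H_diff] by (simp add: T_diff)
    have var: "x * v \<in> H (Suc 0) (g - 1)" "y * v \<in> H (Suc 0) (g - 1)" "z * v \<in> H (Suc 0) (g - 1)"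
      if "v \<in> H (Suc 0) (g - 2)" for v
      using that H_var[of v "Suc 0" "g - 1"] by simp_all
    \<comment> \<open>Each of \<open>x * y * u\<close>, \<open>x * z * u\<close>,
      \<open>y * z * u\<close> has two preimages; their differences lift to \<open>p\<close>,
      \<open>q\<close>, \<open>w\<close>.\<close>
    have T0': "T 0 (y * a) = T 0 (x * b)" "T 0 (z * a) = T 0 (x * c)" "T 0 (z * b) = T 0 (y * c)"
      unfolding T_simps T0 by (simp_all add: mult.left_commute)
    obtain p where p: "p \<in> H (Suc (Suc 0)) (g - 1)" "T (Suc 0) p = y * a - x * b"
      using lift[of "y * a" "x * b"] abc var T0' by blast
    obtain q where q: "q \<in> H (Suc (Suc 0)) (g - 1)" "T (Suc 0) q = z * a - x * c"
      using lift[of "z * a" "x * c"] abc var T0' by blast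
    obtain w where w: "w \<in> H (Suc (Suc 0)) (g - 1)" "T (Suc 0) w = z * b - y * c"
      using lift[of "z * b" "y * c"] abc var T0' by blast
    note pqw = p(1) q(1) w(1) and T1 = p(2) q(2) w(2)
    \<comment> \<open>With these Koszul signs the images of \<open>p\<close>, \<open>q\<close>,
      \<open>w\<close> cancel, so that a lift \<open>e\<close> to module 3 exists.\<close>
    have "z * p - y * q + x * w \<in> H (Suc (Suc 0)) g"
      by (intro H_add H_diff) (use pqw H_var in auto)
    moreover have "T (Suc 0) (z * p - y * q + x * w) = 0" unfolding T_simps T1 by (simp add: algebra_simps)
    ultimately have "\<exists>e \<in> H 3 g. T 2 e = z * p - y * q + x * w"
      using exact[of "z * p - y * q + x * w" "Suc 0" g] unfolding eq by blast
    then obtain e where e: "e \<in> H 3 g" "T 2 e = z * p - y * q + x * w" by blast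
    then obtain k l m where klm: "k \<in> H 3 (g - 1)" "l \<in> H 3 (g - 1)" "m \<in> H 3 (g - 1)"
      and ee: "e = x * k + y * l + z * m" using L unfolding mH_def by blast
    have "w - T 2 k \<in> H (Suc (Suc 0)) (g - 1)" "- q - T 2 l \<in> H (Suc (Suc 0)) (g - 1)" "p - T 2 m \<in> H (Suc (Suc 0)) (g - 1)"
      using pqw klm[unfolded eq, THEN T_H] H_diff H_diff[of q _ _ q] H_diff[of 0 _ _ q] unfolding eq by auto
    moreover have "x * (w - T 2 k) + y * (- q - T 2 l) + z * (p - T 2 m) = 0"
      using e(2) unfolding ee T_simps by (simp add: algebra_simps)
    ultimately obtain r s t where rst: "r \<in> H (Suc (Suc 0)) (g - 2)" "s \<in> H (Suc (Suc 0)) (g - 2)"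
      "t \<in> H (Suc (Suc 0)) (g - 2)" and "p - T 2 m = - x * s - y * t"
      using koszul[of "w - T 2 k" "Suc (Suc 0)" "g - 1" "- q - T 2 l" "p - T 2 m"] unfolding g2 by blast
    then have p': "p = T 2 m - x * s - y * t" by (simp add: algebra_simps)
    have T12: "T (Suc 0) (T 2 m) = 0" using klm(3) complex unfolding eq by auto
    have "T (Suc 0) p = - x * T (Suc 0) s - y * T (Suc 0) t"
      unfolding p' by (simp add: T_simps T12)
    \<comment> \<open>Two expressions for the image of \<open>p\<close> are compared; coprimality of
      \<open>x\<close> and \<open>y\<close> then gives the quotient \<open>f\<close>, which is the
      desired preimage of \<open>u\<close>.\<close>
    then have "x * (b - T (Suc 0) s) = y * (a + T (Suc 0) t)" unfolding T1 by (simp add: algebra_simps)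
    moreover have "b - T (Suc 0) s \<in> H (Suc 0) (g - 2)" "a + T (Suc 0) t \<in> H (Suc 0) (g - 2)"
      using abc rst T_H H_add H_diff by auto
    ultimately obtain f where f: "f \<in> H (Suc 0) (g - 3)" "b - T (Suc 0) s = y * f"
      using coprime(1)[of "b - T (Suc 0) s" "Suc 0" "g - 2" "a + T (Suc 0) t"] unfolding g3 by blast
    have "T 0 (b - T (Suc 0) s) = T 0 b" using rst(2) complex by (simp add: T_simps)
    then have "y * (u - T 0 f) = 0" using T0 arg_cong[OF f(2), of "T 0"] unfolding T_simps by (simp add: algebra_simps)
    from cancel(2)[OF this] have "u = T 0 f" by simp
    then show "u \<in> Im (g - 3)" using f unfolding Im_def by auto
  qed
next
  assume ?R
  then show "H 3 g \<subseteq> mH 3 g"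
    using syzygy_in_mH[of _ 0 g] unfolding Im_def by (auto simp: numeral_3_eq_3)
qed

text \<open>By exactness the cokernel of \<open>T (Suc p)\<close> embeds into module
  \<open>p\<close>, where variables can be cancelled, so it has no socle. This is Hilbert's bound on
  the length of the resolution.\<close>

lemma gens_module_4: "H (Suc (Suc (Suc (Suc p)))) g \<subseteq> mH (Suc (Suc (Suc (Suc p)))) g"
proof
  fix e assume e: "e \<in> H (Suc (Suc (Suc (Suc p)))) g"
  show "e \<in> mH (Suc (Suc (Suc (Suc p)))) g"
  proof (rule syzygy_in_mH[OF e])
    fix u assume u: "u \<in> H (Suc p) (g - 3)" and "x * u \<in> T (Suc p) ` H (Suc (Suc p)) (g - 2)"
    then have "T p (x * u) = 0" using complex by auto
    then have "T p u = 0" using cancel(1)[of "T p u"] by (simp add: T_simps)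
    then show "u \<in> T (Suc p) ` H (Suc (Suc p)) (g - 3)" using exact[OF u] by blast
  qed
qed

end

section \<open>Monomials of degree \<open>d\<close> and linear quotients\<close>

abbreviation keys :: "('a \<Rightarrow>\<^sub>0 'b::zero) \<Rightarrow> 'a set" where
  "keys \<equiv> Poly_Mapping.keys"

abbreviation coeff :: "('a \<Rightarrow>\<^sub>0 'b::zero) \<Rightarrow> 'a \<Rightarrow> 'b" where
  "coeff \<equiv> Poly_Mapping.lookup"

abbreviation single :: "'a \<Rightarrow> 'b::zero \<Rightarrow> 'a \<Rightarrow>\<^sub>0 'b" where
  "single \<equiv> Poly_Mapping.single"

lemma UNIV_3: "(UNIV :: 3 set) = {0, 1, 2}"
  and distinct_3: "(0 :: 3) \<noteq> 1" "(0 :: 3) \<noteq> 2" "(1 :: 3) \<noteq> 2"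
proof -
  show d: "(0 :: 3) \<noteq> 1" "(0 :: 3) \<noteq> 2" "(1 :: 3) \<noteq> 2" by simp_all
  have "{0, 1, 2} = (UNIV :: 3 set)"
    by (rule card_subset_eq) (use d in auto)
  then show "(UNIV :: 3 set) = {0, 1, 2}" by simp
qed

lemma all_3: "(\<forall>i::3. P i) \<longleftrightarrow> P 0 \<and> P 1 \<and> P 2"
  using UNIV_3 by (metis UNIV_I insertE singletonD)

section \<open>Divisibility of exponent vectors and exchange of one variable\<close>

definition edvd :: "expo \<Rightarrow> expo \<Rightarrow> bool" (infix \<open>\<preceq>\<close> 50) where
  "u \<preceq> v \<longleftrightarrow> (\<forall>i. coeff u i \<le> coeff v i)"

abbreviation expo_var :: "3 \<Rightarrow> expo" (\<open>\<epsilon>\<close>) where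
  "\<epsilon> i \<equiv> single i 1"

abbreviation exponent :: "expo \<Rightarrow> 3 \<Rightarrow> nat" (infixl \<open>\<diamondop>\<close> 100) where
  "u \<diamondop> i \<equiv> coeff u i"

lemma expo_var_nth: "\<epsilon> i \<diamondop> j = (if i = j then 1 else 0)"
  "single i (Suc 0) \<diamondop> j = (if i = j then 1 else 0)"
  by (simp_all add: lookup_single when_def)

lemmas expo_nth = lookup_add lookup_minus expo_var_nth

lemma mdeg_3: "mdeg m = m \<diamondop> 0 + m \<diamondop> 1 + m \<diamondop> 2"
  unfolding mdeg_def UNIV_3 by simp

lemma mdeg_add: "mdeg (u + v) = mdeg u + mdeg v"
  by (simp add: mdeg_3 lookup_add)

lemma mdeg_var [simp]: "mdeg (\<epsilon> i) = 1" "mdeg (single i (Suc 0)) = 1"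
  unfolding mdeg_def by (simp_all add: expo_nth)

lemma edvd_refl [simp]: "u \<preceq> u"
  by (simp add: edvd_def)

lemma edvd_trans: "u \<preceq> v \<Longrightarrow> v \<preceq> w \<Longrightarrow> u \<preceq> w"
  unfolding edvd_def using le_trans by blast

lemma edvd_add: "u \<preceq> u + v" "u \<preceq> v + u"
  by (simp_all add: edvd_def lookup_add)

lemma edvd_diff: "u \<preceq> v \<Longrightarrow> u + (v - u) = v"
  by (rule poly_mapping_eqI) (simp add: edvd_def lookup_add lookup_minus)

lemma edvd_iff: "u \<preceq> v \<longleftrightarrow> (\<exists>w. v = u + w)"
  using edvd_diff edvd_add by metis

lemma mdeg_mono: "u \<preceq> v \<Longrightarrow> mdeg u \<le> mdeg v"
  by (auto simp: edvd_iff mdeg_add)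

lemma edvd_mdeg_eq: "u \<preceq> v \<Longrightarrow> mdeg v \<le> mdeg u \<Longrightarrow> u = v"
  using all_3[of "\<lambda>i. u \<diamondop> i \<le> v \<diamondop> i"] all_3[of "\<lambda>i. u \<diamondop> i = v \<diamondop> i"]
  by (intro poly_mapping_eqI) (auto simp: edvd_def mdeg_3)

lemma edvd_strict: "u \<preceq> v \<Longrightarrow> mdeg u < mdeg v \<Longrightarrow> \<exists>i. u + \<epsilon> i \<preceq> v"
proof -
  assume a: "u \<preceq> v" "mdeg u < mdeg v"
  then obtain i where "u \<diamondop> i < v \<diamondop> i"
    using mdeg_mono[of v u] unfolding edvd_def by (meson not_le)
  then have "u + \<epsilon> i \<preceq> v" using a by (auto simp: edvd_def expo_nth)
  then show ?thesis ..
qed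

lemma edvd_add_var: "u + \<epsilon> i \<preceq> v \<longleftrightarrow> u \<preceq> v \<and> u \<diamondop> i < v \<diamondop> i"
proof safe
  assume a: "u + \<epsilon> i \<preceq> v"
  then show "u \<preceq> v" using edvd_add edvd_trans by blast
  show "u \<diamondop> i < v \<diamondop> i" using a[unfolded edvd_def, rule_format, of i] by (simp add: expo_nth)
qed (auto simp: edvd_def expo_nth Suc_le_eq)

lemma edvd_plus_var: "u \<preceq> v + \<epsilon> i \<Longrightarrow> \<not> u \<preceq> v \<Longrightarrow> u \<diamondop> i = v \<diamondop> i + 1"
proof -
  assume a: "u \<preceq> v + \<epsilon> i" "\<not> u \<preceq> v"
  then have le: "u \<diamondop> k \<le> v \<diamondop> k + (if i = k then 1 else 0)" for k by (simp add: edvd_def expo_nth)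
  obtain k where "v \<diamondop> k < u \<diamondop> k" using a(2) unfolding edvd_def by (meson not_le)
  then show ?thesis using le[of k] by (simp split: if_splits)
qed

text \<open>Here \<open>w\<close> is \<open>v\<close> times variable \<open>i\<close> divided by
  variable \<open>j\<close>: the gained index comes first, the lost one second. The additive form
  avoids truncated subtraction.\<close>

definition adj :: "3 \<Rightarrow> 3 \<Rightarrow> expo \<Rightarrow> expo \<Rightarrow> bool" where
  "adj i j v w \<longleftrightarrow> i \<noteq> j \<and> w + \<epsilon> j = v + \<epsilon> i"

lemma adj_nth: "adj i j v w \<Longrightarrow> w \<diamondop> i = v \<diamondop> i + 1 \<and> v \<diamondop> j = w \<diamondop> j + 1 \<and> (\<forall>k. k \<noteq> i \<longrightarrow> k \<noteq> j \<longrightarrow> w \<diamondop> k = v \<diamondop> k)"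
proof -
  assume n: "adj i j v w"
  have "(w + \<epsilon> j) \<diamondop> k = (v + \<epsilon> i) \<diamondop> k" for k using n by (simp add: adj_def)
  then have eq: "w \<diamondop> k + (if j = k then 1 else 0) = v \<diamondop> k + (if i = k then 1 else 0)" for k
    by (simp add: expo_nth)
  have "i \<noteq> j" using n by (simp add: adj_def)
  then have "w \<diamondop> i = v \<diamondop> i + 1" "v \<diamondop> j = w \<diamondop> j + 1" using eq[of i] eq[of j] by auto
  moreover have "w \<diamondop> k = v \<diamondop> k" if "k \<noteq> i" "k \<noteq> j" for k using that eq[of k] by auto
  ultimately show ?thesis by blast
qed

lemma adj_le: "adj i j v w \<Longrightarrow> k \<noteq> i \<Longrightarrow> w \<diamondop> k \<le> v \<diamondop> k"
  using adj_nth[of i j v w] by (cases "k = j") auto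

lemma adj_sym: "adj i j v w \<Longrightarrow> adj j i w v"
  by (auto simp: adj_def)

lemma adj_unique: "adj i j v w \<Longrightarrow> adj i j v w' \<Longrightarrow> w = w'"
  by (auto simp: adj_def) (metis add_right_cancel)

lemma adj_exists: assumes "i \<noteq> j" "0 < v \<diamondop> j" shows "\<exists>w. adj i j v w"
proof -
  have "\<epsilon> j \<preceq> v + \<epsilon> i" using assms by (auto simp: edvd_def expo_nth Suc_le_eq)
  then obtain w where "v + \<epsilon> i = \<epsilon> j + w" unfolding edvd_iff by blast
  then have "adj i j v w" using assms by (simp add: adj_def add.commute)
  then show ?thesis ..
qed

lemma adj_mdeg: "adj i j v w \<Longrightarrow> mdeg w = mdeg v"
  using mdeg_add[of w "\<epsilon> j"] mdeg_add[of v "\<epsilon> i"] by (simp add: adj_def)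

lemma adj_irrefl: "\<not> adj i j v v"
  using adj_nth[of i j v v] by auto

section \<open>Combinatorial conditions on a set of generators\<close>

definition upset :: "expo set \<Rightarrow> expo set" where
  "upset G = {m. \<exists>u \<in> G. u \<preceq> m}"

definition step :: "expo set \<Rightarrow> expo \<Rightarrow> expo \<Rightarrow> expo \<Rightarrow> bool" where
  "step G a u v \<longleftrightarrow> u \<in> G \<and> v \<in> G \<and> u \<preceq> a \<and> v \<preceq> a \<and> (\<exists>i j. adj i j u v)"

definition linearly_connected :: "expo set \<Rightarrow> bool" where
  "linearly_connected G \<longleftrightarrow> (\<forall>a. \<forall>u \<in> G. \<forall>v \<in> G. u \<preceq> a \<longrightarrow> v \<preceq> a \<longrightarrow> (step G a)\<^sup>*\<^sup>* u v)"

text \<open>A socle monomial of degree e yields a generator of \<open>F_2\<close> in degree e + 3,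
  which is linear exactly for e = d - 1; for generators of degree \<open>d\<close> no smaller e can
  occur. Hence the bound.\<close>

definition no_socle :: "nat \<Rightarrow> expo set \<Rightarrow> bool" where
  "no_socle d G \<longleftrightarrow> (\<forall>m. m \<notin> upset G \<longrightarrow> d \<le> mdeg m \<longrightarrow> (\<exists>i. m + \<epsilon> i \<notin> upset G))"

text \<open>The colon ideal by \<open>v\<close> is generated by the u / gcd(u, v). It is generated
  by variables iff each of these is divisible by some x_i with v x_i in the ideal, and for equal
  degrees and \<open>v\<close> outside \<open>G\<close> the latter means that some v x_i / x_j lies
  in \<open>G\<close>.\<close>

definition lin_colon :: "expo set \<Rightarrow> expo \<Rightarrow> bool" where
  "lin_colon G v \<longleftrightarrow> (\<forall>u \<in> G. \<exists>w \<in> G. \<exists>i j. adj i j v w \<and> v \<diamondop> i < u \<diamondop> i)"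

lemma step_sym: "step G a u v \<Longrightarrow> step G a v u"
  unfolding step_def using adj_sym by metis

lemma step_rtranclp_sym: "(step G a)\<^sup>*\<^sup>* u v \<Longrightarrow> (step G a)\<^sup>*\<^sup>* v u"
  by (induction rule: rtranclp_induct) (auto intro: step_sym converse_rtranclp_into_rtranclp)

lemma step_mono: "(step G a)\<^sup>*\<^sup>* u v \<Longrightarrow> G \<subseteq> G' \<Longrightarrow> a \<preceq> b \<Longrightarrow> (step G' b)\<^sup>*\<^sup>* u v"
proof (induction rule: rtranclp_induct)
  case (step y z)
  then have "step G' b y z" unfolding step_def using edvd_trans by blast
  then show ?case using step by (meson rtranclp.rtrancl_into_rtrancl)
qed auto

lemma linearly_connected_first:
  assumes "linearly_connected G" "u \<in> G" "v \<in> G" "u \<noteq> v" "u \<preceq> a" "v \<preceq> a"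
  shows "\<exists>w \<in> G. w \<preceq> a \<and> (\<exists>i j. adj i j v w)"
proof -
  have "(step G a)\<^sup>*\<^sup>* v u" using assms unfolding linearly_connected_def by blast
  then show ?thesis using assms(4) by (cases rule: converse_rtranclpE) (auto simp: step_def)
qed

text \<open>On a path from \<open>v\<close> to \<open>u\<close> among divisors of lcm(u, v), the
  first exchange gains a variable in which \<open>v\<close> is still below the lcm, so
  \<open>u\<close> exceeds \<open>v\<close> there.\<close>

lemma linearly_connected_lin_colon:
  assumes "linearly_connected G" "v \<in> G"
  shows "lin_colon (G - {v}) v"
  unfolding lin_colon_def
proof
  fix u assume u: "u \<in> G - {v}"
  \<comment> \<open>Subtraction truncates, so this is the lcm of \<open>u\<close> and
    \<open>v\<close>.\<close>
  let ?a = "v + (u - v)"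
  have "u \<preceq> ?a" "v \<preceq> ?a" by (auto simp: edvd_def lookup_add lookup_minus)
  then obtain w i j where w: "w \<in> G" "w \<preceq> ?a" "adj i j v w"
    using linearly_connected_first[OF assms(1) _ assms(2)] u by blast
  have "w \<diamondop> i \<le> ?a \<diamondop> i" using w by (simp add: edvd_def)
  then have "v \<diamondop> i < u \<diamondop> i" using adj_nth[OF w(3)] by (simp add: lookup_add lookup_minus)
  moreover have "w \<noteq> v" using w(3) adj_irrefl by blast
  ultimately show "\<exists>w \<in> G - {v}. \<exists>i j. adj i j v w \<and> v \<diamondop> i < u \<diamondop> i" using w by blast
qed

section \<open>Removing a corner\<close>

text \<open>The exchanges from \<open>v\<close> that remain possible inside \<open>G\<close> gain y
  for x, z for x or z for y, so \<open>v\<close> has at most three neighbours.\<close>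

definition corner :: "expo set \<Rightarrow> expo \<Rightarrow> 3 \<Rightarrow> 3 \<Rightarrow> 3 \<Rightarrow> bool" where
  "corner G v x y z \<longleftrightarrow> v \<in> G \<and> UNIV = {x, y, z} \<and> x \<noteq> y \<and> x \<noteq> z \<and> y \<noteq> z \<and>
    (\<forall>w \<in> G. \<forall>j. \<not> adj x j v w) \<and> (\<forall>w \<in> G. \<not> adj y z v w)"

lemma ex_corner:
  assumes "finite G" "G \<noteq> {}" and xyz: "UNIV = {x, y, z}" "x \<noteq> y" "x \<noteq> z" "y \<noteq> z"
  shows "\<exists>v. corner G v x y z \<and> (\<forall>u \<in> G. v \<diamondop> z \<le> u \<diamondop> z)"
proof -
  obtain v0 where v0: "v0 \<in> G" "\<forall>u \<in> G. v0 \<diamondop> z \<le> u \<diamondop> z"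
    using arg_min_if_finite[OF assms(1,2), of "\<lambda>u. u \<diamondop> z"] by (meson not_le)
  let ?R = "{u \<in> G. u \<diamondop> z = v0 \<diamondop> z}"
  have "finite ?R" "?R \<noteq> {}" using assms v0 by auto
  then obtain v where "v \<in> ?R" "v \<diamondop> x = Max ((\<lambda>u. u \<diamondop> x) ` ?R)"
    using Max_in[of "(\<lambda>u. u \<diamondop> x) ` ?R"] by fastforce
  then have v: "v \<in> G" "v \<diamondop> z = v0 \<diamondop> z" "\<And>u. u \<in> ?R \<Longrightarrow> u \<diamondop> x \<le> v \<diamondop> x"
    using \<open>finite ?R\<close> by auto
  have "\<not> adj x j v w" if w: "w \<in> G" for w j
  proof
    assume n: "adj x j v w"
    have "j \<noteq> x" using n by (auto simp: adj_def)
    then consider "j = z" | "j = y" using xyz(1) by auto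
    then show False
    proof cases
      case 1 then show False using adj_nth[OF n] v(2) v0(2) w by force
    next
      case 2
      then have "w \<diamondop> z = v0 \<diamondop> z" "v \<diamondop> x < w \<diamondop> x" using adj_nth[OF n] v(2) xyz(3,4) by auto
      then show False using v(3)[of w] w by simp
    qed
  qed
  moreover have "\<not> adj y z v w" if "w \<in> G" for w
    using adj_nth[of y z v w] v(2) v0(2) that by force
  ultimately show ?thesis unfolding corner_def using v v0 xyz by metis
qed

text \<open>If \<open>v z/x\<close> is not in \<open>G\<close>, then by \<open>no_socle\<close> neither is any divisor of \<open>(v z/x) z\<^sup>n\<close>: multiplying
  \<open>(v z/x) z\<^sup>n\<close> by \<open>x\<close> or \<open>y\<close> leads into the ideal, so multiplying by \<open>z\<close> cannot.\<close>

lemma corner_hole: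
  assumes soc: "no_socle d G" and deg: "\<And>u. u \<in> G \<Longrightarrow> mdeg u = d" and c: "v \<in> G"
    and xyz: "UNIV = {x, y, z}" "x \<noteq> y" "x \<noteq> z" "y \<noteq> z"
    and p: "p \<in> G" "adj y x v p" and h: "\<And>r. r \<in> G \<Longrightarrow> \<not> adj z x v r" and u: "u \<in> G"
  shows "v \<diamondop> x \<le> u \<diamondop> x \<or> v \<diamondop> y < u \<diamondop> y"
proof (rule ccontr)
  assume neg: "\<not> ?thesis"
  have "0 < v \<diamondop> x" using adj_nth[OF p(2)] by simp
  then obtain r where r: "adj z x v r" using adj_exists[of z x v] xyz(3) by blast
  have ra: "r \<diamondop> z = v \<diamondop> z + 1" "v \<diamondop> x = r \<diamondop> x + 1" "r \<diamondop> y = v \<diamondop> y"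
    using adj_nth[OF r] xyz(2,4) by auto
  have pa: "p \<diamondop> y = v \<diamondop> y + 1" "v \<diamondop> x = p \<diamondop> x + 1" "p \<diamondop> z = v \<diamondop> z"
    using adj_nth[OF p(2)] xyz(3,4) by auto
  have ex: "k = x \<or> k = y \<or> k = z" for k using xyz(1) by blast
  note ne = xyz(2-4) xyz(2-4)[symmetric]
  have out: "r + single z n \<notin> upset G" for n
  proof (induction n)
    case 0
    show ?case
    proof
      assume "r + single z 0 \<in> upset G"
      then obtain w where w: "w \<in> G" "w \<preceq> r" by (auto simp: upset_def)
      then have "w = r" using edvd_mdeg_eq deg c adj_mdeg[OF r] by simp
      then show False using h w r by blast
    qed
  next
    case (Suc n)
    let ?m = "r + single z n"
    have "d \<le> mdeg ?m" using adj_mdeg[OF r] deg[OF c] by (simp add: mdeg_add)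
    then obtain i where i: "?m + \<epsilon> i \<notin> upset G" using Suc soc unfolding no_socle_def by blast
    \<comment> \<open>As monomials, r x = v z and r y = p z, so multiplication by x or y reaches a
      multiple of \<open>v\<close> or of \<open>p\<close>.\<close>
    have "v \<diamondop> k \<le> (?m + \<epsilon> x) \<diamondop> k" for k
      using ex[of k] ne by (auto simp: expo_nth lookup_single ra)
    then have "v \<preceq> ?m + \<epsilon> x" by (simp add: edvd_def)
    then have "i \<noteq> x" using i c by (auto simp: upset_def)
    have "p \<diamondop> k \<le> (?m + \<epsilon> y) \<diamondop> k" for k
      using ex[of k] ne ra pa by (auto simp: expo_nth lookup_single)
    then have "p \<preceq> ?m + \<epsilon> y" by (simp add: edvd_def)
    then have "i \<noteq> y" using i p by (auto simp: upset_def)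
    then have "i = z" using \<open>i \<noteq> x\<close> ex by blast
    moreover have "?m + \<epsilon> z = r + single z (Suc n)"
      by (simp add: add.assoc single_add[symmetric])
    ultimately show ?case using i by simp
  qed
  \<comment> \<open>By the negated claim \<open>u\<close> is bounded by \<open>r\<close> in x and in
    y, so it divides r z^n with n its own z-exponent.\<close>
  have "u \<diamondop> k \<le> (r + single z (u \<diamondop> z)) \<diamondop> k" for k
    using ex[of k] ne neg ra by (auto simp: lookup_add lookup_single)
  then show False using out[of "u \<diamondop> z"] u by (auto simp: upset_def edvd_def)
qed

text \<open>Suppose that the corner \<open>v\<close> of the lowest z-row and the corner
  \<open>v'\<close> of the lowest y-row both fail. Since v z/y is a generator, \<open>v'\<close> has
  smaller y-exponent than \<open>v\<close>; the two holes then force equal x-exponents, and the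
  generator v' z/x falls into the hole of \<open>v\<close>.\<close>

lemma ex_good_corner:
  assumes "finite G" "G \<noteq> {}" "no_socle d G" and deg: "\<And>u. u \<in> G \<Longrightarrow> mdeg u = d"
  shows "\<exists>v x y z. corner G v x y z \<and>
    (\<forall>p \<in> G. \<forall>q \<in> G. adj y x v p \<longrightarrow> adj z y v q \<longrightarrow> (\<exists>r \<in> G. adj z x v r))"
proof (rule ccontr)
  assume neg: "\<not> ?thesis"
  obtain x y z :: 3 where xyz: "UNIV = {x, y, z}" "x \<noteq> y" "x \<noteq> z" "y \<noteq> z"
    using UNIV_3 distinct_3 by meson
  then have xzy: "UNIV = {x, z, y}" "z \<noteq> y" by blast+
  obtain v where v: "corner G v x y z" "\<forall>u \<in> G. v \<diamondop> z \<le> u \<diamondop> z"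
    using ex_corner[OF assms(1,2) xyz] by blast
  obtain v' where v': "corner G v' x z y" "\<forall>u \<in> G. v' \<diamondop> y \<le> u \<diamondop> y"
    using ex_corner[OF assms(1,2) xzy(1) xyz(3,2) xzy(2)] by blast
  obtain p q where p: "p \<in> G" "adj y x v p" and q: "q \<in> G" "adj z y v q" and h: "\<And>r. r \<in> G \<Longrightarrow> \<not> adj z x v r"
    using neg v(1) by blast
  obtain p' q' where p': "p' \<in> G" "adj z x v' p'" and h': "\<And>r. r \<in> G \<Longrightarrow> \<not> adj y x v' r"
    using neg v'(1) by blast
  have G: "v \<in> G" "v' \<in> G" using v v' unfolding corner_def by auto
  have hole: "v \<diamondop> x \<le> u \<diamondop> x \<or> v \<diamondop> y < u \<diamondop> y" if "u \<in> G" for u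
    by (rule corner_hole[OF assms(3) _ G(1) xyz p h that]) (use deg in auto)
  have hole': "v' \<diamondop> x \<le> u \<diamondop> x \<or> v' \<diamondop> z < u \<diamondop> z" if "u \<in> G" for u
    by (rule corner_hole[OF assms(3) _ G(2) xzy(1) xyz(3,2) xzy(2) p' h' that]) (use deg in auto)
  have "v' \<diamondop> y < v \<diamondop> y" using bspec[OF v'(2) q(1)] adj_nth[OF q(2)] by simp
  then have "v \<diamondop> x \<le> v' \<diamondop> x" using hole[OF G(2)] by auto
  moreover have "v' \<diamondop> x \<le> v \<diamondop> x" using hole'[OF G(1)] bspec[OF v(2) G(2)] by simp
  ultimately have "p' \<diamondop> x < v \<diamondop> x" using adj_nth[OF p'(2)] by simp
  moreover have "p' \<diamondop> y \<le> v \<diamondop> y" using \<open>v' \<diamondop> y < v \<diamondop> y\<close> adj_le[OF p'(2) xyz(4)] by simp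
  ultimately show False using hole[OF p'(1)] by auto
qed

text \<open>The neighbours v y/x and v z/x are adjacent, and so are v z/x and v z/y; the remaining
  pair is joined through v z/x, which \<open>good\<close> provides.\<close>

lemma link_connected:
  assumes c: "corner G v x y z"
    and good: "\<forall>p \<in> G. \<forall>q \<in> G. adj y x v p \<longrightarrow> adj z y v q \<longrightarrow> (\<exists>r \<in> G. adj z x v r)"
    and p: "p \<in> G" "p \<preceq> a" "adj i j v p" and q: "q \<in> G" "q \<preceq> a" "adj i' j' v q" and v: "v \<preceq> a"
  shows "(step (G - {v}) a)\<^sup>*\<^sup>* p q"
proof -
  let ?S = "step (G - {v}) a"
  have xyz: "x \<noteq> y" "x \<noteq> z" "y \<noteq> z" and U: "k = x \<or> k = y \<or> k = z" for k
    using c unfolding corner_def by (simp_all, blast)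
  have kinds: "(i = y \<and> j = x) \<or> (i = z \<and> j = x) \<or> (i = z \<and> j = y)" if "w \<in> G" "adj i j v w" for i j w
  proof -
    have "i \<noteq> j" using that by (simp add: adj_def)
    moreover have "i \<noteq> x" "\<not> (i = y \<and> j = z)" using c that unfolding corner_def by blast+
    ultimately show ?thesis using U[of i] U[of j] by auto
  qed
  have stepI: "?S u w" if "u \<in> G" "w \<in> G" "u \<preceq> a" "w \<preceq> a" "adj k l u w" "adj k' l' v u" "adj m n v w" for u w k l k' l' m n
  proof -
    have "u \<noteq> v" "w \<noteq> v" using that(6,7) adj_irrefl by blast+
    then show ?thesis using that(1-5) unfolding step_def by blast
  qed
  have yx_zx: "?S u w" if "u \<in> G" "w \<in> G" "u \<preceq> a" "w \<preceq> a" "adj y x v u" "adj z x v w" for u w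
  proof -
    have "w + \<epsilon> x + \<epsilon> y = u + \<epsilon> x + \<epsilon> z" using that(5,6) by (simp add: adj_def add_ac)
    then have "(w + \<epsilon> y) + \<epsilon> x = (u + \<epsilon> z) + \<epsilon> x" by (simp only: add_ac)
    then have "adj z y u w" using xyz(3) unfolding adj_def by (metis add_right_cancel)
    then show ?thesis using stepI[OF that(1-4) _ that(5,6)] by blast
  qed
  have zx_zy: "?S u w" if "u \<in> G" "w \<in> G" "u \<preceq> a" "w \<preceq> a" "adj z x v u" "adj z y v w" for u w
  proof -
    have "w + \<epsilon> y = u + \<epsilon> x" using that(5,6) by (simp add: adj_def)
    then have "adj x y u w" using xyz by (simp add: adj_def)
    then show ?thesis using stepI[OF that(1-4) _ that(5,6)] by blast
  qed
  have yx_zy: "?S\<^sup>*\<^sup>* u w" if h: "u \<in> G" "w \<in> G" "u \<preceq> a" "w \<preceq> a" "adj y x v u" "adj z y v w" for u w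
  proof -
    obtain r where r: "r \<in> G" "adj z x v r" using good h by blast
    \<comment> \<open>The monomial v z/x divides \<open>a\<close>: its z-exponent is that of v z/y,
      and its other exponents do not exceed those of \<open>v\<close>.\<close>
    have "r \<diamondop> k \<le> a \<diamondop> k" for k
    proof (cases "k = z")
      case True
      then have "r \<diamondop> k = w \<diamondop> k" using adj_nth[OF r(2)] adj_nth[OF h(6)] by simp
      then show ?thesis using h(4) by (simp add: edvd_def)
    next
      case False
      then show ?thesis using adj_le[OF r(2)] v le_trans unfolding edvd_def by blast
    qed
    then have "r \<preceq> a" by (simp add: edvd_def)
    then have "?S u r" "?S r w" using yx_zx[OF h(1) r(1) h(3) _ h(5) r(2)] zx_zy[OF r(1) h(2) _ h(4) r(2) h(6)] by blast+
    then show ?thesis by (rule converse_rtranclp_into_rtranclp[OF _ r_into_rtranclp])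
  qed
  from kinds[OF p(1,3)] kinds[OF q(1,3)] show ?thesis
  proof (elim disjE)
    assume k: "i = y \<and> j = x" "i' = y \<and> j' = x" then show ?thesis using adj_unique p q by blast
  next
    assume k: "i = y \<and> j = x" "i' = z \<and> j' = x" then show ?thesis using yx_zx p q by blast
  next
    assume k: "i = y \<and> j = x" "i' = z \<and> j' = y" then show ?thesis using yx_zy p q by blast
  next
    assume k: "i = z \<and> j = x" "i' = y \<and> j' = x" then show ?thesis
      using step_rtranclp_sym[OF r_into_rtranclp[of ?S, OF yx_zx]] p q by blast
  next
    assume k: "i = z \<and> j = x" "i' = z \<and> j' = x" then show ?thesis using adj_unique p q by blast
  next
    assume k: "i = z \<and> j = x" "i' = z \<and> j' = y" then show ?thesis using zx_zy p q by blast
  next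
    assume k: "i = z \<and> j = y" "i' = y \<and> j' = x" then show ?thesis using step_rtranclp_sym[OF yx_zy] p q by blast
  next
    assume k: "i = z \<and> j = y" "i' = z \<and> j' = x" then show ?thesis using step_rtranclp_sym[OF r_into_rtranclp[of ?S, OF zx_zy]] p q by blast
  next
    assume k: "i = z \<and> j = y" "i' = z \<and> j' = y" then show ?thesis using adj_unique p q by blast
  qed
qed

text \<open>A path through \<open>v\<close> enters and leaves it by neighbours, and
  \<open>link_connected\<close> joins these without \<open>v\<close>.\<close>

lemma linearly_connected_remove_corner:
  assumes c: "corner G v x y z"
    and good: "\<forall>p \<in> G. \<forall>q \<in> G. adj y x v p \<longrightarrow> adj z y v q \<longrightarrow> (\<exists>r \<in> G. adj z x v r)"
    and con: "linearly_connected G"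
  shows "linearly_connected (G - {v})"
  unfolding linearly_connected_def
proof (intro allI ballI impI)
  fix a u w assume u: "u \<in> G - {v}" "u \<preceq> a" and w: "w \<in> G - {v}" "w \<preceq> a"
  let ?S = "step (G - {v}) a"
  have "(step G a)\<^sup>*\<^sup>* u w" using con u w unfolding linearly_connected_def by blast
  \<comment> \<open>While the path stands at \<open>v\<close>, the invariant claims all neighbours
    of \<open>v\<close> below \<open>a\<close> at once, since the exit is not yet known.\<close>
  then have "(w \<noteq> v \<longrightarrow> ?S\<^sup>*\<^sup>* u w) \<and>
      (w = v \<longrightarrow> (\<forall>q \<in> G. q \<preceq> a \<longrightarrow> (\<exists>i j. adj i j v q) \<longrightarrow> ?S\<^sup>*\<^sup>* u q))"
  proof (induction rule: rtranclp_induct)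
    case base
    then show ?case using u by auto
  next
    case (step t t')
    obtain i j where n: "adj i j t t'" "t \<in> G" "t' \<in> G" "t \<preceq> a" "t' \<preceq> a"
      using step.hyps(2) by (auto simp: step_def)
    consider "t \<noteq> v" "t' \<noteq> v" | "t \<noteq> v" "t' = v" | "t = v" "t' \<noteq> v" using n adj_irrefl by blast
    then show ?case
    proof cases
      case 1
      then have "?S t t'" using n by (auto simp: step_def)
      then show ?thesis using 1 step.IH by (meson rtranclp.rtrancl_into_rtrancl)
    next
      case 2
      have "?S\<^sup>*\<^sup>* t q" if "q \<in> G" "q \<preceq> a" "adj k l v q" for q k l
        using link_connected[OF c good n(2,4) _ that] adj_sym[OF n(1)] n 2 by blast
      then show ?thesis using 2 step.IH by (meson rtranclp_trans)
    next
      case 3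
      then show ?thesis using step.IH n by blast
    qed
  qed
  then show "?S\<^sup>*\<^sup>* u w" using w by blast
qed

text \<open>A monomial m that leaves the ideal has \<open>v\<close> as its only divisor in
  \<open>G\<close>, and then m x stays outside as well. Otherwise the first step from
  \<open>v\<close> towards another divisor of m x would reach an x-exponent above that of m, hence
  above that of \<open>v\<close>, although no exchange at a corner gains x.\<close>

lemma no_socle_remove_corner:
  assumes c: "corner G v x y z" and con: "linearly_connected G" and soc: "no_socle d G"
  shows "no_socle d (G - {v})"
  unfolding no_socle_def
proof (intro allI impI)
  fix m assume m: "m \<notin> upset (G - {v})" "d \<le> mdeg m"
  show "\<exists>i. m + \<epsilon> i \<notin> upset (G - {v})"
  proof (cases "m \<in> upset G")
    case False
    then obtain i where "m + \<epsilon> i \<notin> upset G" using soc m unfolding no_socle_def by blast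
    then show ?thesis unfolding upset_def by blast
  next
    case True
    then have vm: "v \<preceq> m" "v \<in> G" using m unfolding upset_def by blast+
    have "m + \<epsilon> x \<notin> upset (G - {v})"
    proof
      assume "m + \<epsilon> x \<in> upset (G - {v})"
      then obtain w where w: "w \<in> G" "w \<noteq> v" "w \<preceq> m + \<epsilon> x" by (auto simp: upset_def)
      have "v \<preceq> m + \<epsilon> x" using vm edvd_add edvd_trans by blast
      then obtain t i j where t: "t \<in> G" "t \<preceq> m + \<epsilon> x" "adj i j v t"
        using linearly_connected_first[OF con w(1) vm(2) w(2,3)] by blast
      then have "t \<noteq> v" using adj_irrefl by blast
      then have "\<not> t \<preceq> m" using m t by (auto simp: upset_def)
      then have "t \<diamondop> x = m \<diamondop> x + 1" using edvd_plus_var t by blast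
      moreover have "i \<noteq> x" using c t unfolding corner_def by blast
      then have "t \<diamondop> x \<le> v \<diamondop> x" using adj_le[OF t(3), of x] by simp
      moreover have "v \<diamondop> x \<le> m \<diamondop> x" using vm by (simp add: edvd_def)
      ultimately show False by simp
    qed
    then show ?thesis ..
  qed
qed

text \<open>The list is in order of removal: its head is the last generator in the order of linear
  quotients.\<close>

fun lin_ordered :: "expo list \<Rightarrow> bool" where
  "lin_ordered [] = True" |
  "lin_ordered (v # us) = (lin_colon (set us) v \<and> lin_ordered us)"

lemma ex_lin_ordered:
  assumes "finite G" "\<And>u. u \<in> G \<Longrightarrow> mdeg u = d" "linearly_connected G" "no_socle d G"
  shows "\<exists>us. set us = G \<and> distinct us \<and> lin_ordered us"
  using assms
proof (induction "card G" arbitrary: G)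
  case 0
  then show ?case by auto
next
  case (Suc n)
  then have "G \<noteq> {}" by auto
  from ex_good_corner[OF Suc.prems(1) this Suc.prems(4) Suc.prems(2)]
  obtain v x y z where c: "corner G v x y z"
    and good: "\<forall>p \<in> G. \<forall>q \<in> G. adj y x v p \<longrightarrow> adj z y v q \<longrightarrow> (\<exists>r \<in> G. adj z x v r)" by blast
  then have v: "v \<in> G" by (simp add: corner_def)
  have "\<exists>us. set us = G - {v} \<and> distinct us \<and> lin_ordered us"
  proof (rule Suc.hyps(1))
    show "n = card (G - {v})" using Suc v by simp
  qed (use Suc.prems linearly_connected_remove_corner[OF c good] no_socle_remove_corner[OF c] in auto)
  then obtain us where "set us = G - {v}" "distinct us" "lin_ordered us" by blast
  then have "set (v # us) = G \<and> distinct (v # us) \<and> lin_ordered (v # us)"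
    using v linearly_connected_lin_colon[OF Suc.prems(3) v] by auto
  then show ?case by blast
qed

section \<open>Adding a generator with linear colon ideal\<close>

text \<open>The neighbour \<open>w\<close> of \<open>v\<close> supplied by \<open>lin_colon\<close>
  for \<open>u\<close> divides lcm(u, v), because its gained exponent is at most that of
  \<open>u\<close>. One step leads from \<open>v\<close> to \<open>w\<close>, and a path in
  \<open>G\<close> does the rest.\<close>

lemma linearly_connected_insert:
  assumes con: "linearly_connected G" and v: "lin_colon G v"
  shows "linearly_connected (insert v G)"
proof -
  let ?G = "insert v G"
  have path: "(step ?G a)\<^sup>*\<^sup>* v u" if u: "u \<in> G" "u \<preceq> a" and va: "v \<preceq> a" for u a
  proof -
    obtain w i j where w: "w \<in> G" "adj i j v w" "v \<diamondop> i < u \<diamondop> i" using v u unfolding lin_colon_def by blast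
    have "w \<diamondop> k \<le> a \<diamondop> k" for k
    proof (cases "k = i")
      case True
      then have "w \<diamondop> k \<le> u \<diamondop> k" using w adj_nth[OF w(2)] by simp
      then show ?thesis using u le_trans unfolding edvd_def by blast
    next
      case False
      then show ?thesis using adj_le[OF w(2)] va le_trans unfolding edvd_def by blast
    qed
    then have wa: "w \<preceq> a" by (simp add: edvd_def)
    then have "(step G a)\<^sup>*\<^sup>* w u" using con w u unfolding linearly_connected_def by blast
    then have "(step ?G a)\<^sup>*\<^sup>* w u" by (rule step_mono) auto
    moreover have "step ?G a v w" using w wa va by (auto simp: step_def)
    ultimately show ?thesis by (meson converse_rtranclp_into_rtranclp)
  qed
  show ?thesis unfolding linearly_connected_def
  proof (intro allI ballI impI)
    fix a u w assume "u \<in> ?G" "w \<in> ?G" "u \<preceq> a" "w \<preceq> a"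
    then consider "u = v" "w = v" | "u = v" "w \<in> G" | "u \<in> G" "w = v" | "u \<in> G" "w \<in> G" by blast
    then show "(step ?G a)\<^sup>*\<^sup>* u w"
    proof cases
      case 1 then show ?thesis by simp
    next
      case 2 then show ?thesis using path \<open>w \<preceq> a\<close> \<open>u \<preceq> a\<close> by blast
    next
      case 3 then show ?thesis using step_rtranclp_sym[OF path] \<open>w \<preceq> a\<close> \<open>u \<preceq> a\<close> by blast
    next
      case 4
      then have "(step G a)\<^sup>*\<^sup>* u w" using con \<open>w \<preceq> a\<close> \<open>u \<preceq> a\<close> unfolding linearly_connected_def by blast
      then show ?thesis by (rule step_mono) auto
    qed
  qed
qed

text \<open>A new socle monomial m would force v = m x_i for some i, of degree above
  \<open>d\<close>. The index i is one for which m x_i is outside the old ideal, hence divisible by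
  \<open>v\<close>; the divisors of the other m x_k in \<open>G\<close> force \<open>v\<close> to
  agree with m in variable k.\<close>

lemma no_socle_insert:
  assumes soc: "no_socle d G" and v: "lin_colon G v" "mdeg v = d"
  shows "no_socle d (insert v G)"
  unfolding no_socle_def
proof (intro allI impI, rule ccontr)
  let ?G = "insert v G"
  fix m assume m: "m \<notin> upset ?G" "d \<le> mdeg m" and "\<nexists>i. m + \<epsilon> i \<notin> upset ?G"
  then have all: "m + \<epsilon> i \<in> upset ?G" for i by blast
  have "m \<notin> upset G" "\<not> v \<preceq> m" using m by (auto simp: upset_def)
  then obtain i where i: "m + \<epsilon> i \<notin> upset G" using soc m unfolding no_socle_def by blast
  then have vi: "v \<preceq> m + \<epsilon> i" using all[of i] by (auto simp: upset_def)
  then have vmi: "v \<diamondop> i = m \<diamondop> i + 1" using edvd_plus_var \<open>\<not> v \<preceq> m\<close> by blast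
  have le: "v \<diamondop> k \<le> m \<diamondop> k" if "k \<noteq> i" for k
    using vi that unfolding edvd_def by (metis add.right_neutral expo_nth(1) expo_var_nth(1))
  have eq: "v \<diamondop> k = m \<diamondop> k" if k: "k \<noteq> i" for k
  proof -
    have "\<not> v \<preceq> m + \<epsilon> k" using vmi k by (auto simp: edvd_def expo_nth intro!: exI[of _ i])
    then obtain w where w: "w \<in> G" "w \<preceq> m + \<epsilon> k" using all[of k] by (auto simp: upset_def)
    obtain t s s' where t: "t \<in> G" "adj s s' v t" "v \<diamondop> s < w \<diamondop> s"
      using v(1) w unfolding lin_colon_def by blast
    have ws: "w \<diamondop> l \<le> m \<diamondop> l + (if l = k then 1 else 0)" for l
      using w(2) unfolding edvd_def by (auto simp: expo_nth dest: spec[of _ l])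
    have "s \<noteq> i" using ws[of i] k t(3) vmi by auto
    have "\<not> t \<preceq> m + \<epsilon> i" using i t by (auto simp: upset_def)
    then obtain l where l: "(m + \<epsilon> i) \<diamondop> l < t \<diamondop> l" unfolding edvd_def by (meson not_le)
    \<comment> \<open>As \<open>v\<close> divides m x_i, its neighbour \<open>t\<close> can fail to
      do so only in the gained variable \<open>s\<close>. The bounds at \<open>s\<close> then leave
      only \<open>s = k\<close>.\<close>
    have "l = s"
    proof (rule ccontr)
      assume "l \<noteq> s"
      then have "t \<diamondop> l \<le> v \<diamondop> l" using adj_le t by blast
      then show False using l vi unfolding edvd_def by (meson le_trans not_le)
    qed
    then have "m \<diamondop> s < v \<diamondop> s + 1" using l adj_nth[OF t(2)] \<open>s \<noteq> i\<close> by (simp add: expo_nth)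
    then show ?thesis using ws[of s] t(3) le[OF \<open>s \<noteq> i\<close>] by (auto split: if_splits)
  qed
  have "v = m + \<epsilon> i"
    by (rule poly_mapping_eqI) (use eq vmi in \<open>auto simp: expo_nth\<close>)
  then show False using v m by (simp add: mdeg_add)
qed

lemma lin_ordered_properties:
  assumes "lin_ordered us" "\<And>u. u \<in> set us \<Longrightarrow> mdeg u = d"
  shows "linearly_connected (set us) \<and> no_socle d (set us)"
  using assms
proof (induction us)
  case Nil
  then show ?case by (simp add: linearly_connected_def no_socle_def upset_def)
next
  case (Cons v us)
  then show ?case using linearly_connected_insert no_socle_insert by auto
qed

section \<open>The upper Koszul complex\<close>

text \<open>The \<open>1\<close>-skeleton of the upper Koszul complex at \<open>a\<close>: its faces are the squarefree \<open>t\<close> for which \<open>a/t\<close>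
  lies in the ideal.\<close>

definition sq_edge :: "expo set \<Rightarrow> expo \<Rightarrow> 3 \<Rightarrow> 3 \<Rightarrow> bool" where
  "sq_edge G a i j \<longleftrightarrow> i \<noteq> j \<and> (\<exists>u \<in> G. u + \<epsilon> i + \<epsilon> j \<preceq> a)"

text \<open>This is the vanishing of reduced homology in degree 0. For \<open>a\<close> of degree d
  + 1 the complex consists of isolated vertices, which account for the linear syzygies; so the
  condition starts at d + 2.\<close>

definition sq_connected :: "nat \<Rightarrow> expo set \<Rightarrow> bool" where
  "sq_connected d G \<longleftrightarrow> (\<forall>a. d + 2 \<le> mdeg a \<longrightarrow> (\<forall>i j. (\<exists>u \<in> G. u + \<epsilon> i \<preceq> a) \<longrightarrow> (\<exists>u \<in> G. u + \<epsilon> j \<preceq> a) \<longrightarrow>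
    (sq_edge G a)\<^sup>*\<^sup>* i j))"

lemma edvd_add_two_vars: "u + \<epsilon> i \<preceq> a \<Longrightarrow> u + \<epsilon> j \<preceq> a \<Longrightarrow> i \<noteq> j \<Longrightarrow> u + \<epsilon> i + \<epsilon> j \<preceq> a"
  unfolding edvd_add_var by (simp add: expo_nth)

text \<open>For one generator u, the variables i with u x_i dividing \<open>a\<close> are pairwise
  joined. An exchange from t to t' stays in the component: as \<open>a\<close> has degree at least d
  + 2, a further variable c fits, and c is a vertex for both t and t'.\<close>

lemma linearly_connected_sq_connected:
  assumes con: "linearly_connected G" and deg: "\<And>u. u \<in> G \<Longrightarrow> mdeg u = d"
  shows "sq_connected d G"
  unfolding sq_connected_def
proof (intro allI impI)
  fix a i j assume a: "d + 2 \<le> mdeg a" and "\<exists>u \<in> G. u + \<epsilon> i \<preceq> a" "\<exists>u \<in> G. u + \<epsilon> j \<preceq> a"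
  then obtain u v where u: "u \<in> G" "u + \<epsilon> i \<preceq> a" and v: "v \<in> G" "v + \<epsilon> j \<preceq> a" by blast
  let ?E = "sq_edge G a"
  have same: "?E\<^sup>*\<^sup>* k l" if "t \<in> G" "t + \<epsilon> k \<preceq> a" "t + \<epsilon> l \<preceq> a" for t k l
  proof (cases "k = l")
    case False
    then have "?E k l" using edvd_add_two_vars that unfolding sq_edge_def by blast
    then show ?thesis by blast
  qed simp
  have "u \<preceq> a" "v \<preceq> a" using u v edvd_add_var by blast+
  then have "(step G a)\<^sup>*\<^sup>* u v" using con u v unfolding linearly_connected_def by blast
  then have "\<forall>l. v + \<epsilon> l \<preceq> a \<longrightarrow> ?E\<^sup>*\<^sup>* i l"
  proof (induction rule: rtranclp_induct)
    case base
    then show ?case using same u by blast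
  next
    case (step t t')
    obtain k l where n: "adj k l t t'" and G: "t \<in> G" "t' \<in> G" "t \<preceq> a" "t' \<preceq> a"
      using step.hyps(2) by (auto simp: step_def)
    have "t \<diamondop> k < t' \<diamondop> k" using adj_nth[OF n] by simp
    then have "t + \<epsilon> k \<preceq> a" using G unfolding edvd_add_var by (auto simp: edvd_def intro: less_le_trans)
    moreover have "mdeg (t + \<epsilon> k) < mdeg a" using deg[OF G(1)] a by (simp add: mdeg_add)
    ultimately obtain c where c: "t + \<epsilon> k + \<epsilon> c \<preceq> a" using edvd_strict by blast
    then have "(t + \<epsilon> c) + \<epsilon> k \<preceq> a" by (simp add: add_ac)
    then have "t + \<epsilon> c \<preceq> a" by (rule edvd_trans[OF edvd_add(1)])
    then have ic: "?E\<^sup>*\<^sup>* i c" using step.IH by blast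
    have "(t' + \<epsilon> c) + \<epsilon> l = (t' + \<epsilon> l) + \<epsilon> c" by (simp only: add_ac)
    also have "\<dots> = t + \<epsilon> k + \<epsilon> c" using n unfolding adj_def by metis
    finally have "(t' + \<epsilon> c) + \<epsilon> l \<preceq> a" using c by metis
    then have "t' + \<epsilon> c \<preceq> a" by (rule edvd_trans[OF edvd_add(1)])
    then have "?E\<^sup>*\<^sup>* c m" if "t' + \<epsilon> m \<preceq> a" for m using same G that by blast
    then show ?case using ic rtranclp_trans[of ?E i c] by blast
  qed
  then show "?E\<^sup>*\<^sup>* i j" using v by blast
qed

text \<open>Generators with a common vertex k both divide a / x_k and are joined by induction on the
  degree of \<open>a\<close>. An edge from k to l comes from one generator having both vertices, so
  a path of vertices can be followed. In degree d + 1 two distinct divisors differ by one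
  exchange.\<close>

lemma sq_connected_linearly_connected:
  assumes con: "sq_connected d G" and deg: "\<And>u. u \<in> G \<Longrightarrow> mdeg u = d"
  shows "linearly_connected G"
proof -
  have "(step G a)\<^sup>*\<^sup>* u v" if "u \<in> G" "v \<in> G" "u \<preceq> a" "v \<preceq> a" for a u v
    using that
  proof (induction "mdeg a" arbitrary: a u v rule: less_induct)
    case less
    have d: "mdeg u = d" "mdeg v = d" using deg less.prems by auto
    have "d \<le> mdeg a" using mdeg_mono less.prems d by metis
    then consider "mdeg a = d" | "mdeg a = d + 1" | "d + 2 \<le> mdeg a" by linarith
    then show ?case
    proof cases
      case 1
      then have "u = a" "v = a" using edvd_mdeg_eq less.prems d by simp_all
      then show ?thesis by simp
    next
      case 2
      then obtain i j where ij: "u + \<epsilon> i \<preceq> a" "v + \<epsilon> j \<preceq> a"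
        using edvd_strict[of u a] edvd_strict[of v a] less.prems d by auto
      then have eq: "u + \<epsilon> i = a" "v + \<epsilon> j = a"
        using edvd_mdeg_eq[OF ij(1)] edvd_mdeg_eq[OF ij(2)] 2 d by (simp_all add: mdeg_add)
      show ?thesis
      proof (cases "i = j")
        case True
        then have "u = v" using eq by (metis add_right_cancel)
        then show ?thesis by simp
      next
        case False
        then have "step G a u v" using eq less.prems unfolding step_def adj_def by metis
        then show ?thesis by blast
      qed
    next
      case 3
      then obtain i j where ij: "u + \<epsilon> i \<preceq> a" "v + \<epsilon> j \<preceq> a"
        using edvd_strict[of u a] edvd_strict[of v a] less.prems d by auto
      have sub: "(step G a)\<^sup>*\<^sup>* s t" if "s \<in> G" "t \<in> G" "s + \<epsilon> k \<preceq> a" "t + \<epsilon> k \<preceq> a" for s t k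
      proof -
        have "\<epsilon> k \<preceq> a" using that(3) edvd_add edvd_trans by blast
        then obtain b where b: "a = b + \<epsilon> k" unfolding edvd_iff by (metis add.commute)
        then have "s \<preceq> b" "t \<preceq> b" using that(3,4) by (simp_all add: edvd_def lookup_add)
        moreover have "mdeg b < mdeg a" by (simp add: b mdeg_add)
        ultimately have "(step G b)\<^sup>*\<^sup>* s t" using less.hyps that by blast
        then show ?thesis by (rule step_mono) (simp_all add: b edvd_add)
      qed
      have "(sq_edge G a)\<^sup>*\<^sup>* i j" using con 3 ij less.prems unfolding sq_connected_def by blast
      then have "\<forall>t \<in> G. t + \<epsilon> j \<preceq> a \<longrightarrow> (step G a)\<^sup>*\<^sup>* u t"
      proof (induction rule: rtranclp_induct)
        case base
        then show ?case using sub less.prems ij by blast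
      next
        case (step k l)
        then obtain w where w: "w \<in> G" "w + \<epsilon> k + \<epsilon> l \<preceq> a" unfolding sq_edge_def by blast
        then have "w + \<epsilon> k \<preceq> a" "(w + \<epsilon> l) + \<epsilon> k \<preceq> a" using edvd_add_var by (blast, simp add: add_ac)
        then have wl: "w + \<epsilon> l \<preceq> a" and uw: "(step G a)\<^sup>*\<^sup>* u w" using edvd_add_var step.IH w by blast+
        show ?case
        proof (intro ballI impI)
          fix t assume "t \<in> G" "t + \<epsilon> l \<preceq> a"
          then have "(step G a)\<^sup>*\<^sup>* w t" using sub w wl by blast
          then show "(step G a)\<^sup>*\<^sup>* u t" using uw by (rule rtranclp_trans[rotated])
        qed
      qed
      then show ?thesis using less.prems ij by blast
    qed
  qed
  then show ?thesis unfolding linearly_connected_def by blast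
qed

section \<open>Homogeneous polynomials and monomial ideals\<close>

text \<open>Interpreting \<open>module\<close> would declare \<open>scale_scale\<close> as a simp rule, which loops with
  \<open>algebra_simps\<close>; hence only the facts needed are instantiated.\<close>

lemma module_times: "Modules.module ((*) :: 'a::comm_ring_1 \<Rightarrow> 'a \<Rightarrow> 'a)"
  by unfold_locales (simp_all add: algebra_simps)

lemmas ideal_span_induct = Modules.module.span_induct_alt[OF module_times, consumes 1, case_names base step]
  and ideal_span_sum = Modules.module.span_sum[OF module_times]
  and ideal_span_scale = Modules.module.span_scale[OF module_times]
  and ideal_span_base = Modules.module.span_base[OF module_times]

lemma poly_sum_singles: "(\<Sum>m \<in> keys f. single m (coeff f m)) = f"
  by (rule poly_mapping_eqI) (simp add: lookup_sum lookup_single when_def in_keys_iff sum.delta)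

lemma lookup_single_times:
  fixes f :: "'k::field poly3"
  shows "coeff (single u c * f) m =
    (if u \<preceq> m then c * coeff f (m - u) else 0)"
proof -
  have "single u c * f =
      (\<Sum>w \<in> keys f. single (u + w) (c * coeff f w))"
    by (subst poly_sum_singles[symmetric, of f]) (simp add: sum_distrib_left mult_single)
  then have *: "coeff (single u c * f) m =
      (\<Sum>w \<in> keys f. if u + w = m then c * coeff f w else 0)"
    by (simp add: lookup_sum lookup_single when_def)
  show ?thesis
  proof (cases "u \<preceq> m")
    case True
    then have "u + w = m \<longleftrightarrow> m - u = w" for w using edvd_diff[OF True] by auto
    then show ?thesis using True unfolding * by (simp add: sum.delta' in_keys_iff)
  next
    case False
    then have "u + w \<noteq> m" for w using edvd_add by blast
    then show ?thesis using False unfolding * by simp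
  qed
qed

lemma Var_single: "Var i = single (\<epsilon> i) 1"
  by (simp add: Var_def monomial_def)

lemma lookup_Var_times: "coeff (Var i * f) (m + \<epsilon> i) = coeff f m"
  unfolding Var_single lookup_single_times by (simp add: edvd_add)

lemma lookup_Var_times': "\<not> \<epsilon> i \<preceq> m \<Longrightarrow> coeff (Var i * f) m = 0"
  unfolding Var_single lookup_single_times by simp

lemma Var_edvd: "\<epsilon> i \<preceq> m \<longleftrightarrow> 0 < m \<diamondop> i"
  by (auto simp: edvd_def expo_nth Suc_le_eq split: if_splits)

lemma keys_Var_times: "m \<in> keys (Var i * f) \<longleftrightarrow> (\<exists>w \<in> keys f. m = w + \<epsilon> i)"
proof (cases "\<epsilon> i \<preceq> m")
  case True
  then obtain w where "m = w + \<epsilon> i" unfolding edvd_iff by (metis add.commute)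
  then show ?thesis by (auto simp: in_keys_iff lookup_Var_times[simplified])
next
  case False
  then show ?thesis using lookup_Var_times'[of i m f] edvd_add by (auto simp: in_keys_iff)
qed

lemma Var_times_cancel: "Var i * f = Var i * g \<Longrightarrow> f = g"
  by (rule poly_mapping_eqI) (metis lookup_Var_times)

section \<open>Parts of a polynomial, division by a variable, exactness of the Koszul complex of
  S\<close>

definition restrict_keys :: "(expo \<Rightarrow> bool) \<Rightarrow> 'k::field poly3 \<Rightarrow> 'k poly3" where
  "restrict_keys P f = Poly_Mapping.mapp (\<lambda>m c. c when P m) f"

lemma lookup_restrict: "coeff (restrict_keys P f) m = (if P m then coeff f m else 0)"
  by (auto simp: restrict_keys_def lookup_mapp when_def in_keys_iff)

lemma keys_restrict: "keys (restrict_keys P f) = {m \<in> keys f. P m}"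
  by (auto simp: in_keys_iff lookup_restrict split: if_splits)

lemma restrict_add: "restrict_keys P (f + g) = restrict_keys P f + restrict_keys P g"
  by (rule poly_mapping_eqI) (simp add: lookup_restrict lookup_add)

lemma restrict_split: "f = restrict_keys P f + restrict_keys (\<lambda>m. \<not> P m) f"
  by (rule poly_mapping_eqI) (simp add: lookup_restrict lookup_add)

lemma restrict_0 [simp]: "restrict_keys P 0 = 0"
  by (rule poly_mapping_eqI) (simp add: lookup_restrict)

lemma restrict_sum: "restrict_keys P (sum f A) = (\<Sum>a \<in> A. restrict_keys P (f a))"
  by (induction A rule: infinite_finite_induct) (simp_all add: restrict_add)

definition div_var :: "3 \<Rightarrow> 'k::field poly3 \<Rightarrow> 'k poly3" where
  "div_var i f = Poly_Mapping.map_key (\<lambda>m. m + \<epsilon> i) f"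

lemma lookup_div_var: "coeff (div_var i f) m = coeff f (m + \<epsilon> i)"
proof -
  have "inj (\<lambda>m::expo. m + \<epsilon> i)" by (simp add: inj_def)
  then show ?thesis unfolding div_var_def by (simp add: map_key.rep_eq)
qed

lemma Var_times_div_var:
  assumes "\<And>m. m \<in> keys f \<Longrightarrow> 0 < m \<diamondop> i"
  shows "Var i * div_var i f = f"
proof (rule poly_mapping_eqI)
  fix m
  show "coeff (Var i * div_var i f) m = coeff f m"
  proof (cases "\<epsilon> i \<preceq> m")
    case True
    then obtain w where "m = w + \<epsilon> i" unfolding edvd_iff by (metis add.commute)
    then show ?thesis by (simp only: lookup_Var_times lookup_div_var)
  next
    case False
    then have "m \<notin> keys f" using assms Var_edvd by metis
    then show ?thesis using lookup_Var_times'[OF False, of "div_var i f"] by (simp add: in_keys_iff)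
  qed
qed

definition homog :: "int \<Rightarrow> 'k::field poly3 set" where
  "homog e = {f. \<forall>m \<in> keys f. int (mdeg m) = e}"

lemma homog_0 [simp]: "0 \<in> homog e"
  by (simp add: homog_def)

lemma homog_add: "f \<in> homog e \<Longrightarrow> g \<in> homog e \<Longrightarrow> f + g \<in> homog e"
  using keys_add[of f g] by (auto simp: homog_def)

lemma homog_uminus: "f \<in> homog e \<Longrightarrow> - f \<in> homog e"
  by (simp add: homog_def in_keys_iff)

lemma homog_diff: "f \<in> homog e \<Longrightarrow> g \<in> homog e \<Longrightarrow> f - g \<in> homog e"
  using homog_add[OF _ homog_uminus, of f e g] by simp

lemma homog_Var: "f \<in> homog (e - 1) \<Longrightarrow> Var i * f \<in> homog e"
  by (auto simp: homog_def keys_Var_times mdeg_add)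

lemma homog_div_var: "f \<in> homog e \<Longrightarrow> div_var i f \<in> homog (e - 1)"
proof -
  assume f: "f \<in> homog e"
  have "int (mdeg m) = e - 1" if "m \<in> keys (div_var i f)" for m
  proof -
    have "m + \<epsilon> i \<in> keys f" using that by (simp only: in_keys_iff lookup_div_var not_False_eq_True)
    then show ?thesis using f by (auto simp: homog_def mdeg_add)
  qed
  then show ?thesis by (simp add: homog_def)
qed

lemma homog_restrict: "f \<in> homog e \<Longrightarrow> restrict_keys P f \<in> homog e"
  by (simp add: homog_def keys_restrict)

lemma homog_neg: "f \<in> homog e \<Longrightarrow> e < 0 \<Longrightarrow> f = 0"
  by (auto simp: homog_def simp flip: keys_eq_empty)

text \<open>Every nonconstant monomial is assigned to the first variable that divides it.\<close>

lemma Var_decompose: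
  assumes f: "f \<in> homog e" and 0: "coeff f 0 = 0"
  shows "\<exists>a \<in> homog (e - 1). \<exists>b \<in> homog (e - 1). \<exists>c \<in> homog (e - 1). f = Var 0 * a + Var 1 * b + Var 2 * c"
proof -
  let ?f0 = "restrict_keys (\<lambda>m. 0 < m \<diamondop> 0) f"
  let ?g = "restrict_keys (\<lambda>m. \<not> 0 < m \<diamondop> 0) f"
  let ?f1 = "restrict_keys (\<lambda>m. 0 < m \<diamondop> 1) ?g"
  let ?f2 = "restrict_keys (\<lambda>m. \<not> 0 < m \<diamondop> 1) ?g"
  have "Var 0 * div_var 0 ?f0 = ?f0" "Var 1 * div_var 1 ?f1 = ?f1"
    by (rule Var_times_div_var; simp add: keys_restrict)+
  moreover have "Var 2 * div_var 2 ?f2 = ?f2"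
  proof (rule Var_times_div_var)
    fix m assume "m \<in> keys ?f2"
    then have m: "m \<in> keys f" "m \<diamondop> 0 = 0" "m \<diamondop> 1 = 0" by (auto simp: keys_restrict)
    then have "m \<noteq> 0" using 0 by (auto simp: in_keys_iff)
    then obtain i where "m \<diamondop> i \<noteq> 0" using poly_mapping_eqI[of m 0] by auto
    then show "0 < m \<diamondop> 2" using m UNIV_3 by (metis UNIV_I gr0I insertE singletonD)
  qed
  moreover have "f = ?f0 + ?f1 + ?f2"
    using restrict_split[of f "\<lambda>m. 0 < m \<diamondop> 0"] restrict_split[of ?g "\<lambda>m. 0 < m \<diamondop> 1"] by (simp add: add.assoc)
  ultimately have "f = Var 0 * div_var 0 ?f0 + Var 1 * div_var 1 ?f1 + Var 2 * div_var 2 ?f2" by simp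
  moreover have "div_var 0 ?f0 \<in> homog (e - 1)" "div_var 1 ?f1 \<in> homog (e - 1)" "div_var 2 ?f2 \<in> homog (e - 1)"
    using f by (auto intro: homog_div_var homog_restrict)
  ultimately show ?thesis by blast
qed

lemma Var_coprime:
  assumes a: "a \<in> homog e" and eq: "Var i * a = Var j * b" and ij: "i \<noteq> j"
  shows "\<exists>c \<in> homog (e - 1). a = Var j * c"
proof -
  have "0 < m \<diamondop> j" if "m \<in> keys a" for m
  proof -
    have "m + \<epsilon> i \<in> keys (Var j * b)" using that keys_Var_times eq by metis
    then have "\<epsilon> j \<preceq> m + \<epsilon> i" using keys_Var_times edvd_add by metis
    then show ?thesis using ij unfolding Var_edvd by (simp add: expo_nth)
  qed
  then have "a = Var j * div_var j a" using Var_times_div_var by metis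
  then show ?thesis using homog_div_var[OF a] by blast
qed

text \<open>Monomials of \<open>a\<close> prime to variable \<open>j\<close> are divisible by
  variable \<open>k\<close>, since x_i a lies in (x_j, x_k); this splits \<open>a\<close>. After
  substitution, coprimality of x_j and x_k yields \<open>t\<close>, and cancellation the last
  equation.\<close>

lemma Var_koszul:
  assumes h: "a \<in> homog e" "b \<in> homog e" "c \<in> homog e" and eq: "Var i * a + Var j * b + Var k * c = 0"
    and ij: "i \<noteq> j" "i \<noteq> k" "j \<noteq> k"
  shows "\<exists>r \<in> homog (e - 1). \<exists>s \<in> homog (e - 1). \<exists>t \<in> homog (e - 1).
    a = Var j * r + Var k * s \<and> b = Var k * t - Var i * r \<and> c = - Var i * s - Var j * t"
proof -
  let ?a1 = "restrict_keys (\<lambda>m. 0 < m \<diamondop> j) a" and ?a2 = "restrict_keys (\<lambda>m. \<not> 0 < m \<diamondop> j) a"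
  let ?r = "div_var j ?a1" and ?s = "div_var k ?a2"
  have "Var j * ?r = ?a1" by (rule Var_times_div_var) (simp add: keys_restrict)
  moreover have "Var k * ?s = ?a2"
  proof (rule Var_times_div_var)
    fix m assume m: "m \<in> keys ?a2"
    then have "m \<in> keys a" "m \<diamondop> j = 0" by (auto simp: keys_restrict)
    then have "m + \<epsilon> i \<in> keys (Var i * a)" using keys_Var_times by blast
    moreover have "Var i * a = - (Var j * b) - Var k * c" using eq by (simp add: algebra_simps eq_neg_iff_add_eq_0)
    ultimately have "m + \<epsilon> i \<in> keys (Var j * b) \<or> m + \<epsilon> i \<in> keys (Var k * c)"
      by (auto simp: in_keys_iff lookup_minus)
    then have "\<epsilon> j \<preceq> m + \<epsilon> i \<or> \<epsilon> k \<preceq> m + \<epsilon> i" using keys_Var_times edvd_add by metis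
    then show "0 < m \<diamondop> k" using ij \<open>m \<diamondop> j = 0\<close> unfolding Var_edvd by (auto simp: expo_nth)
  qed
  ultimately have "a = Var j * ?r + Var k * ?s" using restrict_split[of a] by metis
  moreover have "?r \<in> homog (e - 1)" "?s \<in> homog (e - 1)" using h by (auto intro: homog_div_var homog_restrict)
  ultimately obtain r s where r: "r \<in> homog (e - 1)" and s: "s \<in> homog (e - 1)" and a: "a = Var j * r + Var k * s"
    by blast
  have eq': "Var j * (b + Var i * r) = Var k * (- c - Var i * s)"
  proof -
    have "Var j * (b + Var i * r) - Var k * (- c - Var i * s) = Var i * a + Var j * b + Var k * c"
      unfolding a by (simp add: algebra_simps)
    then show ?thesis using eq by simp
  qed
  have "b + Var i * r \<in> homog e" using h r by (intro homog_add homog_Var)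
  then obtain t where t: "t \<in> homog (e - 1)" "b + Var i * r = Var k * t" using Var_coprime[OF _ eq'] ij by blast
  then have "Var k * (Var j * t) = Var k * (- c - Var i * s)"
    using eq' by (simp add: mult.left_commute)
  then have "Var j * t = - c - Var i * s" by (rule Var_times_cancel)
  then have "c = - Var i * s - Var j * t" by simp
  moreover have "b = Var k * t - Var i * r" using t(2) by (simp add: algebra_simps)
  ultimately show ?thesis using a r s t by blast
qed

lemma in_ideal_gen_monomial: "f \<in> ideal_gen (monomial ` G) \<longleftrightarrow> keys f \<subseteq> upset G"
proof
  assume "f \<in> ideal_gen (monomial ` G)"
  then show "keys f \<subseteq> upset G"
  proof (induction rule: ideal_span_induct)
    case base
    then show ?case by simp
  next
    case (step c b f)
    then obtain u where u: "u \<in> G" "b = monomial u" by blast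
    have "keys (c * b) \<subseteq> upset G"
    proof
      fix m assume "m \<in> keys (c * b)"
      then have "u \<preceq> m" unfolding u monomial_def mult.commute[of c]
        by (auto simp: in_keys_iff lookup_single_times split: if_splits)
      then show "m \<in> upset G" using u by (auto simp: upset_def)
    qed
    then show ?case using step keys_add[of "c * b" f] by blast
  qed
next
  assume k: "keys f \<subseteq> upset G"
  have "(\<Sum>m \<in> keys f. single m (coeff f m)) \<in> ideal_gen (monomial ` G)"
  proof (rule ideal_span_sum)
    fix m assume "m \<in> keys f"
    then obtain u where u: "u \<in> G" "u \<preceq> m" using k by (auto simp: upset_def)
    then have "single m (coeff f m) =
        single (m - u) (coeff f m) * monomial u"
      using edvd_diff[OF u(2)] by (simp add: monomial_def mult_single add.commute)
    moreover have "\<dots> \<in> ideal_gen (monomial ` G)" using u by (intro ideal_span_scale ideal_span_base) auto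
    ultimately show "single m (coeff f m) \<in> ideal_gen (monomial ` G)" by simp
  qed
  then show "f \<in> ideal_gen (monomial ` G)" by (simp only: poly_sum_singles)
qed

section \<open>Minimal graded free resolutions as Koszul chases\<close>

text \<open>Vectors become functions on all of \<open>nat\<close>, zero beyond their length. In this
  form the free modules of all ranks share one type with pointwise ring operations, as the locale
  demands of \<open>'v\<close>, and a variable acts as a constant function.\<close>

definition mat_fun :: "'k::field poly3 mat \<Rightarrow> (nat \<Rightarrow> 'k poly3) \<Rightarrow> nat \<Rightarrow> 'k poly3" where
  "mat_fun A v = (\<lambda>k. if k < dim_row A then \<Sum>l<dim_col A. A $$ (k, l) * v l else 0)"

lemma restrict_all: "(\<And>m. m \<in> keys f \<Longrightarrow> P m) \<Longrightarrow> restrict_keys P f = f"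
  by (rule poly_mapping_eqI) (auto simp: lookup_restrict in_keys_iff)

lemma restrict_none: "(\<And>m. m \<in> keys f \<Longrightarrow> \<not> P m) \<Longrightarrow> restrict_keys P f = 0"
  by (rule poly_mapping_eqI) (auto simp: lookup_restrict in_keys_iff)

text \<open>Multiplication by a homogeneous element shifts degrees; the predicates \<open>P\<close>
  and \<open>Q\<close> leave open which grading is meant, so that standard and multigraded
  components are covered alike.\<close>

lemma restrict_times:
  assumes PQ: "\<And>u w. u \<in> keys a \<Longrightarrow> P (u + w) \<longleftrightarrow> Q w"
  shows "restrict_keys P (a * f) = a * restrict_keys Q f"
proof -
  let ?f1 = "restrict_keys Q f" and ?f2 = "restrict_keys (\<lambda>m. \<not> Q m) f"
  have "a * f = a * ?f1 + a * ?f2" using restrict_split[of f Q] by (metis distrib_left)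
  moreover have "restrict_keys P (a * ?f1) = a * ?f1"
  proof (rule restrict_all)
    fix m assume "m \<in> keys (a * ?f1)"
    then obtain u w where "m = u + w" "u \<in> keys a" "w \<in> keys ?f1"
      using keys_mult[of a ?f1] by blast
    then show "P m" using PQ by (simp add: keys_restrict)
  qed
  moreover have "restrict_keys P (a * ?f2) = 0"
  proof (rule restrict_none)
    fix m assume "m \<in> keys (a * ?f2)"
    then obtain u w where "m = u + w" "u \<in> keys a" "w \<in> keys ?f2"
      using keys_mult[of a ?f2] by blast
    then show "\<not> P m" using PQ by (simp add: keys_restrict)
  qed
  ultimately show ?thesis by (simp add: restrict_add)
qed

lemma mat_fun_restrict:
  assumes PQ: "\<And>k l u w. k < dim_row A \<Longrightarrow> l < dim_col A \<Longrightarrow> u \<in> keys (A $$ (k, l)) \<Longrightarrow>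
    P k (u + w) \<longleftrightarrow> Q l w"
  shows "mat_fun A (\<lambda>l. restrict_keys (Q l) (v l)) k = restrict_keys (P k) (mat_fun A v k)"
proof (cases "k < dim_row A")
  case True
  have "A $$ (k, l) * restrict_keys (Q l) (v l) = restrict_keys (P k) (A $$ (k, l) * v l)" if "l < dim_col A" for l
    using restrict_times[of "A $$ (k, l)" "P k" "Q l" "v l"] PQ[OF True that] by simp
  then show ?thesis using True by (simp add: mat_fun_def restrict_sum)
qed (simp add: mat_fun_def)

lemma mat_fun_vec: "A *\<^sub>v vec (dim_col A) v = vec (dim_row A) (mat_fun A v)"
  by (rule eq_vecI) (simp_all add: mat_fun_def scalar_prod_def atLeast0LessThan)

lemma mat_fun_add: "mat_fun A (u + v) = mat_fun A u + mat_fun A v"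
  by (rule ext) (simp add: mat_fun_def algebra_simps sum.distrib)

lemma mat_fun_scale: "mat_fun A ((\<lambda>_. c) * u) = (\<lambda>_. c) * mat_fun A u"
  by (rule ext) (simp add: mat_fun_def sum_distrib_left mult.left_commute)

definition gcoeff :: "int list \<Rightarrow> int \<Rightarrow> nat \<Rightarrow> 'k::field poly3 set" where
  "gcoeff ds g l = (if l < length ds then homog (g - ds ! l) else {0})"

definition gpart :: "int list \<Rightarrow> int \<Rightarrow> (nat \<Rightarrow> 'k::field poly3) set" where
  "gpart ds g = {v. \<forall>l. v l \<in> gcoeff ds g l}"

definition hpart :: "int list \<Rightarrow> int \<Rightarrow> (nat \<Rightarrow> 'k::field poly3) \<Rightarrow> nat \<Rightarrow> 'k poly3" where
  "hpart ds g v = (\<lambda>l. if l < length ds then restrict_keys (\<lambda>m. int (mdeg m) = g - ds ! l) (v l) else 0)"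

lemma hpart_gpart: "hpart ds g v \<in> gpart ds g"
  by (simp add: gpart_def hpart_def gcoeff_def homog_def keys_restrict)

lemma restrict_homog: "f \<in> homog e \<Longrightarrow> restrict_keys (\<lambda>m. int (mdeg m) = e) f = f"
  by (rule poly_mapping_eqI) (auto simp: lookup_restrict homog_def in_keys_iff)

lemma hpart_id: "v \<in> gpart ds g \<Longrightarrow> hpart ds g v = v"
proof
  fix l assume "v \<in> gpart ds g"
  then have "v l \<in> gcoeff ds g l" by (simp add: gpart_def)
  then show "hpart ds g v l = v l" by (simp add: hpart_def gcoeff_def restrict_homog split: if_splits)
qed

lemma mat_fun_cong: "(\<And>l. l < dim_col A \<Longrightarrow> u l = v l) \<Longrightarrow> mat_fun A u = mat_fun A v"
  by (rule ext) (simp add: mat_fun_def)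

text \<open>This serves to make preimages homogeneous: the degree \<open>g\<close> part of a
  preimage of a degree \<open>g\<close> element is a preimage again.\<close>

lemma mat_fun_hpart:
  assumes g: "graded_map as bs A"
  shows "mat_fun A (hpart bs g v) = hpart as g (mat_fun A v)"
proof
  fix k
  have dim: "dim_row A = length as" "dim_col A = length bs" using g unfolding graded_map_def by auto
  have "mat_fun A (hpart bs g v) k = mat_fun A (\<lambda>l. restrict_keys (\<lambda>m. int (mdeg m) = g - bs ! l) (v l)) k"
    by (intro fun_cong[OF mat_fun_cong]) (simp add: hpart_def dim)
  also have "\<dots> = restrict_keys (\<lambda>m. int (mdeg m) = g - as ! k) (mat_fun A v k)"
  proof (rule mat_fun_restrict[where P = "\<lambda>k m. int (mdeg m) = g - as ! k" and Q = "\<lambda>l m. int (mdeg m) = g - bs ! l"])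
    fix k l u w assume "k < dim_row A" "l < dim_col A" "u \<in> keys (A $$ (k, l))"
    then have "as ! k + int (mdeg u) = bs ! l" using g unfolding dim graded_map_def by simp
    then show "int (mdeg (u + w)) = g - as ! k \<longleftrightarrow> int (mdeg w) = g - bs ! l" by (auto simp: mdeg_add)
  qed
  also have "\<dots> = hpart as g (mat_fun A v) k" by (simp add: hpart_def mat_fun_def dim)
  finally show "mat_fun A (hpart bs g v) k = hpart as g (mat_fun A v) k" .
qed

lemma mat_fun_gpart: "graded_map as bs A \<Longrightarrow> v \<in> gpart bs g \<Longrightarrow> mat_fun A v \<in> gpart as g"
  using mat_fun_hpart[of as bs A g v] hpart_gpart[of as g "mat_fun A v"] by (simp add: hpart_id)

lemma gpart_supported: "v \<in> gpart ds g \<Longrightarrow> l \<ge> length ds \<Longrightarrow> v l = 0"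
  unfolding gpart_def gcoeff_def mem_Collect_eq by (drule spec[of _ l]) simp

lemma gpart_homog: "v \<in> gpart ds g \<Longrightarrow> l < length ds \<Longrightarrow> v l \<in> homog (g - ds ! l)"
  unfolding gpart_def gcoeff_def mem_Collect_eq by (drule spec[of _ l]) simp

lemma vec_gpart_cong:
  assumes "vec n u = vec n v" "\<And>l. l \<ge> n \<Longrightarrow> u l = v l"
  shows "u = v"
proof
  fix l show "u l = v l"
  proof (cases "l < n")
    case True
    then have "vec n u $ l = vec n v $ l" using assms(1) by simp
    then show ?thesis using True by simp
  qed (use assms(2) in simp)
qed

lemma gcoeff_closed:
  "0 \<in> gcoeff ds g l" "a \<in> gcoeff ds g l \<Longrightarrow> b \<in> gcoeff ds g l \<Longrightarrow> a + b \<in> gcoeff ds g l"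
  "a \<in> gcoeff ds g l \<Longrightarrow> b \<in> gcoeff ds g l \<Longrightarrow> a - b \<in> gcoeff ds g l"
  "a \<in> gcoeff ds (g - 1) l \<Longrightarrow> Var i * a \<in> gcoeff ds g l"
  using homog_Var[of a "g - ds ! l"]
  by (auto simp: gcoeff_def homog_add homog_diff algebra_simps)

lemma gcoeff_coprime:
  assumes "a \<in> gcoeff ds g l" "Var i * a = Var j * b" "i \<noteq> j"
  shows "\<exists>c \<in> gcoeff ds (g - 1) l. a = Var j * c"
proof (cases "l < length ds")
  case True
  then show ?thesis using Var_coprime[of a "g - ds ! l" i j b] assms by (simp add: gcoeff_def algebra_simps)
qed (use assms in \<open>auto simp: gcoeff_def\<close>)

lemma gcoeff_koszul:
  assumes "a \<in> gcoeff ds g l" "b \<in> gcoeff ds g l" "c \<in> gcoeff ds g l"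
    and "Var 0 * a + Var 1 * b + Var 2 * c = 0"
  shows "\<exists>r \<in> gcoeff ds (g - 1) l. \<exists>s \<in> gcoeff ds (g - 1) l. \<exists>t \<in> gcoeff ds (g - 1) l.
    a = Var 1 * r + Var 2 * s \<and> b = Var 2 * t - Var 0 * r \<and> c = - Var 0 * s - Var 1 * t"
proof (cases "l < length ds")
  case True
  then have "gcoeff ds (g - 1) l = homog (g - ds ! l - 1)" by (simp add: gcoeff_def algebra_simps)
  then show ?thesis using Var_koszul[of a "g - ds ! l" b c 0 1 2] assms True distinct_3
    by (simp add: gcoeff_def algebra_simps cong: bex_cong)
qed (use assms in \<open>auto simp: gcoeff_def\<close>)

section \<open>The chase in a resolution given by matrices\<close>

locale min_res =
  fixes I :: "'k::field poly3 set" and a :: "nat \<Rightarrow> int list" and D :: "nat \<Rightarrow> 'k poly3 mat"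
  assumes min_res: "minimal_graded_free_resolution I a D"
begin

text \<open>With S in front as module 0, \<open>D p\<close> maps module \<open>p + 1\<close> to
  module \<open>p\<close> for every \<open>p\<close>, the augmentation included; thus
  \<open>F_i\<close> is module \<open>i + 1\<close>.\<close>

definition degs :: "nat \<Rightarrow> int list" where
  "degs p = (case p of 0 \<Rightarrow> [0] | Suc i \<Rightarrow> a i)"

lemma graded: "graded_map (degs p) (degs (Suc p)) (D p)"
  using min_res unfolding minimal_graded_free_resolution_def graded_free_resolution_def degs_def
  by (cases p) auto

lemma dims: "dim_row (D p) = length (degs p)" "dim_col (D p) = length (degs (Suc p))"
  using graded[of p] unfolding graded_map_def by auto

lemma image_kernel: "mat_image (D (Suc p)) = mat_kernel (D p)"
  using min_res unfolding minimal_graded_free_resolution_def graded_free_resolution_def by blast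

lemma entry_no_const: "k < length (degs (Suc p)) \<Longrightarrow> l < length (degs (Suc (Suc p))) \<Longrightarrow>
  0 \<notin> keys (D (Suc p) $$ (k, l))"
proof -
  have ent: "elements_mat (D (Suc p)) \<subseteq> ideal_gen (range Var)"
    using min_res unfolding minimal_graded_free_resolution_def by blast
  assume "k < length (degs (Suc p))" "l < length (degs (Suc (Suc p)))"
  then have "D (Suc p) $$ (k, l) \<in> elements_mat (D (Suc p))" by (intro elements_matI) (auto simp: dims)
  moreover have "(range Var :: 'k poly3 set) = monomial ` range \<epsilon>" by (auto simp: Var_def)
  ultimately have "D (Suc p) $$ (k, l) \<in> ideal_gen (monomial ` range \<epsilon>)"
    using ent by auto
  then have "keys (D (Suc p) $$ (k, l)) \<subseteq> upset (range \<epsilon>)"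
    by (simp only: in_ideal_gen_monomial)
  moreover have "0 \<notin> upset (range \<epsilon>)" using Var_edvd by (auto simp: upset_def)
  ultimately show ?thesis by blast
qed

sublocale koszul_resolution "\<lambda>p. gpart (degs p)" "\<lambda>p. mat_fun (D p)" "\<lambda>_. Var 0" "\<lambda>_. Var 1" "\<lambda>_. Var 2"
proof
  fix u v :: "nat \<Rightarrow> 'k poly3" and p g
  assume "u \<in> gpart (degs p) g" "v \<in> gpart (degs p) g"
  then show "u + v \<in> gpart (degs p) g" "u - v \<in> gpart (degs p) g"
    by (auto simp: gpart_def gcoeff_closed)
next
  fix u :: "nat \<Rightarrow> 'k poly3" and p g
  assume "u \<in> gpart (degs p) (g - 1)"
  then show "(\<lambda>_. Var 0) * u \<in> gpart (degs p) g \<and> (\<lambda>_. Var 1) * u \<in> gpart (degs p) g \<and>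
      (\<lambda>_. Var 2) * u \<in> gpart (degs p) g"
    by (auto simp: gpart_def gcoeff_closed)
next
  fix u v :: "nat \<Rightarrow> 'k poly3" and p
  show "mat_fun (D p) (u + v) = mat_fun (D p) u + mat_fun (D p) v" by (rule mat_fun_add)
next
  fix u :: "nat \<Rightarrow> 'k poly3" and p
  show "mat_fun (D p) ((\<lambda>_. Var 0) * u) = (\<lambda>_. Var 0) * mat_fun (D p) u"
    "mat_fun (D p) ((\<lambda>_. Var 1) * u) = (\<lambda>_. Var 1) * mat_fun (D p) u"
    "mat_fun (D p) ((\<lambda>_. Var 2) * u) = (\<lambda>_. Var 2) * mat_fun (D p) u"
    by (rule mat_fun_scale)+
next
  fix u :: "nat \<Rightarrow> 'k poly3" and p g
  assume "u \<in> gpart (degs (Suc p)) g"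
  then show "mat_fun (D p) u \<in> gpart (degs p) g" by (rule mat_fun_gpart[OF graded])
next
  fix u :: "nat \<Rightarrow> 'k poly3" and p g
  have "D (Suc p) *\<^sub>v vec (dim_col (D (Suc p))) u \<in> mat_kernel (D p)"
    unfolding image_kernel[symmetric] mat_image_def by auto
  then have "D p *\<^sub>v vec (dim_col (D p)) (mat_fun (D (Suc p)) u) = 0\<^sub>v (dim_row (D p))"
    unfolding mat_fun_vec[of "D (Suc p)"] mat_kernel_def by (simp add: dims)
  then have "vec (dim_row (D p)) (mat_fun (D p) (mat_fun (D (Suc p)) u)) = vec (dim_row (D p)) 0"
    unfolding mat_fun_vec by (simp add: zero_vec_def zero_fun_def)
  then show "mat_fun (D p) (mat_fun (D (Suc p)) u) = 0"
    by (rule vec_gpart_cong) (simp add: mat_fun_def)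
next
  fix u :: "nat \<Rightarrow> 'k poly3" and p g
  assume u: "u \<in> gpart (degs (Suc p)) g" and 0: "mat_fun (D p) u = 0"
  have "D p *\<^sub>v vec (dim_col (D p)) u = 0\<^sub>v (dim_row (D p))"
    unfolding mat_fun_vec 0 by (auto simp: zero_vec_def)
  then have "vec (dim_col (D p)) u \<in> mat_image (D (Suc p))"
    unfolding image_kernel mat_kernel_def by simp
  then obtain w where w: "w \<in> carrier_vec (dim_col (D (Suc p)))" "D (Suc p) *\<^sub>v w = vec (dim_col (D p)) u"
    unfolding mat_image_def by auto
  let ?w = "\<lambda>l. w $ l"
  have "vec (dim_col (D (Suc p))) ?w = w" using w by auto
  then have "vec (dim_row (D (Suc p))) (mat_fun (D (Suc p)) ?w) = vec (dim_row (D (Suc p))) u"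
    using w(2) mat_fun_vec[of "D (Suc p)" ?w] by (simp add: dims)
  then have "mat_fun (D (Suc p)) ?w = u"
    by (rule vec_gpart_cong) (use gpart_supported[OF u] in \<open>simp add: mat_fun_def dims\<close>)
  \<comment> \<open>The preimage given by exactness may be inhomogeneous; its degree
    \<open>g\<close> part still maps to \<open>u\<close>.\<close>
  then have "mat_fun (D (Suc p)) (hpart (degs (Suc (Suc p))) g ?w) = u"
    using mat_fun_hpart[OF graded[of "Suc p"], of g ?w] hpart_id[OF u] by simp
  then show "\<exists>w \<in> gpart (degs (Suc (Suc p))) g. mat_fun (D (Suc p)) w = u" using hpart_gpart by blast
next
  fix u :: "nat \<Rightarrow> 'k poly3" and p g
  assume u: "u \<in> gpart (degs (Suc (Suc p))) g"
  let ?ds = "degs (Suc p)"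
  have "\<exists>a b c. a \<in> gcoeff ?ds (g - 1) k \<and> b \<in> gcoeff ?ds (g - 1) k \<and> c \<in> gcoeff ?ds (g - 1) k \<and>
      mat_fun (D (Suc p)) u k = Var 0 * a + Var 1 * b + Var 2 * c" for k
  proof (cases "k < length ?ds")
    case True
    let ?f = "mat_fun (D (Suc p)) u k"
    have "?f \<in> homog (g - ?ds ! k)"
      using mat_fun_gpart[OF graded u] True by (rule gpart_homog)
    moreover have "coeff (D (Suc p) $$ (k, l) * u l) 0 = 0" if "l < length (degs (Suc (Suc p)))" for l
    proof -
      have add0: "v = 0" if "0 = v + w" for v w :: expo
      proof (rule poly_mapping_eqI)
        fix i
        have "0 = v \<diamondop> i + w \<diamondop> i" using arg_cong[OF that, of "\<lambda>x. x \<diamondop> i"] by (simp add: lookup_add)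
        then show "v \<diamondop> i = coeff 0 i" by simp
      qed
      have "0 \<notin> keys (D (Suc p) $$ (k, l) * u l)"
      proof
        assume "0 \<in> keys (D (Suc p) $$ (k, l) * u l)"
        then obtain v w where "0 = v + w" "v \<in> keys (D (Suc p) $$ (k, l))"
          using keys_mult[of "D (Suc p) $$ (k, l)" "u l"] by blast
        then show False using add0 entry_no_const[OF True that] by blast
      qed
      then show ?thesis by (simp add: in_keys_iff)
    qed
    then have "coeff ?f 0 = 0" by (simp add: mat_fun_def lookup_sum dims)
    ultimately obtain a b c where "a \<in> homog (g - ?ds ! k - 1)" "b \<in> homog (g - ?ds ! k - 1)" "c \<in> homog (g - ?ds ! k - 1)"
       "?f = Var 0 * a + Var 1 * b + Var 2 * c" using Var_decompose by blast
    moreover have "g - ?ds ! k - 1 = g - 1 - ?ds ! k" by simp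
    ultimately show ?thesis using True unfolding gcoeff_def by auto
  next
    case False
    then show ?thesis by (intro exI[of _ 0]) (simp add: gcoeff_def mat_fun_def dims)
  qed
  then obtain a b c where "\<forall>k. a k \<in> gcoeff ?ds (g - 1) k \<and> b k \<in> gcoeff ?ds (g - 1) k \<and> c k \<in> gcoeff ?ds (g - 1) k \<and>
      mat_fun (D (Suc p)) u k = Var 0 * a k + Var 1 * b k + Var 2 * c k" by metis
  then show "\<exists>a \<in> gpart ?ds (g - 1). \<exists>b \<in> gpart ?ds (g - 1). \<exists>c \<in> gpart ?ds (g - 1).
      mat_fun (D (Suc p)) u = (\<lambda>_. Var 0) * a + (\<lambda>_. Var 1) * b + (\<lambda>_. Var 2) * c"
    by (intro bexI[of _ a] bexI[of _ b] bexI[of _ c]) (auto simp: gpart_def)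
next
  fix u :: "nat \<Rightarrow> 'k poly3"
  have "u = 0" if "(\<lambda>_. Var i) * u = 0" for i
  proof
    fix l
    have "Var i * u l = Var i * 0" using fun_cong[OF that, of l] by simp
    then show "u l = 0 l" using Var_times_cancel by simp
  qed
  then show "(\<lambda>_. Var 0) * u = 0 \<Longrightarrow> u = 0" "(\<lambda>_. Var 1) * u = 0 \<Longrightarrow> u = 0"
    "(\<lambda>_. Var 2) * u = 0 \<Longrightarrow> u = 0" by blast+
next
  fix b c :: "nat \<Rightarrow> 'k poly3" and p g
  assume b: "b \<in> gpart (degs p) g"
  have "\<exists>c' \<in> gpart (degs p) (g - 1). b = (\<lambda>_. Var j) * c'"
    if eq: "(\<lambda>_. Var i) * b = (\<lambda>_. Var j) * c" and ij: "i \<noteq> j" for i j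
  proof -
    have "\<exists>d. d \<in> gcoeff (degs p) (g - 1) l \<and> b l = Var j * d" for l
      using gcoeff_coprime[of "b l" "degs p" g l i j "c l"] b fun_cong[OF eq, of l] ij
      by (auto simp: gpart_def)
    then obtain d where "\<forall>l. d l \<in> gcoeff (degs p) (g - 1) l \<and> b l = Var j * d l" by metis
    then show ?thesis by (intro bexI[of _ d]) (auto simp: gpart_def)
  qed
  then show "(\<lambda>_. Var 0) * b = (\<lambda>_. Var 1) * c \<Longrightarrow> \<exists>c \<in> gpart (degs p) (g - 1). b = (\<lambda>_. Var 1) * c"
    "(\<lambda>_. Var 1) * b = (\<lambda>_. Var 2) * c \<Longrightarrow> \<exists>c \<in> gpart (degs p) (g - 1). b = (\<lambda>_. Var 2) * c"
    using distinct_3 by blast+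
next
  fix b c d :: "nat \<Rightarrow> 'k poly3" and p g
  assume bcd: "b \<in> gpart (degs p) g" "c \<in> gpart (degs p) g" "d \<in> gpart (degs p) g"
    and eq: "(\<lambda>_. Var 0) * b + (\<lambda>_. Var 1) * c + (\<lambda>_. Var 2) * d = 0"
  let ?C = "gcoeff (degs p) (g - 1)"
  have "\<exists>r s t. r \<in> ?C l \<and> s \<in> ?C l \<and> t \<in> ?C l \<and> b l = Var 1 * r + Var 2 * s \<and> c l = Var 2 * t - Var 0 * r \<and>
      d l = - Var 0 * s - Var 1 * t" for l
    using gcoeff_koszul[of "b l" "degs p" g l "c l" "d l"] bcd fun_cong[OF eq, of l] by (auto simp: gpart_def)
  then obtain r s t where rst: "\<forall>l. r l \<in> ?C l \<and> s l \<in> ?C l \<and> t l \<in> ?C l \<and> b l = Var 1 * r l + Var 2 * s l \<and>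
      c l = Var 2 * t l - Var 0 * r l \<and> d l = - Var 0 * s l - Var 1 * t l" by metis
  have "b = (\<lambda>_. Var 1) * r + (\<lambda>_. Var 2) * s" "c = (\<lambda>_. Var 2) * t - (\<lambda>_. Var 0) * r"
    "d = - (\<lambda>_. Var 0) * s - (\<lambda>_. Var 1) * t" using rst by (auto simp: fun_eq_iff)
  moreover have "r \<in> gpart (degs p) (g - 1)" "s \<in> gpart (degs p) (g - 1)" "t \<in> gpart (degs p) (g - 1)"
    using rst by (auto simp: gpart_def)
  ultimately show "\<exists>r \<in> gpart (degs p) (g - 1). \<exists>s \<in> gpart (degs p) (g - 1). \<exists>t \<in> gpart (degs p) (g - 1).
      b = (\<lambda>_. Var 1) * r + (\<lambda>_. Var 2) * s \<and> c = (\<lambda>_. Var 2) * t - (\<lambda>_. Var 0) * r \<and>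
      d = - (\<lambda>_. Var 0) * s - (\<lambda>_. Var 1) * t" by blast
qed


text \<open>A basis element of degree \<open>g\<close> has a coefficient 1 where elements of degree
  \<open>g - 1\<close> have coefficients of degree -1, that is, 0. Without such a basis element, no
  coefficient of a degree \<open>g\<close> vector has a constant term, and
  \<open>Var_decompose\<close> splits each of them.\<close>

lemma gens_degs: "g \<in> set (degs p) \<longleftrightarrow> \<not> gpart (degs p) g \<subseteq> mH p g"
proof
  assume "g \<in> set (degs p)"
  then obtain l where l: "l < length (degs p)" "degs p ! l = g" by (auto simp: in_set_conv_nth)
  let ?e = "\<lambda>k. if k = l then 1 else 0 :: 'k poly3"
  have "?e \<in> gpart (degs p) g" using l by (auto simp: gpart_def gcoeff_def homog_def mdeg_3)
  moreover have "?e \<notin> mH p g"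
  proof
    assume "?e \<in> mH p g"
    then obtain u v w where "u \<in> gpart (degs p) (g - 1)" "v \<in> gpart (degs p) (g - 1)" "w \<in> gpart (degs p) (g - 1)"
      and e: "?e = (\<lambda>_. Var 0) * u + (\<lambda>_. Var 1) * v + (\<lambda>_. Var 2) * w" unfolding mH_def by blast
    then have "u l \<in> gcoeff (degs p) (g - 1) l" "v l \<in> gcoeff (degs p) (g - 1) l" "w l \<in> gcoeff (degs p) (g - 1) l"
      by (auto simp: gpart_def)
    then have "u l = 0" "v l = 0" "w l = 0" using l homog_neg[of _ "-1"] by (auto simp: gcoeff_def)
    then have "(1 :: 'k poly3) = 0" using fun_cong[OF e, of l] by simp
    then show False by simp
  qed
  ultimately show "\<not> gpart (degs p) g \<subseteq> mH p g" by blast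
next
  assume n: "\<not> gpart (degs p) g \<subseteq> mH p g"
  show "g \<in> set (degs p)"
  proof (rule ccontr)
    assume g: "g \<notin> set (degs p)"
    have "v \<in> mH p g" if v: "v \<in> gpart (degs p) g" for v
    proof -
      have "\<exists>a b c. a \<in> gcoeff (degs p) (g - 1) k \<and> b \<in> gcoeff (degs p) (g - 1) k \<and> c \<in> gcoeff (degs p) (g - 1) k \<and>
        v k = Var 0 * a + Var 1 * b + Var 2 * c" for k
      proof (cases "k < length (degs p)")
        case True
        then have h: "v k \<in> homog (g - degs p ! k)" using v by (intro gpart_homog)
        have "g \<noteq> degs p ! k" using g True by auto
        then have "0 \<notin> keys (v k)" using h by (auto simp: homog_def mdeg_3)
        then have "coeff (v k) 0 = 0" by (simp add: in_keys_iff)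
        moreover have "gcoeff (degs p) (g - 1) k = homog (g - degs p ! k - 1)" using True by (simp add: gcoeff_def algebra_simps)
        ultimately show ?thesis using Var_decompose[OF h] by auto
      next
        case False
        then show ?thesis using gpart_supported[OF v] by (intro exI[of _ 0]) (simp add: gcoeff_def)
      qed
      then obtain a b c where "\<forall>k. a k \<in> gcoeff (degs p) (g - 1) k \<and> b k \<in> gcoeff (degs p) (g - 1) k \<and>
        c k \<in> gcoeff (degs p) (g - 1) k \<and> v k = Var 0 * a k + Var 1 * b k + Var 2 * c k" by metis
      then have "v = (\<lambda>_. Var 0) * a + (\<lambda>_. Var 1) * b + (\<lambda>_. Var 2) * c" "a \<in> gpart (degs p) (g - 1)"
        "b \<in> gpart (degs p) (g - 1)" "c \<in> gpart (degs p) (g - 1)" by (auto simp: gpart_def fun_eq_iff)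
      then show ?thesis using mH_I by blast
    qed
    then show False using n by blast
  qed
qed

definition emb :: "'k poly3 \<Rightarrow> nat \<Rightarrow> 'k poly3" where
  "emb f = (\<lambda>k. if k = 0 then f else 0)"

lemma emb_simps: "(\<lambda>_. c) * emb f = emb (c * f)" "emb f + emb h = emb (f + h)" "emb f - emb h = emb (f - h)"
  "- emb f = emb (- f)" "emb f = emb h \<longleftrightarrow> f = h" "emb f = 0 \<longleftrightarrow> f = 0"
  by (auto simp: emb_def fun_eq_iff)

lemma gpart_0: "gpart (degs 0) g = emb ` homog g"
proof -
  have "v = emb (v 0)" if "v \<in> gpart [0] g" for v
    using gpart_supported[OF that] by (auto simp: emb_def fun_eq_iff)
  moreover have "v 0 \<in> homog g" if "v \<in> gpart [0] g" for v
    using gpart_homog[OF that, of 0] by simp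
  moreover have "emb f \<in> gpart [0] g" if "f \<in> homog g" for f
    using that by (auto simp: gpart_def gcoeff_def emb_def)
  ultimately show ?thesis unfolding degs_def by auto
qed

lemma image_0: "mat_image (D 0) = {v \<in> carrier_vec 1. v $ 0 \<in> I}"
  using min_res unfolding minimal_graded_free_resolution_def graded_free_resolution_def by blast

lemma Im_eq: "Im g = emb ` (I \<inter> homog g)"
proof
  have d0: "length (degs 0) = 1" by (simp add: degs_def)
  show "Im g \<subseteq> emb ` (I \<inter> homog g)"
  proof
    fix v assume "v \<in> Im g"
    then obtain e where e: "e \<in> gpart (degs 1) g" "v = mat_fun (D 0) e" unfolding Im_def by blast
    then have "v \<in> gpart (degs 0) g" using mat_fun_gpart[OF graded[of 0]] by simp
    then obtain f where f: "v = emb f" "f \<in> homog g" unfolding gpart_0 by blast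
    have "D 0 *\<^sub>v vec (dim_col (D 0)) e \<in> mat_image (D 0)" unfolding mat_image_def by auto
    then have "v 0 \<in> I" unfolding image_0 mat_fun_vec using e by (simp add: dims d0)
    then show "v \<in> emb ` (I \<inter> homog g)" using f by (simp add: emb_def)
  qed
  show "emb ` (I \<inter> homog g) \<subseteq> Im g"
  proof
    fix v assume "v \<in> emb ` (I \<inter> homog g)"
    then obtain f where f: "v = emb f" "f \<in> I" "f \<in> homog g" by blast
    then have "vec 1 v \<in> mat_image (D 0)" unfolding image_0 by (simp add: emb_def)
    then obtain w where w: "w \<in> carrier_vec (dim_col (D 0))" "D 0 *\<^sub>v w = vec 1 v"
      unfolding mat_image_def by auto
    let ?w = "\<lambda>l. w $ l"
    have "vec (dim_col (D 0)) ?w = w" using w by auto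
    then have "vec 1 (mat_fun (D 0) ?w) = vec 1 v"
      using w(2) mat_fun_vec[of "D 0" ?w] by (simp add: dims d0)
    then have eq: "mat_fun (D 0) ?w = v"
      by (rule vec_gpart_cong) (simp add: mat_fun_def dims d0 f emb_def)
    have "v \<in> gpart (degs 0) g" unfolding gpart_0 using f by blast
    then have "mat_fun (D 0) (hpart (degs 1) g ?w) = v"
      using mat_fun_hpart[OF graded[of 0], of g ?w] hpart_id eq by simp
    then show "v \<in> Im g" unfolding Im_def using hpart_gpart by blast
  qed
qed

text \<open>The right-hand sides here, in \<open>gens_1_iff\<close> and in \<open>gens_2_iff\<close>
  speak of \<open>I\<close> alone, so they describe whichever resolution \<open>betti\<close>
  chooses.\<close>

lemma gens_0_iff: "g \<in> set (a 0) \<longleftrightarrow> \<not> (\<forall>f \<in> I \<inter> homog g. \<exists>u \<in> I \<inter> homog (g - 1). \<exists>v \<in> I \<inter> homog (g - 1).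
    \<exists>w \<in> I \<inter> homog (g - 1). f = Var 0 * u + Var 1 * v + Var 2 * w)"
  using gens_degs[of g 1] unfolding gens_module_1 Im_eq
  by (simp only: degs_def One_nat_def nat.case ball_simps bex_simps emb_simps)

lemma gens_1_iff: "g \<in> set (a 1) \<longleftrightarrow> \<not> (\<forall>u \<in> I \<inter> homog (g - 1). \<forall>v \<in> I \<inter> homog (g - 1). \<forall>w \<in> I \<inter> homog (g - 1).
    Var 0 * u + Var 1 * v + Var 2 * w = 0 \<longrightarrow>
    (\<exists>r \<in> I \<inter> homog (g - 2). \<exists>s \<in> I \<inter> homog (g - 2). \<exists>t \<in> I \<inter> homog (g - 2).
        u = Var 1 * r + Var 2 * s \<and> v = Var 2 * t - Var 0 * r \<and> w = - Var 0 * s - Var 1 * t))"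
proof -
  have c: "- (\<lambda>_. c) * emb f = emb (- c * f)" for c f by (simp add: emb_def fun_eq_iff)
  have "degs 2 = a 1" by (simp add: degs_def numeral_2_eq_2)
  then show ?thesis
    using gens_degs[of g 2] unfolding gens_module_2 Im_eq
    by (simp only: ball_simps bex_simps emb_simps c)
qed

lemma gens_2_iff: "g \<in> set (a 2) \<longleftrightarrow> \<not> (\<forall>u \<in> homog (g - 3). Var 0 * u \<in> I \<inter> homog (g - 2) \<longrightarrow>
    Var 1 * u \<in> I \<inter> homog (g - 2) \<longrightarrow> Var 2 * u \<in> I \<inter> homog (g - 2) \<longrightarrow> u \<in> I \<inter> homog (g - 3))"
proof -
  have m: "emb f \<in> emb ` S \<longleftrightarrow> f \<in> S" for f S by (auto simp: emb_simps)
  have "degs 3 = a 2" by (simp add: degs_def numeral_3_eq_3 numeral_2_eq_2)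
  then show ?thesis
    using gens_degs[of g 3] unfolding gens_module_3 Im_eq gpart_0
    by (simp only: ball_simps bex_simps emb_simps m)
qed

lemma gens_ge_3: "a (Suc (Suc (Suc p))) = []"
proof -
  have "g \<notin> set (degs (Suc (Suc (Suc (Suc p)))))" for g
    using gens_degs[of g] gens_module_4[of p g] by blast
  then have "g \<notin> set (a (Suc (Suc (Suc p))))" for g by (simp add: degs_def)
  then show ?thesis by (metis list.set_intros(1) list.exhaust)
qed

end

section \<open>Existence of minimal graded free resolutions\<close>

abbreviation fscale :: "'k::field poly3 \<Rightarrow> (nat \<Rightarrow> 'k poly3) \<Rightarrow> nat \<Rightarrow> 'k poly3" where
  "fscale c v \<equiv> (\<lambda>_. c) * v"

lemma module_fscale: "Modules.module (fscale :: 'k::field poly3 \<Rightarrow> _)"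
  by unfold_locales (auto simp: fun_eq_iff algebra_simps)

abbreviation fspan :: "(nat \<Rightarrow> 'k::field poly3) set \<Rightarrow> (nat \<Rightarrow> 'k poly3) set" where
  "fspan \<equiv> Modules.module.span fscale"

lemmas fspan_base = Modules.module.span_base[OF module_fscale]
  and fspan_add = Modules.module.span_add[OF module_fscale]
  and fspan_scale = Modules.module.span_scale[OF module_fscale]
  and fspan_sum = Modules.module.span_sum[OF module_fscale]
  and fspan_zero = Modules.module.span_zero[OF module_fscale]
  and fspan_finite = Modules.module.span_finite[OF module_fscale]
  and fspan_eq = Modules.module.span_eq[OF module_fscale]
  and fspan_induct = Modules.module.span_induct_alt[OF module_fscale, consumes 1, case_names base step]

lemma ex_irredundant:
  assumes "finite S"
  shows "\<exists>B \<subseteq> S. fspan B = fspan S \<and> (\<forall>v \<in> B. v \<notin> fspan (B - {v}))"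
  using assms
proof (induction "card S" arbitrary: S)
  case 0
  then show ?case by auto
next
  case (Suc n)
  show ?case
  proof (cases "\<exists>v \<in> S. v \<in> fspan (S - {v})")
    case False
    then show ?thesis by blast
  next
    case True
    then obtain v where v: "v \<in> S" "v \<in> fspan (S - {v})" by blast
    have "S \<subseteq> fspan (S - {v})"
    proof
      fix u assume "u \<in> S"
      then show "u \<in> fspan (S - {v})" using v fspan_base[of u "S - {v}"] by (cases "u = v") auto
    qed
    moreover have "S - {v} \<subseteq> fspan S" using fspan_base by blast
    ultimately have eq: "fspan (S - {v}) = fspan S" unfolding fspan_eq by blast
    have "n = card (S - {v})" "finite (S - {v})" using Suc v by auto
    from Suc.hyps(1)[OF this] show ?thesis unfolding eq by blast
  qed
qed

text \<open>In the grading by exponent vectors an entry has at most one monomial, so a matrix is a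
  scalar matrix with monomials attached. This makes kernels accessible by supports.\<close>

definition mgraded :: "expo list \<Rightarrow> expo list \<Rightarrow> 'k::field poly3 mat \<Rightarrow> bool" where
  "mgraded as bs A \<longleftrightarrow> A \<in> carrier_mat (length as) (length bs) \<and>
    (\<forall>k < length as. \<forall>l < length bs. \<forall>m \<in> keys (A $$ (k, l)). as ! k + m = bs ! l)"

lemma mgraded_graded_map:
  assumes "mgraded as bs A"
  shows "graded_map (map (int \<circ> mdeg) as) (map (int \<circ> mdeg) bs) A"
  unfolding graded_map_def
proof (intro conjI allI impI ballI)
  show "A \<in> carrier_mat (length (map (int \<circ> mdeg) as)) (length (map (int \<circ> mdeg) bs))"
    using assms by (simp add: mgraded_def)
next
  fix k l m assume "k < length (map (int \<circ> mdeg) as)" "l < length (map (int \<circ> mdeg) bs)"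
    "m \<in> keys (A $$ (k, l))"
  then have "as ! k + m = bs ! l" "k < length as" "l < length bs" using assms by (auto simp: mgraded_def)
  then show "map (int \<circ> mdeg) as ! k + int (mdeg m) = map (int \<circ> mdeg) bs ! l"
    using mdeg_add[of "as ! k" m] by simp
qed

definition mhom :: "expo list \<Rightarrow> expo \<Rightarrow> (nat \<Rightarrow> 'k::field poly3) set" where
  "mhom as g = {v. \<forall>k. (k < length as \<longrightarrow> (\<forall>m \<in> keys (v k). as ! k + m = g)) \<and>
    (k \<ge> length as \<longrightarrow> v k = 0)}"

definition vecs :: "nat \<Rightarrow> (nat \<Rightarrow> 'k::field poly3) set" where
  "vecs n = {v. \<forall>k \<ge> n. v k = 0}"

text \<open>For a graded matrix this says that its columns generate its image minimally.\<close>

definition unit_free :: "'k::field poly3 mat \<Rightarrow> bool" where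
  "unit_free A \<longleftrightarrow> (\<forall>w l c. mat_fun A w = 0 \<longrightarrow> l < dim_col A \<longrightarrow> w l = single 0 c \<longrightarrow> c = 0)"

lemma mat_fun_sum_columns:
  assumes "A = mat n (length vs) (\<lambda>(k, l). (vs ! l) k)" "set vs \<subseteq> vecs n"
  shows "mat_fun A w = (\<Sum>l < length vs. fscale (w l) (vs ! l))"
proof
  fix k
  have sum: "(\<Sum>l \<in> L. fscale (w l) (vs ! l)) k = (\<Sum>l \<in> L. w l * (vs ! l) k)" for L
    by (induction L rule: infinite_finite_induct) auto
  show "mat_fun A w k = (\<Sum>l < length vs. fscale (w l) (vs ! l)) k"
  proof (cases "k < n")
    case True
    then show ?thesis unfolding sum by (simp add: mat_fun_def assms(1) mult.commute)
  next
    case False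
    then have "(vs ! l) k = 0" if "l < length vs" for l
      using assms(2) nth_mem[OF that] unfolding vecs_def by auto
    then show ?thesis using False unfolding sum by (simp add: mat_fun_def assms(1))
  qed
qed

text \<open>The columns are an irredundant generating subset of \<open>S\<close>. A relation with a
  nonzero constant at one column could be divided by this constant and would express the column by
  the others.\<close>

lemma minimal_presentation:
  fixes S :: "(nat \<Rightarrow> 'k::field poly3) set"
  assumes "finite S" and hom: "\<And>v. v \<in> S \<Longrightarrow> \<exists>g. v \<in> mhom as g"
  shows "\<exists>bs A. mgraded as bs A \<and> unit_free A \<and> range (mat_fun A) = fspan S"
proof -
  obtain B where B: "B \<subseteq> S" "fspan B = fspan S" and irr: "\<And>v. v \<in> B \<Longrightarrow> v \<notin> fspan (B - {v})"
    using ex_irredundant[OF assms(1)] by blast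
  have "finite B" using B assms(1) finite_subset by blast
  then obtain vs where vs: "set vs = B" "distinct vs" using finite_distinct_list by blast
  obtain deg where deg: "\<And>v. v \<in> S \<Longrightarrow> v \<in> mhom as (deg v)" using hom by metis
  define A where "A = mat (length as) (length vs) (\<lambda>(k, l). (vs ! l) k)"
  have "set vs \<subseteq> vecs (length as)" using deg vs B unfolding mhom_def vecs_def by blast
  note mf = mat_fun_sum_columns[OF A_def this]
  have "mgraded as (map deg vs) A"
  proof -
    have "as ! k + m = deg (vs ! l)" if "k < length as" "l < length vs" "m \<in> keys ((vs ! l) k)" for k l m
      using deg[of "vs ! l"] nth_mem[OF that(2)] vs B that unfolding mhom_def by blast
    then show ?thesis by (auto simp: mgraded_def A_def)
  qed
  moreover have "range (mat_fun A) = fspan B"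
  proof
    show "range (mat_fun A) \<subseteq> fspan B"
    proof
      fix v assume "v \<in> range (mat_fun A)"
      then obtain w where "v = (\<Sum>l < length vs. fscale (w l) (vs ! l))" using mf by auto
      also have "\<dots> \<in> fspan B" using vs(1) by (intro fspan_sum fspan_scale fspan_base) auto
      finally show "v \<in> fspan B" .
    qed
    show "fspan B \<subseteq> range (mat_fun A)"
    proof
      fix v assume "v \<in> fspan B"
      then obtain u where "v = (\<Sum>b \<in> B. fscale (u b) b)" unfolding fspan_finite[OF \<open>finite B\<close>] by blast
      also have "\<dots> = (\<Sum>l < length vs. fscale (u (vs ! l)) (vs ! l))"
        using sum.reindex_bij_betw[OF bij_betw_nth[OF vs(2) refl vs(1)[symmetric]], of "\<lambda>b. fscale (u b) b"] by simp
      also have "\<dots> = mat_fun A (\<lambda>l. u (vs ! l))" unfolding mf ..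
      finally show "v \<in> range (mat_fun A)" by blast
    qed
  qed
  moreover have "unit_free A"
    unfolding unit_free_def
  proof (intro allI impI, rule ccontr)
    fix w l c assume 0: "mat_fun A w = 0" and l: "l < dim_col A" and w: "w l = single 0 c" and c: "c \<noteq> 0"
    have l': "l < length vs" using l by (simp add: A_def)
    let ?e = "single 0 (- 1 / c) :: 'k poly3"
    let ?R = "\<Sum>k \<in> {..<length vs} - {l}. fscale (w k) (vs ! k)"
    have e0: "0 = fscale (w l) (vs ! l) + ?R"
      using 0 l' unfolding mf by (subst sum.remove[symmetric]) auto
    have e1: "fscale ?e (fscale (w l) (vs ! l)) = - (vs ! l)"
    proof
      fix k
      have "?e * w l = - 1" using c unfolding w by (simp add: mult_single single_uminus)
      then show "fscale ?e (fscale (w l) (vs ! l)) k = (- (vs ! l)) k"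
        by (simp add: mult.assoc[symmetric])
    qed
    have e2: "0 = - (vs ! l) + fscale ?e ?R"
      using arg_cong[OF e0, of "fscale ?e"] unfolding distrib_left e1 by simp
    have "vs ! l = vs ! l + 0" by simp
    also have "\<dots> = vs ! l + (- (vs ! l) + fscale ?e ?R)" using e2 by (rule arg_cong)
    also have "\<dots> = fscale ?e ?R" by simp
    finally have "vs ! l = fscale ?e ?R" .
    moreover have "vs ! k \<in> B - {vs ! l}" if "k \<in> {..<length vs} - {l}" for k
      using that vs l' nth_eq_iff_index_eq[OF vs(2)] by auto
    then have "fscale ?e ?R \<in> fspan (B - {vs ! l})"
      by (intro fspan_sum fspan_scale fspan_base)
    ultimately have "vs ! l \<in> fspan (B - {vs ! l})" by simp
    then show False using irr[of "vs ! l"] vs l' by auto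
  qed
  ultimately show ?thesis using B(2) by metis
qed

definition fkernel :: "'k::field poly3 mat \<Rightarrow> (nat \<Rightarrow> 'k poly3) set" where
  "fkernel A = {v \<in> vecs (dim_col A). mat_fun A v = 0}"

lemma fkernelI: "(\<And>k. k \<ge> dim_col A \<Longrightarrow> v k = 0) \<Longrightarrow> mat_fun A v = 0 \<Longrightarrow> v \<in> fkernel A"
  by (simp add: fkernel_def vecs_def)

lemma fkernelD: "v \<in> fkernel A \<Longrightarrow> mat_fun A v = 0" "v \<in> fkernel A \<Longrightarrow> k \<ge> dim_col A \<Longrightarrow> v k = 0"
  by (simp_all add: fkernel_def vecs_def)

text \<open>The lcm of the degrees at the positions in \<open>S\<close>; the inserted 0 covers the
  empty set.\<close>

definition mlcm :: "expo list \<Rightarrow> nat set \<Rightarrow> expo" where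
  "mlcm bs S = Abs_poly_mapping (\<lambda>i. Max (insert 0 ((\<lambda>l. (bs ! l) \<diamondop> i) ` S)))"

lemma lookup_mlcm: "mlcm bs S \<diamondop> i = Max (insert 0 ((\<lambda>l. (bs ! l) \<diamondop> i) ` S))"
proof -
  have "finite {i :: 3. Max (insert 0 ((\<lambda>l. (bs ! l) \<diamondop> i) ` S)) \<noteq> 0}" by (rule finite)
  then show ?thesis unfolding mlcm_def by (simp add: lookup_Abs_poly_mapping)
qed

lemma mlcm_iff: "finite S \<Longrightarrow> mlcm bs S \<preceq> g \<longleftrightarrow> (\<forall>l \<in> S. bs ! l \<preceq> g)"
  by (auto simp: edvd_def lookup_mlcm)

lemma mhom_coeff:
  assumes "v \<in> mhom bs g" "l < length bs"
  shows "v l = single (g - bs ! l) (coeff (v l) (g - bs ! l))"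
    and "v l \<noteq> 0 \<Longrightarrow> bs ! l \<preceq> g"
proof -
  have k: "bs ! l + m = g" if "m \<in> keys (v l)" for m
    using assms that unfolding mhom_def by blast
  show "v l = single (g - bs ! l) (coeff (v l) (g - bs ! l))"
  proof (rule poly_mapping_eqI)
    fix m
    show "coeff (v l) m =
      coeff (single (g - bs ! l) (coeff (v l) (g - bs ! l))) m"
    proof (cases "m \<in> keys (v l)")
      case True
      then have "m = g - bs ! l" using k by (metis add_diff_cancel_left')
      then show ?thesis by simp
    next
      case False
      then show ?thesis by (auto simp: lookup_single when_def in_keys_iff)
    qed
  qed
  assume "v l \<noteq> 0"
  then obtain m where "m \<in> keys (v l)" by (metis keys_eq_empty ex_in_conv)
  then show "bs ! l \<preceq> g" using k edvd_add by metis
qed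

lemma single_times_cancel:
  fixes f :: "'k::field poly3"
  assumes "single u 1 * f = 0"
  shows "f = 0"
proof -
  have "coeff (single u (1 :: 'k)) u \<noteq> coeff 0 u" by simp
  then have "single u (1 :: 'k) \<noteq> 0" by metis
  then show ?thesis using assms by simp
qed

text \<open>One multihomogeneous syzygy for every possible support, placed in the lowest degree where it lives,
  is enough to generate the kernel: any other syzygy with this support shrinks when a multiple of the
  chosen one is subtracted.\<close>

lemma fkernel_finitely_generated:
  fixes A :: "'k::field poly3 mat"
  assumes A: "mgraded as bs A"
  shows "\<exists>S. finite S \<and> (\<forall>v \<in> S. \<exists>g. v \<in> mhom bs g) \<and> fspan S = fkernel A"
proof -
  let ?n = "length bs"
  have dim: "dim_row A = length as" "dim_col A = ?n" using A by (auto simp: mgraded_def)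
  define P where "P L v \<longleftrightarrow> v \<in> mhom bs (mlcm bs L) \<and> mat_fun A v = 0 \<and> {l. v l \<noteq> 0} = L" for L and v :: "nat \<Rightarrow> 'k poly3"
  define gen where "gen L = (SOME v. P L v)" for L
  define S where "S = gen ` {L \<in> Pow {..<?n}. \<exists>v. P L v}"
  have gen: "P L (gen L)" if "P L v" for L v unfolding gen_def by (rule someI[of "P L" v, OF that])
  have "finite S" by (simp add: S_def)
  have supp: "{l. v l \<noteq> 0} \<subseteq> {..<?n}" if "v \<in> mhom bs g" for v :: "nat \<Rightarrow> 'k poly3" and g
    using that unfolding mhom_def by (auto simp: not_less[symmetric])
  have S_gen: "v \<in> fspan S" if "v \<in> mhom bs g" "mat_fun A v = 0" for v g
    using that
  proof (induction "card {l. v l \<noteq> 0}" arbitrary: v rule: less_induct)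
    case less
    let ?L = "{l. v l \<noteq> 0}"
    have L: "?L \<subseteq> {..<?n}" "finite ?L" using supp[OF less.prems(1)] finite_subset by auto
    show ?case
    proof (cases "?L = {}")
      case True
      then have "v = 0" by (auto simp: fun_eq_iff)
      then show ?thesis using fspan_zero by simp
    next
      case False
      then obtain l0 where l0: "v l0 \<noteq> 0" by blast
      have le: "bs ! l \<preceq> mlcm bs ?L" if "v l \<noteq> 0" for l
        using that mlcm_iff[OF L(2), of bs "mlcm bs ?L"] by simp
      have "mlcm bs ?L \<preceq> g" unfolding mlcm_iff[OF L(2)] using mhom_coeff(2)[OF less.prems(1)] L(1) by blast
      then obtain h where h: "g = mlcm bs ?L + h" unfolding edvd_iff by blast
      define c where "c l = coeff (v l) (g - bs ! l)" for l
      have vl: "v l = single (g - bs ! l) (c l)" if "l < ?n" for l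
        unfolding c_def by (rule mhom_coeff(1)[OF less.prems(1) that])
      \<comment> \<open>Each coordinate is a single term, so \<open>v\<close> can be divided by the
        monomial with exponent \<open>h\<close> and lands in degree \<open>mlcm bs ?L\<close> with
        the same support.\<close>
      define v' where "v' l = (if v l = 0 then 0 else single (mlcm bs ?L - bs ! l) (c l))" for l
      have sh: "v = fscale (single h 1) v'"
      proof
        fix l
        show "v l = fscale (single h 1) v' l"
        proof (cases "v l = 0")
          case False
          then have "h + (mlcm bs ?L - bs ! l) = g - bs ! l"
            using edvd_diff[OF le[OF False]] h by (metis (no_types, lifting) add.assoc add.commute add_diff_cancel_left')
          then show ?thesis using vl[of l] False L(1) by (auto simp: v'_def mult_single)
        qed (simp add: v'_def)
      qed
      have "P ?L v'" unfolding P_def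
      proof (intro conjI)
        have "bs ! k + m = mlcm bs ?L" if "m \<in> keys (v' k)" for k m
        proof -
          have "v k \<noteq> 0" using that by (auto simp: v'_def)
          moreover from this have "m = mlcm bs ?L - bs ! k" using that by (auto simp: v'_def split: if_splits)
          ultimately show ?thesis using edvd_diff[OF le] by simp
        qed
        moreover have "v' k = 0" if "k \<ge> ?n" for k using that L(1) by (auto simp: v'_def)
        ultimately show "v' \<in> mhom bs (mlcm bs ?L)" by (simp add: mhom_def)
        have "fscale (single h 1) (mat_fun A v') = 0"
          using less.prems(2) sh mat_fun_scale by metis
        then have "single h 1 * mat_fun A v' k = 0" for k by (auto simp: fun_eq_iff)
        then show "mat_fun A v' = 0" using single_times_cancel by (auto simp: fun_eq_iff)
        have "v' l \<noteq> 0 \<longleftrightarrow> v l \<noteq> 0" for l using fun_cong[OF sh, of l] by (auto simp: v'_def)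
        then show "{l. v' l \<noteq> 0} = ?L" by simp
      qed
      then have g: "P ?L (gen ?L)" by (rule gen)
      have inS: "gen ?L \<in> S" using L(1) g unfolding S_def by blast
      let ?b = "mlcm bs ?L - bs ! l0"
      let ?c = "coeff (gen ?L l0) ?b"
      have l0n: "l0 < ?n" using l0 L(1) by blast
      have gl0: "gen ?L l0 = single ?b ?c" "gen ?L l0 \<noteq> 0"
        using g l0 mhom_coeff(1)[OF _ l0n] unfolding P_def by blast+
      then have c0: "?c \<noteq> 0" by auto
      \<comment> \<open>The scalar cancels coordinate \<open>l0\<close>, so that the support shrinks
        strictly.\<close>
      define s where "s = single h (c l0 / ?c)"
      define u where "u = v - fscale s (gen ?L)"
      have "u \<in> mhom bs g"
      proof -
        have "bs ! k + m = g" if k: "k < ?n" and m: "m \<in> keys (u k)" for k m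
        proof -
          have "m \<in> keys (v k) \<or> m \<in> keys (s * gen ?L k)"
            using m by (auto simp: u_def in_keys_iff lookup_minus)
          then show ?thesis
          proof
            assume "m \<in> keys (v k)"
            then show ?thesis using less.prems(1) k unfolding mhom_def by blast
          next
            assume "m \<in> keys (s * gen ?L k)"
            then obtain m' where "m = h + m'" "m' \<in> keys (gen ?L k)"
              using keys_mult[of s "gen ?L k"] unfolding s_def by (auto split: if_splits)
            moreover from this have "bs ! k + m' = mlcm bs ?L" using g k unfolding P_def mhom_def by blast
            ultimately show ?thesis using h by (metis add.assoc add.commute)
          qed
        qed
        moreover have "u k = 0" if "k \<ge> ?n" for k
          using that less.prems(1) g unfolding u_def P_def mhom_def by simp
        ultimately show ?thesis by (simp add: mhom_def)
      qed
      moreover have "mat_fun A u = 0"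
      proof -
        have "mat_fun A v = mat_fun A u + mat_fun A (fscale s (gen ?L))"
          unfolding mat_fun_add[symmetric] by (simp add: u_def)
        moreover have "mat_fun A (fscale s (gen ?L)) = 0" unfolding mat_fun_scale using g by (simp add: P_def)
        ultimately show ?thesis using less.prems(2) by simp
      qed
      moreover have "{l. u l \<noteq> 0} \<subset> ?L"
      proof -
        have "u l0 = 0"
        proof -
          have "h + ?b = g - bs ! l0"
            using edvd_diff[OF le[OF l0]] h by (metis (no_types, lifting) add.assoc add.commute add_diff_cancel_left')
          then have "s * gen ?L l0 = v l0" using c0 vl[OF l0n] by (subst gl0) (simp add: s_def mult_single)
          then show ?thesis by (simp add: u_def)
        qed
        moreover have "u l = 0" if "v l = 0" for l
        proof -
          have "gen ?L l = 0" using g that unfolding P_def by blast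
          then show ?thesis using that by (simp add: u_def)
        qed
        ultimately show ?thesis using l0 by blast
      qed
      then have "card {l. u l \<noteq> 0} < card ?L" using L(2) by (rule psubset_card_mono[rotated])
      ultimately have "u \<in> fspan S" using less.hyps by blast
      moreover have "fscale s (gen ?L) \<in> fspan S" using inS by (intro fspan_scale fspan_base)
      ultimately have "u + fscale s (gen ?L) \<in> fspan S" by (rule fspan_add)
      then show ?thesis by (simp add: u_def)
    qed
  qed
  have "fspan S = fkernel A"
  proof
    show "fspan S \<subseteq> fkernel A"
    proof
      fix v assume "v \<in> fspan S"
      then show "v \<in> fkernel A"
      proof (induction rule: fspan_induct)
        case base
        show ?case by (rule fkernelI) (auto simp: mat_fun_def)
      next
        case (step c b y)
        then obtain L where "P L b" using gen unfolding S_def by blast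
        then have "mat_fun A b = 0" and hb: "b \<in> mhom bs (mlcm bs L)" unfolding P_def by auto
        have b: "b k = 0" if "k \<ge> ?n" for k using hb that unfolding mhom_def by simp
        from \<open>mat_fun A b = 0\<close> have "mat_fun A (fscale c b + y) = 0"
          using fkernelD(1)[OF step(2)] unfolding mat_fun_add mat_fun_scale by simp
        then show ?case by (rule fkernelI[rotated]) (use b fkernelD(2)[OF step(2)] dim in simp)
      qed
    qed
    show "fkernel A \<subseteq> fspan S"
    proof
      fix v assume v: "v \<in> fkernel A"
      \<comment> \<open>A general kernel element is split into multihomogeneous parts;
        \<open>N\<close> collects the finitely many degrees that occur, and each part is in the
        kernel because \<open>A\<close> is multigraded.\<close>
      define part where "part g l = (if l < ?n then restrict_keys (\<lambda>m. bs ! l + m = g) (v l) else 0)" for g l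
      define N where "N = (\<Union>l < ?n. (\<lambda>m. bs ! l + m) ` keys (v l))"
      have "finite N" by (simp add: N_def)
      have "part g \<in> fspan S" for g
      proof (rule S_gen)
        show "part g \<in> mhom bs g" by (auto simp: mhom_def part_def keys_restrict)
        show "mat_fun A (part g) = 0"
        proof
          fix k
          have "mat_fun A (part g) k = mat_fun A (\<lambda>l. restrict_keys (\<lambda>m. bs ! l + m = g) (v l)) k"
            by (intro fun_cong[OF mat_fun_cong]) (simp add: part_def dim)
          also have "\<dots> = restrict_keys (\<lambda>m. as ! k + m = g) (mat_fun A v k)"
          proof (rule mat_fun_restrict[where P = "\<lambda>k m. as ! k + m = g" and Q = "\<lambda>l m. bs ! l + m = g"])
            fix k l u w assume "k < dim_row A" "l < dim_col A" "u \<in> keys (A $$ (k, l))"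
            then have "as ! k + u = bs ! l" using A dim unfolding mgraded_def by auto
            then show "as ! k + (u + w) = g \<longleftrightarrow> bs ! l + w = g" by (simp add: add.assoc[symmetric])
          qed
          finally show "mat_fun A (part g) k = 0 k" using fkernelD(1)[OF v] by simp
        qed
      qed
      then have "(\<Sum>g \<in> N. part g) \<in> fspan S" by (intro fspan_sum)
      moreover have "(\<Sum>g \<in> N. part g) = v"
      proof
        fix l
        have app: "(\<Sum>g \<in> N. part g) l = (\<Sum>g \<in> N. part g l)" using \<open>finite N\<close> by induction auto
        show "(\<Sum>g \<in> N. part g) l = v l"
        proof (cases "l < ?n")
          case True
          show ?thesis unfolding app
          proof (rule poly_mapping_eqI)
            fix m
            have "coeff (\<Sum>g \<in> N. part g l) m =
                (\<Sum>g \<in> N. if bs ! l + m = g then coeff (v l) m else 0)"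
              using True by (simp add: lookup_sum part_def lookup_restrict)
            also have "\<dots> = (if bs ! l + m \<in> N then coeff (v l) m else 0)"
              using \<open>finite N\<close> by (simp add: sum.delta')
            also have "\<dots> = coeff (v l) m"
            proof (cases "m \<in> keys (v l)")
              case True
              then have "bs ! l + m \<in> N" using \<open>l < ?n\<close> unfolding N_def by blast
              then show ?thesis by simp
            qed (simp add: in_keys_iff)
            finally show "coeff (\<Sum>g \<in> N. part g l) m = coeff (v l) m" .
          qed
        next
          case False
          then show ?thesis unfolding app using fkernelD(2)[OF v] by (simp add: part_def dim)
        qed
      qed
      ultimately show "v \<in> fspan S" by simp
    qed
  qed
  moreover have "\<forall>v \<in> S. \<exists>g. v \<in> mhom bs g" using gen unfolding S_def P_def by blast
  ultimately show ?thesis using \<open>finite S\<close> by blast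
qed

text \<open>An entry of \<open>B\<close> with a constant term is a constant, since its row and
  column have equal degrees. Its column is a relation among the columns of \<open>A\<close> with
  this constant as a coefficient, and \<open>unit_free A\<close> makes it 0.\<close>

lemma minimal_step:
  assumes A: "mgraded as bs A" and uf: "unit_free A"
  shows "\<exists>cs B. mgraded bs cs B \<and> unit_free B \<and> range (mat_fun B) = fkernel A \<and>
    (\<forall>f \<in> elements_mat B. 0 \<notin> keys f)"
proof -
  obtain S where S: "finite S" "\<And>v. v \<in> S \<Longrightarrow> \<exists>g. v \<in> mhom bs g" "fspan S = fkernel A"
    using fkernel_finitely_generated[OF A] by blast
  obtain cs B where B: "mgraded bs cs B" "unit_free B" "range (mat_fun B) = fkernel A"
    using minimal_presentation[OF S(1,2)] S(3) by metis
  have dim: "dim_col A = length bs" "dim_row B = length bs" "dim_col B = length cs"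
    using A B(1) by (auto simp: mgraded_def)
  have "0 \<notin> keys f" if "f \<in> elements_mat B" for f
  proof
    assume 0: "0 \<in> keys f"
    obtain k l where kl: "k < length bs" "l < length cs" "f = B $$ (k, l)"
      using \<open>f \<in> elements_mat B\<close> dim unfolding elements_mat_def by auto
    let ?w = "mat_fun B (\<lambda>j. if j = l then 1 else 0)"
    have "?w k = f" using kl by (simp add: mat_fun_def dim if_distrib sum.delta' cong: if_cong)
    have g: "bs ! k + m = cs ! l" if "m \<in> keys f" for m
      using B(1) kl that unfolding mgraded_def by blast
    have "f = single 0 (coeff f 0)"
    proof (rule poly_mapping_eqI)
      fix m
      have "m = 0" if "m \<in> keys f" using g[OF that] g[OF 0] by (metis add_left_cancel)
      then show "coeff f m = coeff (single 0 (coeff f 0)) m"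
        by (cases "m = 0") (auto simp: in_keys_iff lookup_single)
    qed
    moreover have "mat_fun A ?w = 0" using B(3) unfolding fkernel_def by blast
    ultimately have "coeff f 0 = 0"
      using uf kl dim \<open>?w k = f\<close> unfolding unit_free_def by metis
    then show False using 0 by (simp add: in_keys_iff)
  qed
  then show ?thesis using B by blast
qed

section \<open>From presentations to a resolution\<close>

lemma mat_image_range: "mat_image A = vec (dim_row A) ` range (mat_fun A)"
proof
  show "mat_image A \<subseteq> vec (dim_row A) ` range (mat_fun A)"
  proof
    fix x assume "x \<in> mat_image A"
    then obtain w where w: "w \<in> carrier_vec (dim_col A)" "x = A *\<^sub>v w" by (auto simp: mat_image_def)
    then have "vec (dim_col A) (\<lambda>l. w $ l) = w" by auto
    then have "x = vec (dim_row A) (mat_fun A (\<lambda>l. w $ l))" using w mat_fun_vec[of A "\<lambda>l. w $ l"] by simp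
    then show "x \<in> vec (dim_row A) ` range (mat_fun A)" by blast
  qed
  show "vec (dim_row A) ` range (mat_fun A) \<subseteq> mat_image A"
    unfolding mat_image_def using mat_fun_vec[symmetric] by fastforce
qed

lemma mat_kernel_fkernel: "mat_kernel A = vec (dim_col A) ` fkernel A"
proof
  show "mat_kernel A \<subseteq> vec (dim_col A) ` fkernel A"
  proof
    fix x assume "x \<in> mat_kernel A"
    then have x: "x \<in> carrier_vec (dim_col A)" "A *\<^sub>v x = 0\<^sub>v (dim_row A)" by (auto simp: mat_kernel_def)
    let ?v = "\<lambda>l. if l < dim_col A then x $ l else 0"
    have xv: "vec (dim_col A) ?v = x" using x by auto
    then have "vec (dim_row A) (mat_fun A ?v) = vec (dim_row A) 0"
      using x(2) mat_fun_vec[of A ?v] by (simp add: zero_vec_def zero_fun_def)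
    then have "mat_fun A ?v = 0" by (rule vec_gpart_cong) (simp add: mat_fun_def)
    then have "?v \<in> fkernel A" by (rule fkernelI[rotated]) simp
    then show "x \<in> vec (dim_col A) ` fkernel A" by (rule rev_image_eqI) (rule xv[symmetric])
  qed
  show "vec (dim_col A) ` fkernel A \<subseteq> mat_kernel A"
  proof
    fix x assume "x \<in> vec (dim_col A) ` fkernel A"
    then obtain v where v: "x = vec (dim_col A) v" "mat_fun A v = 0" by (auto simp: fkernel_def)
    then have "A *\<^sub>v x = 0\<^sub>v (dim_row A)" using mat_fun_vec[of A v] by (simp add: zero_vec_def zero_fun_def)
    then show "x \<in> mat_kernel A" using v by (simp add: mat_kernel_def)
  qed
qed

lemma ex_minimal_resolution:
  assumes "finite G"
  shows "\<exists>a D. minimal_graded_free_resolution (ideal_gen (monomial ` G) :: 'k::field poly3 set) a D"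
proof -
  let ?I = "ideal_gen (monomial ` G) :: 'k poly3 set"
  define emb where "emb f = (\<lambda>k::nat. if k = 0 then f else 0)" for f :: "'k poly3"
  let ?S = "(emb \<circ> monomial) ` G"
  have hom: "\<exists>g. v \<in> mhom [0] g" if v: "v \<in> ?S" for v
  proof -
    obtain u where "u \<in> G" "v = emb (monomial u)" using v by auto
    then have "v \<in> mhom [0] u" by (auto simp: mhom_def emb_def monomial_def)
    then show ?thesis ..
  qed
  have "finite ?S" using assms by simp
  obtain bs A where A: "mgraded [0] bs A" "unit_free A" "range (mat_fun A) = fspan ?S"
    using minimal_presentation[OF \<open>finite ?S\<close> hom] by blast
  have span: "fspan ?S = emb ` ?I"
  proof
    show "fspan ?S \<subseteq> emb ` ?I"
    proof
      fix v assume "v \<in> fspan ?S"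
      then show "v \<in> emb ` ?I"
      proof (induction rule: fspan_induct)
        case base
        have "0 \<in> ?I" unfolding in_ideal_gen_monomial by simp
        then show ?case by (rule image_eqI[rotated]) (auto simp: emb_def fun_eq_iff)
      next
        case (step c b y)
        then obtain u f where u: "u \<in> G" "b = emb (monomial u)" "f \<in> ?I" "y = emb f" by auto
        have eq: "fscale c b + y = emb (c * monomial u + f)" unfolding u by (auto simp: emb_def fun_eq_iff)
        have "c * monomial u + f \<in> ?I"
          by (rule Modules.module.span_add[OF module_times ideal_span_scale[OF ideal_span_base] u(3)]) (use u in auto)
        then show ?case unfolding eq by (rule imageI)
      qed
    qed
    show "emb ` ?I \<subseteq> fspan ?S"
    proof
      fix v assume "v \<in> emb ` ?I"
      then obtain f where f: "f \<in> ?I" "v = emb f" by blast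
      from f(1) have "emb f \<in> fspan ?S"
      proof (induction rule: ideal_span_induct)
        case base
        have "emb 0 = 0" by (auto simp: emb_def fun_eq_iff)
        then show ?case using fspan_zero by metis
      next
        case (step c b y)
        then obtain u where u: "u \<in> G" "b = monomial u" by auto
        have eq: "emb (c * b + y) = fscale c (emb b) + emb y" by (auto simp: emb_def fun_eq_iff)
        have "fscale c (emb b) \<in> fspan ?S" using u by (intro fspan_scale fspan_base) auto
        then show ?case unfolding eq using step(2) by (rule fspan_add)
      qed
      then show "v \<in> fspan ?S" using f by simp
    qed
  qed
  \<comment> \<open>Stage 0 presents the ideal as a submodule of S, whose basis element has degree
    0; \<open>Q\<close> then matches the columns of one stage with the rows of the next.\<close>
  define P where "P n t \<longleftrightarrow> (case t of (as, bs, B) \<Rightarrow> mgraded as bs B \<and> unit_free B \<and>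
      (n = 0 \<longrightarrow> as = [0] \<and> range (mat_fun B) = emb ` ?I))"
    for n :: nat and t :: "expo list \<times> expo list \<times> 'k poly3 mat"
  define Q where "Q t t' \<longleftrightarrow> (case (t, t') of ((as, bs, B), (as', bs', B')) \<Rightarrow>
      as' = bs \<and> range (mat_fun B') = fkernel B \<and> (\<forall>f \<in> elements_mat B'. 0 \<notin> keys f))"
    for t t' :: "expo list \<times> expo list \<times> 'k poly3 mat"
  have "\<exists>s. \<forall>n. P n (s n) \<and> Q (s n) (s (Suc n))"
  proof (rule dependent_nat_choice)
    show "\<exists>t. P 0 t" using A span by (intro exI[of _ "([0], bs, A)"]) (simp add: P_def)
    fix t n assume "P n t"
    then obtain as bs B where t: "t = (as, bs, B)" "mgraded as bs B" "unit_free B" by (cases t) (auto simp: P_def)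
    from minimal_step[OF t(2,3)] obtain cs C where "mgraded bs cs C" "unit_free C" "range (mat_fun C) = fkernel B"
      "\<forall>f \<in> elements_mat C. 0 \<notin> keys f" by blast
    then show "\<exists>t'. P (Suc n) t' \<and> Q t t'" using t by (intro exI[of _ "(bs, cs, C)"]) (simp add: P_def Q_def)
  qed
  then obtain s where s: "\<And>n. P n (s n)" "\<And>n. Q (s n) (s (Suc n))" by blast
  define as where "as n = fst (s n)" for n
  define D where "D n = snd (snd (s n))" for n
  have s_eq: "s n = (as n, as (Suc n), D n)" for n
    using s(2)[of n] by (cases "s n"; cases "s (Suc n)") (auto simp: Q_def as_def D_def)
  have gr: "mgraded (as n) (as (Suc n)) (D n)" for n using s(1)[of n] unfolding s_eq by (simp add: P_def)
  have base: "as 0 = [0]" "range (mat_fun (D 0)) = emb ` ?I" using s(1)[of 0] unfolding s_eq by (simp_all add: P_def)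
  have ker: "range (mat_fun (D (Suc n))) = fkernel (D n)"
    and ent: "\<And>f. f \<in> elements_mat (D (Suc n)) \<Longrightarrow> 0 \<notin> keys f" for n
    using s(2)[of n] unfolding s_eq by (auto simp: Q_def)
  define a where "a n = map (int \<circ> mdeg) (as (Suc n))" for n
  have dim: "dim_row (D n) = length (as n)" "dim_col (D n) = length (as (Suc n))" for n
    using gr[of n] by (auto simp: mgraded_def)
  have "graded_map [0] (a 0) (D 0)" using mgraded_graded_map[OF gr[of 0]] by (simp add: base a_def mdeg_3)
  moreover have "graded_map (a i) (a (Suc i)) (D (Suc i))" for i
    using mgraded_graded_map[OF gr[of "Suc i"]] by (simp add: a_def)
  moreover have "mat_image (D (Suc i)) = mat_kernel (D i)" for i
    unfolding mat_image_range mat_kernel_fkernel ker dim ..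
  moreover have "mat_image (D 0) = {v \<in> carrier_vec 1. v $ 0 \<in> ?I}"
  proof -
    have "mat_image (D 0) = vec 1 ` emb ` ?I" unfolding mat_image_range base(2) dim base(1) by simp
    also have "\<dots> = {v \<in> carrier_vec 1. v $ 0 \<in> ?I}"
    proof
      show "vec 1 ` emb ` ?I \<subseteq> {v \<in> carrier_vec 1. v $ 0 \<in> ?I}" by (auto simp: emb_def)
      show "{v \<in> carrier_vec 1. v $ 0 \<in> ?I} \<subseteq> vec 1 ` emb ` ?I"
      proof
        fix v assume "v \<in> {v \<in> carrier_vec 1. v $ 0 \<in> ?I}"
        then have "v = vec 1 (emb (v $ 0))" "v $ 0 \<in> ?I" by (auto simp: emb_def)
        then show "v \<in> vec 1 ` emb ` ?I" by blast
      qed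
    qed
    finally show ?thesis .
  qed
  moreover have "elements_mat (D (Suc i)) \<subseteq> ideal_gen (range Var)" for i
  proof
    fix f assume f: "f \<in> elements_mat (D (Suc i))"
    have "m \<in> upset (range \<epsilon>)" if "m \<in> keys f" for m
    proof -
      have "m \<noteq> 0" using ent[OF f] that by metis
      then obtain i where "m \<diamondop> i \<noteq> 0" using poly_mapping_eqI[of m 0] by auto
      then have "\<epsilon> i \<preceq> m" unfolding Var_edvd by simp
      then show ?thesis by (auto simp: upset_def)
    qed
    then have "f \<in> ideal_gen (monomial ` range \<epsilon>)" unfolding in_ideal_gen_monomial by blast
    moreover have "(range Var :: 'k poly3 set) = monomial ` range \<epsilon>" by (auto simp: Var_def)
    ultimately show "f \<in> ideal_gen (range Var)" by simp
  qed
  ultimately have "minimal_graded_free_resolution ?I a D"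
    unfolding minimal_graded_free_resolution_def graded_free_resolution_def by blast
  then show ?thesis by blast
qed

section \<open>Minimal generators and colon ideals\<close>

lemma keys_monomial [simp]: "keys (monomial m :: 'k::field poly3) = {m}"
  by (simp add: monomial_def)

lemma inj_monomial: "inj (monomial :: expo \<Rightarrow> 'k::field poly3)"
  by (rule injI) (metis keys_monomial singleton_inject)

lemma monomial_in_ideal_gen: "(monomial m :: 'k::field poly3) \<in> ideal_gen (monomial ` G) \<longleftrightarrow> m \<in> upset G"
  unfolding in_ideal_gen_monomial by simp

lemma ideal_gen_eq_iff:
  "(ideal_gen (monomial ` A) :: 'k::field poly3 set) = ideal_gen (monomial ` B) \<longleftrightarrow> upset A = upset B"
proof
  assume "(ideal_gen (monomial ` A) :: 'k poly3 set) = ideal_gen (monomial ` B)"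
  then show "upset A = upset B" using monomial_in_ideal_gen[where 'k = 'k] by blast
next
  assume eq: "upset A = upset B"
  have "f \<in> ideal_gen (monomial ` A) \<longleftrightarrow> f \<in> ideal_gen (monomial ` B)" for f :: "'k poly3"
    unfolding in_ideal_gen_monomial eq ..
  then show "(ideal_gen (monomial ` A) :: 'k poly3 set) = ideal_gen (monomial ` B)" by blast
qed

definition minimal_expos :: "expo set \<Rightarrow> expo set" where
  "minimal_expos M = {m \<in> M. \<forall>u \<in> M. u \<preceq> m \<longrightarrow> u = m}"

lemma edvd_antisym: "u \<preceq> v \<Longrightarrow> v \<preceq> u \<Longrightarrow> u = v"
  using edvd_mdeg_eq mdeg_mono by blast

lemma upset_minimal_expos: "upset (minimal_expos M) = upset M"
proof
  show "upset (minimal_expos M) \<subseteq> upset M" by (auto simp: upset_def minimal_expos_def)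
  show "upset M \<subseteq> upset (minimal_expos M)"
  proof
    fix m assume "m \<in> upset M"
    then obtain u0 where u0: "u0 \<in> M \<and> u0 \<preceq> m" by (auto simp: upset_def)
    obtain u where u: "u \<in> M" "u \<preceq> m" and min: "\<And>w. w \<in> M \<Longrightarrow> w \<preceq> m \<Longrightarrow> mdeg u \<le> mdeg w"
      using ex_has_least_nat[of "\<lambda>u. u \<in> M \<and> u \<preceq> m" u0 mdeg, OF u0] by blast
    have "u \<in> minimal_expos M"
      unfolding minimal_expos_def
    proof (intro CollectI conjI ballI impI)
      fix w assume "w \<in> M" "w \<preceq> u"
      then show "w = u" using min[of w] edvd_trans u edvd_mdeg_eq by metis
    qed (rule u)
    then show "m \<in> upset (minimal_expos M)" using u by (auto simp: upset_def)
  qed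
qed

lemma upset_base: "u \<in> A \<Longrightarrow> u \<in> upset A"
  unfolding upset_def by (intro CollectI bexI[of _ u]) simp_all

text \<open>A minimal m is a multiple of some u in \<open>A\<close>, and u is a multiple of some w
  in \<open>M\<close>; minimality gives w = m, hence u = m. So every monomial generating set
  contains the minimal exponents.\<close>

lemma minimal_expos_least: "upset A = upset M \<Longrightarrow> minimal_expos M \<subseteq> A"
proof
  fix m assume eq: "upset A = upset M" and m: "m \<in> minimal_expos M"
  then have "m \<in> M" by (simp add: minimal_expos_def)
  then have "m \<in> upset A" using eq upset_base by blast
  then obtain u where u: "u \<in> A" "u \<preceq> m" by (auto simp: upset_def)
  then have "u \<in> upset M" using eq upset_base by blast
  then obtain w where w: "w \<in> M" "w \<preceq> u" by (auto simp: upset_def)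
  then have "w = m" using m edvd_trans[OF w(2) u(2)] unfolding minimal_expos_def by blast
  then have "u = m" using edvd_antisym u w by blast
  then show "m \<in> A" using u by simp
qed

lemma min_mono_gens_eq:
  "min_mono_gens (ideal_gen (monomial ` M) :: 'k::field poly3 set) = monomial ` minimal_expos M"
  unfolding min_mono_gens_def
proof (rule the_equality)
  let ?I = "ideal_gen (monomial ` M) :: 'k poly3 set"
  have gen: "ideal_gen (monomial ` minimal_expos M) = ?I"
    unfolding ideal_gen_eq_iff by (rule upset_minimal_expos)
  have mono: "\<exists>A. H = monomial ` A" if "H \<subseteq> range monomial" for H :: "'k poly3 set"
    using that by (simp add: subset_image_iff)
  have "ideal_gen H \<noteq> ?I" if H: "H \<subset> monomial ` minimal_expos M" for H :: "'k poly3 set"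
  proof
    assume I: "ideal_gen H = ?I"
    obtain A where A: "H = monomial ` A" using mono[of H] H by blast
    have "upset A = upset M" using I unfolding A ideal_gen_eq_iff .
    then have "minimal_expos M \<subseteq> A" by (rule minimal_expos_least)
    then show False using H unfolding A by blast
  qed
  then show "monomial ` minimal_expos M \<subseteq> range monomial \<and> ideal_gen (monomial ` minimal_expos M) = ?I \<and>
      (\<forall>H. H \<subset> monomial ` minimal_expos M \<longrightarrow> ideal_gen H \<noteq> ?I)"
    using gen image_mono[OF subset_UNIV] by auto
  fix G :: "'k poly3 set"
  assume G: "G \<subseteq> range monomial \<and> ideal_gen G = ?I \<and> (\<forall>H. H \<subset> G \<longrightarrow> ideal_gen H \<noteq> ?I)"
  then obtain A where A: "G = monomial ` A" using mono[of G] by blast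
  have "ideal_gen G = ?I" using G by simp
  then have "upset A = upset M" unfolding A ideal_gen_eq_iff .
  then have "monomial ` minimal_expos M \<subseteq> G" unfolding A using minimal_expos_least by blast
  then show "G = monomial ` minimal_expos M" using G gen by (metis psubsetI)
qed

lemma finite_mdeg: "finite {m. mdeg m = d}"
proof (rule finite_imageD)
  let ?f = "\<lambda>m::expo. (m \<diamondop> 0, m \<diamondop> 1, m \<diamondop> 2)"
  have "?f ` {m. mdeg m = d} \<subseteq> {..d} \<times> {..d} \<times> {..d}" by (auto simp: mdeg_3)
  then show "finite (?f ` {m. mdeg m = d})" by (rule finite_subset) simp
  show "inj_on ?f {m. mdeg m = d}"
  proof (rule inj_onI)
    fix u v assume "?f u = ?f v"
    then have "\<forall>i. u \<diamondop> i = v \<diamondop> i" unfolding all_3 by simp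
    then show "u = v" by (intro poly_mapping_eqI) simp
  qed
qed

text \<open>A monomial x^m lies in the colon ideal iff v x^m lies in the ideal of \<open>A\<close>.
  As all degrees agree and \<open>v\<close> is not in \<open>A\<close>, v x_i lies there iff v x_i =
  w x_j for some w in \<open>A\<close> and j different from i.\<close>

lemma colon_linear_iff:
  assumes deg: "\<And>u. u \<in> A \<Longrightarrow> mdeg u = d" and v: "mdeg v = d" "v \<notin> A"
  shows "(\<exists>X. colon_ideal (ideal_gen (monomial ` A)) (monomial v :: 'k::field poly3) = ideal_gen (Var ` X))
    \<longleftrightarrow> lin_colon A v"
proof -
  have Var_im: "(Var ` X :: 'k poly3 set) = monomial ` \<epsilon> ` X" for X by (auto simp: Var_def)
  have mem: "g \<in> colon_ideal (ideal_gen (monomial ` A)) (monomial v) \<longleftrightarrow>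
      (\<forall>m \<in> keys g. v + m \<in> upset A)" for g :: "'k poly3"
  proof -
    have "keys (g * monomial v) = (\<lambda>m. v + m) ` keys g"
    proof (rule Set.set_eqI)
      fix m
      have "m \<in> keys (g * monomial v) \<longleftrightarrow> v \<preceq> m \<and> m - v \<in> keys g"
        by (simp add: mult.commute[of g] monomial_def lookup_single_times in_keys_iff)
      also have "\<dots> \<longleftrightarrow> m \<in> (\<lambda>m. v + m) ` keys g"
      proof
        assume h: "v \<preceq> m \<and> m - v \<in> keys g"
        then have "m = v + (m - v)" using edvd_diff by metis
        then show "m \<in> (\<lambda>m. v + m) ` keys g" using h by blast
      qed (auto simp: edvd_add)
      finally show "m \<in> keys (g * monomial v) \<longleftrightarrow> m \<in> (\<lambda>m. v + m) ` keys g" .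
    qed
    then show ?thesis unfolding colon_ideal_def mem_Collect_eq in_ideal_gen_monomial by auto
  qed
  have mon: "(monomial m :: 'k poly3) \<in> colon_ideal (ideal_gen (monomial ` A)) (monomial v) \<longleftrightarrow> v + m \<in> upset A" for m
    unfolding mem by simp
  have nbI: "\<exists>w \<in> A. \<exists>j. adj i j v w" if up: "v + \<epsilon> i \<in> upset A" for i
  proof -
    obtain w where w: "w \<in> A" "w \<preceq> v + \<epsilon> i" using up by (auto simp: upset_def)
    then obtain j where j: "w + \<epsilon> j \<preceq> v + \<epsilon> i" using edvd_strict deg v by (metis less_add_one mdeg_add mdeg_var(1))
    then have "w + \<epsilon> j = v + \<epsilon> i" using edvd_mdeg_eq[OF j] deg[OF w(1)] v by (simp add: mdeg_add)
    moreover from this have "i \<noteq> j" using w v by auto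
    ultimately have "adj i j v w" by (simp add: adj_def)
    then show ?thesis using w by blast
  qed
  show ?thesis
  proof
    assume "\<exists>X. colon_ideal (ideal_gen (monomial ` A)) (monomial v :: 'k poly3) = ideal_gen (Var ` X)"
    then obtain X where X: "colon_ideal (ideal_gen (monomial ` A)) (monomial v :: 'k poly3) = ideal_gen (monomial ` \<epsilon> ` X)"
      unfolding Var_im by blast
    then have iff: "v + m \<in> upset A \<longleftrightarrow> m \<in> upset (\<epsilon> ` X)" for m
      using mon[of m] monomial_in_ideal_gen[of m "\<epsilon> ` X", where 'k = 'k] by simp
    show "lin_colon A v" unfolding lin_colon_def
    proof
      fix u assume u: "u \<in> A"
      \<comment> \<open>The truncated difference is the exponent of u / gcd(u, v), the element of
        the colon ideal contributed by \<open>u\<close>.\<close>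
      have "u \<preceq> v + (u - v)" by (auto simp: edvd_def lookup_add lookup_minus)
      then have "u - v \<in> upset (\<epsilon> ` X)" using iff u by (auto simp: upset_def)
      then obtain i where i: "i \<in> X" "\<epsilon> i \<preceq> u - v" by (auto simp: upset_def)
      then have "v \<diamondop> i < u \<diamondop> i" unfolding Var_edvd by (simp add: lookup_minus)
      moreover have "\<epsilon> i \<in> upset (\<epsilon> ` X)" using i(1) by (intro upset_base imageI)
      then have "\<exists>w \<in> A. \<exists>j. adj i j v w" using nbI iff by blast
      ultimately show "\<exists>w \<in> A. \<exists>i j. adj i j v w \<and> v \<diamondop> i < u \<diamondop> i" by blast
    qed
  next
    assume lin: "lin_colon A v"
    define X where "X = {i. v + \<epsilon> i \<in> upset A}"
    have iff: "v + m \<in> upset A \<longleftrightarrow> m \<in> upset (\<epsilon> ` X)" for m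
    proof
      assume "v + m \<in> upset A"
      then obtain u where u: "u \<in> A" "u \<preceq> v + m" by (auto simp: upset_def)
      then obtain w i j where w: "w \<in> A" "adj i j v w" "v \<diamondop> i < u \<diamondop> i" using lin unfolding lin_colon_def by blast
      have "w + \<epsilon> j = v + \<epsilon> i" using w(2) by (simp add: adj_def)
      then have "w \<preceq> v + \<epsilon> i" using edvd_add(1)[of w "\<epsilon> j"] by simp
      then have "i \<in> X" using w by (auto simp: X_def upset_def)
      moreover have "u \<diamondop> i \<le> v \<diamondop> i + m \<diamondop> i" using u(2) by (simp add: edvd_def lookup_add)
      then have "\<epsilon> i \<preceq> m" unfolding Var_edvd using w(3) by simp
      ultimately show "m \<in> upset (\<epsilon> ` X)" by (auto simp: upset_def)
    next
      assume "m \<in> upset (\<epsilon> ` X)"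
      then obtain i where i: "v + \<epsilon> i \<in> upset A" "\<epsilon> i \<preceq> m" by (auto simp: upset_def X_def)
      then have "v + \<epsilon> i \<preceq> v + m" by (simp add: edvd_def lookup_add)
      then show "v + m \<in> upset A" using i edvd_trans unfolding upset_def by blast
    qed
    have "g \<in> colon_ideal (ideal_gen (monomial ` A)) (monomial v) \<longleftrightarrow> g \<in> ideal_gen (monomial ` \<epsilon> ` X)" for g :: "'k poly3"
      unfolding mem in_ideal_gen_monomial iff by blast
    then show "\<exists>X. colon_ideal (ideal_gen (monomial ` A)) (monomial v :: 'k poly3) = ideal_gen (Var ` X)"
      unfolding Var_im by blast
  qed
qed

lemma lin_ordered_rev:
  "lin_ordered us \<longleftrightarrow> (\<forall>i < length us. lin_colon (set (take i (rev us))) (rev us ! i))"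
proof (induction us)
  case (Cons v us)
  have "(\<forall>i < length (v # us). lin_colon (set (take i (rev (v # us)))) (rev (v # us) ! i)) \<longleftrightarrow>
      lin_colon (set us) v \<and> (\<forall>i < length us. lin_colon (set (take i (rev us))) (rev us ! i))"
    by (auto simp: less_Suc_eq nth_append)
  then show ?case using Cons by simp
qed simp

lemma linear_quotients_iff:
  assumes G: "\<And>u. u \<in> G \<Longrightarrow> mdeg u = d" and gens: "min_mono_gens I = (monomial ` G :: 'k::field poly3 set)"
  shows "linear_quotients I \<longleftrightarrow> (\<exists>us. set us = G \<and> distinct us \<and> lin_ordered us)"
proof -
  have colon: "(\<exists>X. colon_ideal (ideal_gen (set (take i (map monomial xs)))) (map monomial xs ! i :: 'k poly3) = ideal_gen (Var ` X))
      \<longleftrightarrow> lin_colon (set (take i xs)) (xs ! i)" if "set xs = G" "distinct xs" "i < length xs" for xs i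
  proof -
    have "set (take i (map monomial xs)) = (monomial ` set (take i xs) :: 'k poly3 set)" by (simp add: take_map)
    moreover have "map monomial xs ! i = (monomial (xs ! i) :: 'k poly3)" using that by simp
    moreover have "xs ! i \<notin> set (take i xs)"
      using that by (auto simp: in_set_conv_nth nth_eq_iff_index_eq)
    moreover have "mdeg u = d" if "u \<in> set (take i xs)" for u
      using G that \<open>set xs = G\<close> set_take_subset by fastforce
    moreover have "mdeg (xs ! i) = d" using G that nth_mem by blast
    ultimately show ?thesis using colon_linear_iff[of "set (take i xs)" d "xs ! i", where 'k = 'k] by simp
  qed
  show ?thesis
  proof
    assume "linear_quotients I"
    then obtain us where us: "distinct us" "set us = (monomial ` G :: 'k poly3 set)"
      and lin: "\<forall>i. 1 \<le> i \<and> i < length us \<longrightarrow>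
        (\<exists>X. colon_ideal (ideal_gen (set (take i us))) (us ! i) = ideal_gen (Var ` X))"
      unfolding linear_quotients_def gens by (elim exE conjE)
    have "\<exists>xs. us = map monomial xs" unfolding ex_map_conv us(2) by blast
    then obtain xs where xs: "us = map monomial xs" by blast
    have x: "distinct xs" "set xs = G" using us unfolding xs
      by (auto simp: distinct_map inj_image_eq_iff[OF inj_monomial])
    have "lin_colon (set (take i xs)) (xs ! i)" if "i < length xs" for i
    \<comment> \<open>\<open>linear_quotients\<close> starts at position 1; at position 0 nothing
      precedes and \<open>lin_colon\<close> holds vacuously.\<close>
    proof (cases "i = 0")
      case False
      then show ?thesis using lin[rule_format, of i] colon[OF x(2,1) that] that unfolding xs by simp
    qed (simp add: lin_colon_def)
    then have "lin_ordered (rev xs)" unfolding lin_ordered_rev by simp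
    then show "\<exists>us. set us = G \<and> distinct us \<and> lin_ordered us" using x by (intro exI[of _ "rev xs"]) simp
  next
    assume "\<exists>us. set us = G \<and> distinct us \<and> lin_ordered us"
    then obtain us where us: "set us = G" "distinct us" "lin_ordered us" by blast
    let ?xs = "rev us"
    have "distinct (map monomial ?xs :: 'k poly3 list)"
      using us by (simp add: distinct_map inj_on_subset[OF inj_monomial])
    moreover have "set (map monomial ?xs) = (monomial ` G :: 'k poly3 set)" using us by simp
    moreover have "\<exists>X. colon_ideal (ideal_gen (set (take i (map monomial ?xs)))) (map monomial ?xs ! i :: 'k poly3) = ideal_gen (Var ` X)"
      if "i < length (map monomial ?xs)" for i
      using colon[of ?xs i] us that unfolding lin_ordered_rev by simp
    ultimately show "linear_quotients I" unfolding linear_quotients_def gens by blast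
  qed
qed

section \<open>Koszul cycles of a monomial ideal\<close>

locale equigen =
  fixes G :: "expo set" and d :: nat and I :: "'k::field poly3 set"
  assumes G_deg: "u \<in> G \<Longrightarrow> mdeg u = d" and G_ne: "G \<noteq> {}"
    and I_def: "I = ideal_gen (monomial ` G)"
begin

definition J :: "int \<Rightarrow> 'k poly3 set" where
  "J e = I \<inter> homog e"

lemma mem_I: "f \<in> I \<longleftrightarrow> keys f \<subseteq> upset G"
  unfolding I_def by (rule in_ideal_gen_monomial)

lemma J_iff: "f \<in> J e \<longleftrightarrow> keys f \<subseteq> upset G \<and> f \<in> homog e"
  by (simp add: J_def mem_I)

lemma upset_deg: "m \<in> upset G \<Longrightarrow> d \<le> mdeg m"
  using mdeg_mono G_deg by (auto simp: upset_def)

lemma J_low: "e < int d \<Longrightarrow> J e = {0}"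
proof -
  assume e: "e < int d"
  have "f = 0" if f: "f \<in> J e" for f
  proof (rule ccontr)
    assume "f \<noteq> 0"
    then obtain m where m: "m \<in> keys f" by (metis keys_eq_empty ex_in_conv)
    then have "d \<le> mdeg m" using f upset_deg unfolding J_iff by blast
    moreover have "int (mdeg m) = e" using f m by (simp add: J_iff homog_def)
    ultimately show False using e by linarith
  qed
  moreover have "0 \<in> J e" by (simp add: J_iff)
  ultimately show ?thesis by auto
qed

lemma J_0: "0 \<in> J e"
  by (simp add: J_iff)

lemma J_add: "f \<in> J e \<Longrightarrow> g \<in> J e \<Longrightarrow> f + g \<in> J e"
  using keys_add[of f g] homog_add unfolding J_iff by blast

lemma J_uminus: "f \<in> J e \<Longrightarrow> - f \<in> J e"
  using homog_uminus unfolding J_iff by (auto simp: in_keys_iff)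

lemma J_diff: "f \<in> J e \<Longrightarrow> g \<in> J e \<Longrightarrow> f - g \<in> J e"
  using J_add[of f e "- g"] J_uminus[of g e] by simp

lemma J_single: "m \<in> upset G \<Longrightarrow> int (mdeg m) = e \<Longrightarrow> single m c \<in> J e"
  by (simp add: J_iff homog_def)

text \<open>Above degree \<open>d\<close> every monomial of \<open>I\<close> is a variable times a
  monomial of \<open>I\<close>; assigning each monomial of \<open>f\<close> to one such variable
  splits \<open>f\<close>. Below \<open>d\<close> only 0 occurs.\<close>

lemma J_Var:
  assumes "e \<noteq> int d" "f \<in> J e"
  shows "\<exists>a \<in> J (e - 1). \<exists>b \<in> J (e - 1). \<exists>c \<in> J (e - 1). f = Var 0 * a + Var 1 * b + Var 2 * c"
proof (cases "e < int d")
  case True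
  then have "f = 0" using J_low assms by blast
  then show ?thesis using J_0 by (intro bexI[of _ 0]) simp_all
next
  case False
  define Q where "Q i m \<longleftrightarrow> (\<exists>w \<in> upset G. m = w + \<epsilon> i)" for i m
  have Q: "\<exists>i. Q i m" if m: "m \<in> keys f" for m
  proof -
    obtain u where u: "u \<in> G" "u \<preceq> m" using m assms(2) unfolding J_iff upset_def by blast
    have "int (mdeg m) = e" using m assms(2) unfolding J_iff homog_def by blast
    then have "mdeg u < mdeg m" using False assms(1) G_deg[OF u(1)] by linarith
    then obtain i where "u + \<epsilon> i \<preceq> m" using edvd_strict u by blast
    then obtain h where "m = u + \<epsilon> i + h" unfolding edvd_iff by blast
    then have "m = (u + h) + \<epsilon> i" by (simp only: add_ac)
    moreover have "u + h \<in> upset G" using u edvd_add unfolding upset_def by blast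
    ultimately show ?thesis unfolding Q_def by blast
  qed
  have part: "\<exists>a \<in> J (e - 1). h = Var i * a" if h: "h \<in> homog e" "\<And>m. m \<in> keys h \<Longrightarrow> Q i m" for h i
  proof -
    have "Var i * div_var i h = h"
    proof (rule Var_times_div_var)
      fix m assume "m \<in> keys h"
      then obtain w where "m = w + \<epsilon> i" using h(2) unfolding Q_def by blast
      then show "0 < m \<diamondop> i" by (simp add: expo_nth)
    qed
    moreover have "m \<in> upset G" if "m \<in> keys (div_var i h)" for m
    proof -
      have "m + \<epsilon> i \<in> keys h" using that by (simp only: in_keys_iff lookup_div_var not_False_eq_True)
      then show ?thesis using h(2) unfolding Q_def by (metis add_right_cancel)
    qed
    then have "div_var i h \<in> J (e - 1)" unfolding J_iff using homog_div_var[OF h(1)] by blast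
    ultimately show ?thesis by (intro bexI[of _ "div_var i h"]) simp_all
  qed
  let ?f0 = "restrict_keys (Q 0) f" and ?g = "restrict_keys (\<lambda>m. \<not> Q 0 m) f"
  let ?f1 = "restrict_keys (Q 1) ?g" and ?f2 = "restrict_keys (\<lambda>m. \<not> Q 1 m) ?g"
  have f: "f \<in> homog e" using assms by (simp add: J_iff)
  have f2: "Q 2 m" if "m \<in> keys ?f2" for m
  proof -
    have "m \<in> keys f" "\<not> Q 0 m" "\<not> Q 1 m" using that by (auto simp: keys_restrict)
    then obtain i where "Q i m" "i \<noteq> 0" "i \<noteq> 1" using Q by blast
    moreover from this have "i = 2" using UNIV_3 by (metis UNIV_I insertE singletonD)
    ultimately show ?thesis by simp
  qed
  obtain a where a: "a \<in> J (e - 1)" "?f0 = Var 0 * a"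
    using part[of ?f0 0] f by (auto simp: homog_restrict keys_restrict)
  obtain b where b: "b \<in> J (e - 1)" "?f1 = Var 1 * b"
    using part[of ?f1 1] f by (auto simp: homog_restrict keys_restrict)
  obtain c where c: "c \<in> J (e - 1)" "?f2 = Var 2 * c"
    using part[of ?f2 2] f f2 homog_restrict by blast
  have "f = ?f0 + ?f1 + ?f2"
    using restrict_split[of f "Q 0"] restrict_split[of ?g "Q 1"] by (metis add.assoc)
  then show ?thesis using a b c by metis
qed

lemma J_d: "\<exists>f \<in> J (int d). f \<noteq> 0"
proof -
  obtain u where u: "u \<in> G" using G_ne by blast
  then have "monomial u \<in> J (int d)" unfolding monomial_def by (intro J_single upset_base) (use G_deg in auto)
  moreover have "(monomial u :: 'k poly3) \<noteq> 0" by (metis keys_monomial keys_zero insert_not_empty)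
  ultimately show ?thesis by blast
qed

text \<open>By \<open>gens_2_iff\<close>, the left-hand side says that \<open>F\<^sub>2\<close> is generated in degree \<open>d + 2\<close>.\<close>

lemma socle_condition:
  "(\<forall>g. g \<noteq> int d + 2 \<longrightarrow> (\<forall>u \<in> homog (g - 3). Var 0 * u \<in> J (g - 2) \<longrightarrow> Var 1 * u \<in> J (g - 2) \<longrightarrow>
      Var 2 * u \<in> J (g - 2) \<longrightarrow> u \<in> J (g - 3))) \<longleftrightarrow> no_socle d G" (is "?L \<longleftrightarrow> _")
proof
  assume L: ?L
  show "no_socle d G" unfolding no_socle_def
  proof (intro allI impI, rule ccontr)
    fix m assume m: "m \<notin> upset G" "d \<le> mdeg m" and "\<nexists>i. m + \<epsilon> i \<notin> upset G"
    then have up: "m + \<epsilon> i \<in> upset G" for i by blast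
    define g where "g = int (mdeg m) + 3"
    have V: "Var i * monomial m = single (m + \<epsilon> i) (1::'k)" for i
      by (simp add: Var_single monomial_def mult_single add.commute)
    have "Var i * (monomial m :: 'k poly3) \<in> J (g - 2)" for i
      unfolding V using up by (intro J_single) (auto simp: g_def mdeg_add)
    moreover have "(monomial m :: 'k poly3) \<in> homog (g - 3)" by (simp add: homog_def g_def)
    moreover have "g \<noteq> int d + 2" using m by (simp add: g_def)
    ultimately have "(monomial m :: 'k poly3) \<in> J (g - 3)" using L by blast
    then show False using m unfolding J_iff by simp
  qed
next
  assume soc: "no_socle d G"
  show ?L
  proof (intro allI impI ballI)
    fix g u assume g: "g \<noteq> int d + 2" and u: "u \<in> homog (g - 3)"
      and 0: "Var 0 * u \<in> J (g - 2)" and 1: "Var 1 * u \<in> J (g - 2)" and 2: "Var 2 * u \<in> J (g - 2)"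
    have V: "Var i * u \<in> J (g - 2)" for i
      using 0 1 2 all_3[of "\<lambda>i. Var i * u \<in> J (g - 2)"] by blast
    show "u \<in> J (g - 3)"
    proof (cases "g - 2 < int d")
      case True
      then have "Var 0 * u = Var 0 * 0" using 0 J_low by auto
      then have "u = 0" by (rule Var_times_cancel)
      then show ?thesis using J_0 by simp
    next
      case False
      have "m \<in> upset G" if m: "m \<in> keys u" for m
      proof (rule ccontr)
        assume "m \<notin> upset G"
        moreover have "int (mdeg m) = g - 3" using m u by (simp add: homog_def)
        then have "d \<le> mdeg m" using False g by linarith
        ultimately obtain i where "m + \<epsilon> i \<notin> upset G" using soc unfolding no_socle_def by blast
        moreover have "m + \<epsilon> i \<in> keys (Var i * u)" using m keys_Var_times by blast
        ultimately show False using V[of i] unfolding J_iff by blast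
      qed
      then show ?thesis using u unfolding J_iff by blast
    qed
  qed
qed

text \<open>A cycle of the Koszul complex of \<open>I\<close> as a function on the variables; it is a boundary if it is
  contracted from an alternating array.\<close>

definition bdry :: "int \<Rightarrow> (3 \<Rightarrow> 'k poly3) \<Rightarrow> bool" where
  "bdry g y \<longleftrightarrow> (\<exists>S. (\<forall>i j. S i j \<in> J (g - 2)) \<and> (\<forall>i j. S i j = - S j i) \<and> (\<forall>i. S i i = 0) \<and>
    (\<forall>i. y i = (\<Sum>j \<in> UNIV. Var j * S i j)))"

text \<open>\<open>r\<close>, \<open>s\<close>, \<open>t\<close> are the entries above the diagonal.
  The array treats the variables symmetrically and is easy to add up; the explicit form is the one
  in \<open>gens_1_iff\<close>.\<close>

lemma bdry_iff:
  "bdry g y \<longleftrightarrow> (\<exists>r \<in> J (g - 2). \<exists>s \<in> J (g - 2). \<exists>t \<in> J (g - 2).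
    y 0 = Var 1 * r + Var 2 * s \<and> y 1 = Var 2 * t - Var 0 * r \<and> y 2 = - Var 0 * s - Var 1 * t)"
proof
  assume "bdry g y"
  then obtain S where S: "\<And>i j. S i j \<in> J (g - 2)" "\<And>i j. S i j = - S j i" "\<And>i. S i i = 0"
    "\<And>i. y i = (\<Sum>j \<in> UNIV. Var j * S i j)" unfolding bdry_def by blast
  have "y i = Var 0 * S i 0 + Var 1 * S i 1 + Var 2 * S i 2" for i
    unfolding S(4) UNIV_3 by simp
  moreover have "S 1 0 = - S 0 1" "S 2 0 = - S 0 2" "S 2 1 = - S 1 2" by (rule S(2))+
  ultimately have "y 0 = Var 1 * S 0 1 + Var 2 * S 0 2 \<and> y 1 = Var 2 * S 1 2 - Var 0 * S 0 1 \<and>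
      y 2 = - Var 0 * S 0 2 - Var 1 * S 1 2" by (simp add: S(3))
  then show "\<exists>r \<in> J (g - 2). \<exists>s \<in> J (g - 2). \<exists>t \<in> J (g - 2).
    y 0 = Var 1 * r + Var 2 * s \<and> y 1 = Var 2 * t - Var 0 * r \<and> y 2 = - Var 0 * s - Var 1 * t" using S(1) by blast
next
  assume "\<exists>r \<in> J (g - 2). \<exists>s \<in> J (g - 2). \<exists>t \<in> J (g - 2).
    y 0 = Var 1 * r + Var 2 * s \<and> y 1 = Var 2 * t - Var 0 * r \<and> y 2 = - Var 0 * s - Var 1 * t"
  then obtain r s t where rst: "r \<in> J (g - 2)" "s \<in> J (g - 2)" "t \<in> J (g - 2)" and
    y: "y 0 = Var 1 * r + Var 2 * s" "y 1 = Var 2 * t - Var 0 * r" "y 2 = - Var 0 * s - Var 1 * t" by blast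
  define A where "A i j = (if i = 0 \<and> j = 1 then r else if i = 0 \<and> j = 2 then s else if i = 1 \<and> j = 2 then t else 0)"
    for i j :: 3
  define S where "S i j = A i j - A j i" for i j
  have AJ: "A i j \<in> J (g - 2)" for i j using rst J_0 by (simp add: A_def)
  have "S i j \<in> J (g - 2)" for i j unfolding S_def by (intro J_diff AJ)
  moreover have "S i j = - S j i" for i j by (simp add: S_def)
  moreover have "S i i = 0" for i by (simp add: S_def)
  moreover have "\<forall>i. y i = (\<Sum>j \<in> UNIV. Var j * S i j)"
    unfolding all_3 UNIV_3 by (simp add: S_def A_def y)
  ultimately show "bdry g y" unfolding bdry_def by (intro exI[of _ S] conjI allI) blast+
qed

lemma bdry_0: "bdry g (\<lambda>i. 0)"
  unfolding bdry_iff using J_0 by (intro bexI[of _ 0]) simp_all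

lemma bdry_add:
  assumes "bdry g y" "bdry g y'"
  shows "bdry g (\<lambda>i. y i + y' i)"
proof -
  obtain S where S: "\<And>i j. S i j \<in> J (g - 2)" "\<And>i j. S i j = - S j i" "\<And>i. S i i = 0"
    "\<And>i. y i = (\<Sum>j \<in> UNIV. Var j * S i j)" using assms(1) unfolding bdry_def by blast
  obtain S' where S': "\<And>i j. S' i j \<in> J (g - 2)" "\<And>i j. S' i j = - S' j i" "\<And>i. S' i i = 0"
    "\<And>i. y' i = (\<Sum>j \<in> UNIV. Var j * S' i j)" using assms(2) unfolding bdry_def by blast
  let ?S = "\<lambda>i j. S i j + S' i j"
  have "?S i j = - ?S j i" for i j using S(2)[of i j] S'(2)[of i j] by simp
  moreover have "y i + y' i = (\<Sum>j \<in> UNIV. Var j * ?S i j)" for i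
    by (simp add: S(4) S'(4) distrib_left sum.distrib)
  moreover have "?S i j \<in> J (g - 2)" for i j using S(1) S'(1) J_add by blast
  moreover have "?S i i = 0" for i by (simp add: S(3) S'(3))
  ultimately show ?thesis unfolding bdry_def by (intro exI[of _ ?S] conjI allI)
qed

lemma bdry_sum: "(\<And>a. a \<in> A \<Longrightarrow> bdry g (y a)) \<Longrightarrow> bdry g (\<lambda>i. \<Sum>a \<in> A. y a i)"
  by (induction A rule: infinite_finite_induct) (simp_all add: bdry_0 bdry_add)

text \<open>The 0-cycle c([i] - [j]) of the upper Koszul complex at \<open>a\<close>, where vertex k
  stands for a / x_k in coordinate k.\<close>

definition elem :: "expo \<Rightarrow> 3 \<Rightarrow> 3 \<Rightarrow> 'k \<Rightarrow> 3 \<Rightarrow> 'k poly3" where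
  "elem a i j c = (\<lambda>k. (if k = i then single (a - \<epsilon> i) c else 0) -
    (if k = j then single (a - \<epsilon> j) c else 0))"

text \<open>An edge provides a monomial b of \<open>I\<close> with a = b x_i x_j; the array with c b
  at (i, j) and its negative at (j, i) is the witness.\<close>

lemma elem_edge:
  assumes a: "int (mdeg a) = g" and e: "sq_edge G a i j"
  shows "bdry g (elem a i j c)"
proof -
  obtain u where u: "i \<noteq> j" "u \<in> G" "u + \<epsilon> i + \<epsilon> j \<preceq> a" using e unfolding sq_edge_def by blast
  then obtain h where "a = u + \<epsilon> i + \<epsilon> j + h" unfolding edvd_iff by blast
  then have ab: "a = (u + h) + \<epsilon> i + \<epsilon> j" by (simp only: add_ac)
  define b where "b = u + h"
  have b: "b \<in> upset G" unfolding b_def upset_def using u edvd_add by blast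
  have deg: "int (mdeg b) = g - 2" using a unfolding ab b_def by (simp add: mdeg_add)
  have "a = (b + \<epsilon> j) + \<epsilon> i" "a = (b + \<epsilon> i) + \<epsilon> j" unfolding ab b_def by (simp_all only: add_ac)
  then have ai: "a - \<epsilon> i = b + \<epsilon> j" and aj: "a - \<epsilon> j = b + \<epsilon> i" by (metis add_diff_cancel_right')+
  define S where "S k l = (if k = i \<and> l = j then single b c else
    if k = j \<and> l = i then - single b c else 0)" for k l
  have "S k l \<in> J (g - 2)" for k l using J_single[OF b deg] by (auto simp: S_def J_0 J_uminus)
  moreover have "S k l = - S l k" for k l using u(1) by (auto simp: S_def)
  moreover have "S k k = 0" for k using u(1) by (auto simp: S_def)
  moreover have "elem a i j c k = (\<Sum>l \<in> UNIV. Var l * S k l)" for k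
  proof -
    have "Var l * S k l = (if l = j then if k = i then single (a - \<epsilon> i) c else 0 else 0) -
        (if l = i then if k = j then single (a - \<epsilon> j) c else 0 else 0)" for l
      using u(1) unfolding ai aj by (auto simp: S_def Var_single mult_single add.commute)
    then show ?thesis unfolding elem_def by (simp add: sum_subtractf sum.delta)
  qed
  ultimately show ?thesis unfolding bdry_def by blast
qed

lemma elem_path:
  assumes a: "int (mdeg a) = g" and e: "(sq_edge G a)\<^sup>*\<^sup>* i j"
  shows "bdry g (elem a i j c)"
  using e
proof (induction rule: rtranclp_induct)
  case base
  have "elem a i i c = (\<lambda>k. 0)" by (simp add: elem_def)
  then show ?case using bdry_0 by simp
next
  case (step k l)
  have "elem a i l c = (\<lambda>m. elem a i k c m + elem a k l c m)" by (auto simp: elem_def)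
  then show ?case using bdry_add[OF step.IH elem_edge[OF a step.hyps(2)]] by simp
qed

text \<open>Coordinate i is a scalar c_i times a / x_i, and the cycle condition says that the c_i
  sum to 0. Hence the cycle is the sum of the c_j([j] - [i0]), which are boundaries by
  connectivity.\<close>

lemma cycle_multidegree:
  assumes con: "sq_connected d G" and a: "int (mdeg a) = g" "d + 2 \<le> mdeg a"
    and y: "\<And>i. y i \<in> J (g - 1)" "\<And>i m. m \<in> keys (y i) \<Longrightarrow> m + \<epsilon> i = a"
    and 0: "(\<Sum>i \<in> UNIV. Var i * y i) = 0"
  shows "bdry g y"
proof -
  define c where "c i = coeff (y i) (a - \<epsilon> i)" for i
  have ys: "y i = single (a - \<epsilon> i) (c i)" for i
  proof (rule poly_mapping_eqI)
    fix m
    show "coeff (y i) m = coeff (single (a - \<epsilon> i) (c i)) m"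
    proof (cases "m \<in> keys (y i)")
      case True
      then have "m = a - \<epsilon> i" using y(2) by (metis add_diff_cancel_right')
      then show ?thesis by (simp add: c_def)
    next
      case False
      then show ?thesis by (auto simp: lookup_single when_def in_keys_iff c_def)
    qed
  qed
  have vert: "\<exists>u \<in> G. u + \<epsilon> i \<preceq> a" if ci: "c i \<noteq> 0" for i
  proof -
    have k: "a - \<epsilon> i \<in> keys (y i)" using ci by (simp add: c_def in_keys_iff)
    then have "a - \<epsilon> i \<in> upset G" using y(1)[of i] unfolding J_iff by blast
    then obtain u where u: "u \<in> G" "u \<preceq> a - \<epsilon> i" by (auto simp: upset_def)
    then obtain h where "a - \<epsilon> i = u + h" unfolding edvd_iff by blast
    then have "a = (u + \<epsilon> i) + h" using y(2)[OF k] by (simp only: add_ac)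
    then show ?thesis using u edvd_add by metis
  qed
  show ?thesis
  proof (cases "\<exists>i. c i \<noteq> 0")
    case False
    then have "y = (\<lambda>i. 0)" using ys by auto
    then show ?thesis using bdry_0 by simp
  next
    case True
    then obtain i0 where i0: "c i0 \<noteq> 0" by blast
    have V: "Var i * y i = single a (c i)" for i
    proof (cases "c i = 0")
      case False
      then have "a - \<epsilon> i \<in> keys (y i)" by (simp add: c_def in_keys_iff)
      then have "a - \<epsilon> i + \<epsilon> i = a" by (rule y(2))
      then show ?thesis by (simp add: ys[of i] Var_single mult_single add.commute)
    qed (simp add: ys[of i])
    have "single a (\<Sum>i \<in> UNIV. c i) = 0"
    proof -
      have "single a (\<Sum>i \<in> L. c i) = (\<Sum>i \<in> L. single a (c i))" for L
        by (induction L rule: infinite_finite_induct) (simp_all add: single_add)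
      then show ?thesis using 0 unfolding V by simp
    qed
    then have csum: "(\<Sum>i \<in> UNIV. c i) = 0" by (metis lookup_single_eq lookup_zero)
    have el: "bdry g (elem a j i0 (c j))" for j
    proof (cases "c j = 0")
      case True
      have "elem a j i0 (c j) = (\<lambda>k. 0)" unfolding True by (auto simp: elem_def)
      then show ?thesis using bdry_0 by simp
    next
      case False
      then have "(sq_edge G a)\<^sup>*\<^sup>* j i0" using con a(2) vert[OF False] vert[OF i0] unfolding sq_connected_def by blast
      then show ?thesis by (rule elem_path[OF a(1)])
    qed
    have "y = (\<lambda>k. \<Sum>j \<in> UNIV. elem a j i0 (c j) k)"
    proof
      fix k
      have neg: "(\<Sum>j \<in> L. if k = i0 then single (a - \<epsilon> i0) (c j) else 0) =
          (if k = i0 then single (a - \<epsilon> i0) (\<Sum>j \<in> L. c j) else 0)" for L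
        by (induction L rule: infinite_finite_induct) (simp_all add: single_add)
      have "(\<Sum>j \<in> UNIV. elem a j i0 (c j) k) = (\<Sum>j \<in> UNIV. if k = j then single (a - \<epsilon> j) (c j) else 0)"
        unfolding elem_def sum_subtractf neg csum by simp
      also have "\<dots> = y k" by (simp add: sum.delta' ys[of k])
      finally show "y k = (\<Sum>j \<in> UNIV. elem a j i0 (c j) k)" by simp
    qed
    then show ?thesis using bdry_sum[of UNIV g "\<lambda>j. elem a j i0 (c j)"] el by simp
  qed
qed

lemma cycle_bdry:
  assumes con: "sq_connected d G" and g: "int d + 2 \<le> g" and y: "\<And>i. y i \<in> J (g - 1)"
    and 0: "(\<Sum>i \<in> UNIV. Var i * y i) = 0"
  shows "bdry g y"
proof -
  \<comment> \<open>These are the multidegrees that occur; the component of a cycle in each of them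
    is again a cycle.\<close>
  define N where "N = (\<Union>i \<in> UNIV. (\<lambda>m. m + \<epsilon> i) ` keys (y i))"
  have "finite N" by (simp add: N_def)
  have bd: "bdry g (\<lambda>i. restrict_keys (\<lambda>m. m + \<epsilon> i = a) (y i))" if aN: "a \<in> N" for a
  proof (rule cycle_multidegree[OF con])
    obtain i m where m: "m \<in> keys (y i)" "a = m + \<epsilon> i" using aN unfolding N_def by blast
    then have "int (mdeg m) = g - 1" using y[of i] by (auto simp: J_iff homog_def)
    then show "int (mdeg a) = g" by (simp add: m mdeg_add)
    then show "d + 2 \<le> mdeg a" using g by linarith
    show "restrict_keys (\<lambda>m. m + \<epsilon> i = a) (y i) \<in> J (g - 1)" for i
      using y[of i] homog_restrict unfolding J_iff keys_restrict by blast
    show "m + \<epsilon> i = a" if "m \<in> keys (restrict_keys (\<lambda>m. m + \<epsilon> i = a) (y i))" for i m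
      using that by (simp add: keys_restrict)
    have "Var i * restrict_keys (\<lambda>m. m + \<epsilon> i = a) (y i) = restrict_keys (\<lambda>m. m = a) (Var i * y i)" for i
      by (rule restrict_times[symmetric]) (auto simp: Var_single add.commute)
    then have "(\<Sum>i \<in> UNIV. Var i * restrict_keys (\<lambda>m. m + \<epsilon> i = a) (y i)) = restrict_keys (\<lambda>m. m = a) (\<Sum>i \<in> UNIV. Var i * y i)"
      by (simp add: restrict_sum)
    then show "(\<Sum>i \<in> UNIV. Var i * restrict_keys (\<lambda>m. m + \<epsilon> i = a) (y i)) = 0" by (simp add: 0)
  qed
  have "y = (\<lambda>i. \<Sum>a \<in> N. restrict_keys (\<lambda>m. m + \<epsilon> i = a) (y i))"
  proof (rule ext, rule poly_mapping_eqI)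
    fix i m
    have "coeff (\<Sum>a \<in> N. restrict_keys (\<lambda>m. m + \<epsilon> i = a) (y i)) m =
        (\<Sum>a \<in> N. if m + \<epsilon> i = a then coeff (y i) m else 0)"
      by (simp add: lookup_sum lookup_restrict)
    also have "\<dots> = (if m + \<epsilon> i \<in> N then coeff (y i) m else 0)"
      using \<open>finite N\<close> by (simp add: sum.delta')
    also have "\<dots> = coeff (y i) m"
    proof (cases "m \<in> keys (y i)")
      case True
      then have "m + \<epsilon> i \<in> N" unfolding N_def by blast
      then show ?thesis by simp
    qed (simp add: in_keys_iff)
    finally show "coeff (y i) m = coeff (\<Sum>a \<in> N. restrict_keys (\<lambda>m. m + \<epsilon> i = a) (y i)) m" ..
  qed
  then show ?thesis using bdry_sum[of N g "\<lambda>a i. restrict_keys (\<lambda>m. m + \<epsilon> i = a) (y i)"] bd by simp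
qed

text \<open>A nonzero coefficient \<open>s k l\<close> of the array exhibits an edge from k to l.
  Coordinates i and j show that either \<open>s i j\<close> is nonzero or, with k the third
  variable, both \<open>s i k\<close> and \<open>s j k\<close> are; so i and j are joined directly
  or through k.\<close>

lemma bdry_connected:
  assumes a: "int (mdeg a) = g" and b: "bdry g (elem a i j 1)" and ij: "i \<noteq> j"
    and v: "\<epsilon> i \<preceq> a" "\<epsilon> j \<preceq> a"
  shows "(sq_edge G a)\<^sup>*\<^sup>* i j"
proof -
  obtain S where S: "\<And>i j. S i j \<in> J (g - 2)" "\<And>i j. S i j = - S j i" "\<And>i. S i i = 0"
    "\<And>k. elem a i j 1 k = (\<Sum>l \<in> UNIV. Var l * S k l)" using b unfolding bdry_def by blast
  define s where "s k l = coeff (Var l * S k l) (a - \<epsilon> k)" for k l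
  have edge: "sq_edge G a k l" if s: "s k l \<noteq> 0" and k: "\<epsilon> k \<preceq> a" and kl: "k \<noteq> l" for k l
  proof -
    have "a - \<epsilon> k \<in> keys (Var l * S k l)" using s by (simp add: s_def in_keys_iff)
    then obtain w where w: "w \<in> keys (S k l)" "a - \<epsilon> k = w + \<epsilon> l" unfolding keys_Var_times by blast
    then obtain u where u: "u \<in> G" "u \<preceq> w" using S(1)[of k l] unfolding J_iff upset_def by blast
    then obtain h where "w = u + h" unfolding edvd_iff by blast
    then have "a = \<epsilon> k + (u + h + \<epsilon> l)" using w edvd_diff[OF k] by metis
    then have "a = (u + \<epsilon> k + \<epsilon> l) + h" by (simp only: add_ac)
    then show ?thesis using u kl edvd_add unfolding sq_edge_def by metis
  qed
  have anti: "s k l = - s l k" if k: "\<epsilon> k \<preceq> a" and l: "\<epsilon> l \<preceq> a" and kl: "k \<noteq> l" for k l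
  proof -
    have kl': "\<epsilon> l \<preceq> a - \<epsilon> k" "\<epsilon> k \<preceq> a - \<epsilon> l"
      using k l kl unfolding Var_edvd by (simp_all add: expo_nth lookup_minus)
    have "a - \<epsilon> k - \<epsilon> l = a - \<epsilon> l - \<epsilon> k" by (simp add: diff_diff_add add.commute)
    then show ?thesis unfolding s_def Var_single using kl' S(2)[of k l] by (simp add: lookup_single_times)
  qed
  obtain k where k: "k \<noteq> i" "k \<noteq> j" "UNIV = {i, j, k}"
  proof -
    have "card (UNIV - {i, j}) = 1" using ij by (simp add: card_Diff_subset)
    then obtain k where "UNIV - {i, j} = {k}" by (auto simp: card_1_singleton_iff)
    then show ?thesis using that[of k] by blast
  qed
  have row: "elem a i j 1 l = Var i * S l i + Var j * S l j + Var k * S l k" for l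
    unfolding S(4) k(3) using ij k(1,2) by (simp add: add.assoc)
  have ei: "1 = s i j + s i k"
    using arg_cong[OF row[of i], of "\<lambda>f. coeff f (a - \<epsilon> i)"] ij
    by (simp add: elem_def lookup_add S(3) s_def)
  have ej: "- 1 = s j i + s j k"
    using arg_cong[OF row[of j], of "\<lambda>f. coeff f (a - \<epsilon> j)"] ij
    by (simp add: elem_def lookup_add S(3) s_def)
  show ?thesis
  proof (cases "s i j = 0")
    case False
    then have "sq_edge G a i j" using edge v ij by blast
    then show ?thesis by blast
  next
    case True
    then have "s j i = 0" using anti[OF v ij] by simp
    then have "s i k \<noteq> 0" "s j k \<noteq> 0" using True ei ej by auto
    then have "sq_edge G a i k" "sq_edge G a j k" using edge v k by blast+
    moreover from this have "sq_edge G a k j" by (auto simp: sq_edge_def add_ac)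
    ultimately show ?thesis by (meson converse_rtranclp_into_rtranclp r_into_rtranclp)
  qed
qed

text \<open>By \<open>gens_1_iff\<close>, the left-hand side says that \<open>F\<^sub>1\<close> is generated in degree \<open>d + 1\<close>.\<close>

lemma linear_syzygy_condition:
  "(\<forall>g. g \<noteq> int d + 1 \<longrightarrow> (\<forall>u \<in> J (g - 1). \<forall>v \<in> J (g - 1). \<forall>w \<in> J (g - 1). Var 0 * u + Var 1 * v + Var 2 * w = 0 \<longrightarrow>
    (\<exists>r \<in> J (g - 2). \<exists>s \<in> J (g - 2). \<exists>t \<in> J (g - 2).
        u = Var 1 * r + Var 2 * s \<and> v = Var 2 * t - Var 0 * r \<and> w = - Var 0 * s - Var 1 * t)))
    \<longleftrightarrow> sq_connected d G" (is "?L \<longleftrightarrow> _")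
proof
  assume L: ?L
  show "sq_connected d G" unfolding sq_connected_def
  proof (intro allI impI)
    fix a i j assume a: "d + 2 \<le> mdeg a" and "\<exists>u \<in> G. u + \<epsilon> i \<preceq> a" "\<exists>u \<in> G. u + \<epsilon> j \<preceq> a"
    then obtain u v where u: "u \<in> G" "u + \<epsilon> i \<preceq> a" and v: "v \<in> G" "v + \<epsilon> j \<preceq> a" by blast
    show "(sq_edge G a)\<^sup>*\<^sup>* i j"
    proof (cases "i = j")
      case False
      define g where "g = int (mdeg a)"
      have vert: "\<epsilon> k \<preceq> a \<and> (\<forall>c. single (a - \<epsilon> k) c \<in> J (g - 1))" if w: "w \<in> G" "w + \<epsilon> k \<preceq> a" for w k
      proof -
        obtain h where h: "a = w + \<epsilon> k + h" using w(2) unfolding edvd_iff by blast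
        then have a': "a = (w + h) + \<epsilon> k" by (simp only: add_ac)
        then have "a - \<epsilon> k = w + h" by simp
        moreover have "w + h \<in> upset G" using w edvd_add unfolding upset_def by blast
        moreover have "int (mdeg (w + h)) = g - 1" unfolding g_def a' by (simp add: mdeg_add)
        moreover have "\<epsilon> k \<preceq> a" unfolding a' by (rule edvd_add)
        ultimately show ?thesis using J_single by simp
      qed
      \<comment> \<open>The difference of two vertices is the test cycle: once it bounds, the
        vertices are connected.\<close>
      let ?y = "elem a i j 1"
      have y: "?y k \<in> J (g - 1)" for k
        unfolding elem_def using vert[OF u] vert[OF v] J_0 by (intro J_diff) auto
      have Vs: "Var k * single (a - \<epsilon> k) (1 :: 'k) = single a 1" if "\<epsilon> k \<preceq> a" for k
        using edvd_diff[OF that] by (simp add: Var_single mult_single)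
      have "(\<Sum>k \<in> UNIV. Var k * ?y k) = (\<Sum>k \<in> UNIV. if k = i then Var k * single (a - \<epsilon> i) 1 else 0) -
          (\<Sum>k \<in> UNIV. if k = j then Var k * single (a - \<epsilon> j) 1 else 0)"
        unfolding elem_def right_diff_distrib sum_subtractf by (simp add: if_distrib cong: if_cong)
      also have "\<dots> = 0" using Vs vert[OF u] vert[OF v] by (simp add: sum.delta)
      finally have 0: "Var 0 * ?y 0 + Var 1 * ?y 1 + Var 2 * ?y 2 = 0" unfolding UNIV_3 by (simp add: add.assoc)
      have "g \<noteq> int d + 1" using a by (simp add: g_def)
      then have "bdry g ?y" unfolding bdry_iff using L y 0 by blast
      then show ?thesis using bdry_connected[OF _ _ False] vert[OF u] vert[OF v] by (simp add: g_def)
    qed simp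
  qed
next
  assume con: "sq_connected d G"
  show ?L
  proof (intro allI impI ballI)
    fix g u v w assume g: "g \<noteq> int d + 1" and uvw: "u \<in> J (g - 1)" "v \<in> J (g - 1)" "w \<in> J (g - 1)"
      and 0: "Var 0 * u + Var 1 * v + Var 2 * w = 0"
    define y where "y i = (if i = 0 then u else if i = 1 then v else w)" for i :: 3
    have "bdry g y"
    proof (cases "g - 1 < int d")
      case True
      then have "u = 0" "v = 0" "w = 0" using uvw J_low by blast+
      then have "y = (\<lambda>i. 0)" by (auto simp: y_def)
      then show ?thesis using bdry_0 by simp
    next
      case False
      then have "int d + 2 \<le> g" using g by linarith
      moreover have "y i \<in> J (g - 1)" for i using uvw by (simp add: y_def)
      moreover have "(\<Sum>i \<in> UNIV. Var i * y i) = 0" unfolding UNIV_3 using 0 by (simp add: y_def add.assoc)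
      ultimately show ?thesis by (rule cycle_bdry[OF con])
    qed
    then show "\<exists>r \<in> J (g - 2). \<exists>s \<in> J (g - 2). \<exists>t \<in> J (g - 2).
        u = Var 1 * r + Var 2 * s \<and> v = Var 2 * t - Var 0 * r \<and> w = - Var 0 * s - Var 1 * t"
      unfolding bdry_iff by (simp add: y_def)
  qed
qed

end

section \<open>Betti numbers\<close>

locale equigen_res = equigen G d I + min_res I a D
  for G d and I :: "'k::field poly3 set" and a D
begin

lemma degrees_0: "set (a 0) = {int d}"
proof -
  have "g \<in> set (a 0) \<longleftrightarrow> g = int d" for g
  proof (cases "g = int d")
    case True
    obtain f where f: "f \<in> J (int d)" "f \<noteq> 0" using J_d by blast
    have "J (int d - 1) = {0}" by (rule J_low) simp
    then have "\<not> (\<forall>f \<in> J g. \<exists>u \<in> J (g - 1). \<exists>v \<in> J (g - 1). \<exists>w \<in> J (g - 1). f = Var 0 * u + Var 1 * v + Var 2 * w)"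
      using f True by auto
    then show ?thesis using True gens_0_iff[of g] unfolding J_def by simp
  next
    case False
    then show ?thesis using gens_0_iff[of g] J_Var unfolding J_def by blast
  qed
  then show ?thesis by auto
qed

lemma degrees_1_iff: "set (a 1) \<subseteq> {int d + 1} \<longleftrightarrow> sq_connected d G"
  using gens_1_iff unfolding linear_syzygy_condition[symmetric] J_def by blast

lemma degrees_2_iff: "set (a 2) \<subseteq> {int d + 2} \<longleftrightarrow> no_socle d G"
  using gens_2_iff unfolding socle_condition[symmetric] J_def by blast

lemma degrees_1_lower: "g \<in> set (a 1) \<Longrightarrow> int d + 1 \<le> g"
proof (rule ccontr)
  assume g: "g \<in> set (a 1)" "\<not> int d + 1 \<le> g"
  then have "J (g - 1) = {0}" by (intro J_low) simp
  then have "\<forall>u \<in> J (g - 1). \<forall>v \<in> J (g - 1). \<forall>w \<in> J (g - 1).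
    Var 0 * u + Var 1 * v + Var 2 * w = 0 \<longrightarrow>
    (\<exists>r \<in> J (g - 2). \<exists>s \<in> J (g - 2). \<exists>t \<in> J (g - 2).
        u = Var 1 * r + Var 2 * s \<and> v = Var 2 * t - Var 0 * r \<and> w = - Var 0 * s - Var 1 * t)"
    using J_0 by (auto intro!: bexI[of _ 0])
  then show False using gens_1_iff[of g] g(1) unfolding J_def by blast
qed

lemma degrees_2_lower: "g \<in> set (a 2) \<Longrightarrow> int d + 2 \<le> g"
proof (rule ccontr)
  assume g: "g \<in> set (a 2)" "\<not> int d + 2 \<le> g"
  then have J: "J (g - 2) = {0}" by (intro J_low) simp
  have "u \<in> J (g - 3)" if "Var 0 * u \<in> J (g - 2)" for u
  proof -
    have "Var 0 * u = Var 0 * 0" using that J by simp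
    then have "u = 0" by (rule Var_times_cancel)
    then show ?thesis using J_0 by simp
  qed
  then show False using gens_2_iff[of g] g(1) unfolding J_def by blast
qed

lemma degrees_ge_3: "3 \<le> i \<Longrightarrow> a i = []"
proof -
  assume "3 \<le> i"
  then have "i = Suc (Suc (Suc (i - 3)))" by simp
  then show ?thesis using gens_ge_3 by metis
qed

lemma degrees_lower: "g \<in> set (a i) \<Longrightarrow> int d + int i \<le> g"
proof -
  assume g: "g \<in> set (a i)"
  then have "\<not> 3 \<le> i" using degrees_ge_3 by fastforce
  then consider "i = 0" | "i = 1" | "i = 2" by linarith
  then show ?thesis using g degrees_0 degrees_1_lower degrees_2_lower by cases auto
qed

lemma linear_degrees_iff: "(\<forall>i. set (a i) \<subseteq> {int d + int i}) \<longleftrightarrow> sq_connected d G \<and> no_socle d G"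
proof -
  have "(\<forall>i. set (a i) \<subseteq> {int d + int i}) \<longleftrightarrow> set (a 1) \<subseteq> {int d + 1} \<and> set (a 2) \<subseteq> {int d + 2}"
  proof
    assume "\<forall>i. set (a i) \<subseteq> {int d + int i}"
    from spec[OF this, of 1] spec[OF this, of 2]
    show "set (a 1) \<subseteq> {int d + 1} \<and> set (a 2) \<subseteq> {int d + 2}" by simp
  next
    assume 12: "set (a 1) \<subseteq> {int d + 1} \<and> set (a 2) \<subseteq> {int d + 2}"
    show "\<forall>i. set (a i) \<subseteq> {int d + int i}"
    proof
      fix i :: nat
      consider "i = 0" | "i = 1" | "i = 2" | "3 \<le> i" by linarith
      then show "set (a i) \<subseteq> {int d + int i}" using 12 degrees_0 degrees_ge_3 by cases auto
    qed
  qed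
  then show ?thesis unfolding degrees_1_iff degrees_2_iff .
qed

text \<open>The set is finite because \<open>a i\<close> is empty from i = 3 on, it contains
  \<open>d\<close> because of \<open>F_0\<close>, and \<open>degrees_lower\<close> bounds it below
  by \<open>d\<close>. So its maximum is \<open>d\<close> iff it has no other element.\<close>

lemma Max_shift_iff:
  "Max {j - int i | i j. j \<in> set (a i)} = int d \<longleftrightarrow> (\<forall>i. set (a i) \<subseteq> {int d + int i})"
proof -
  let ?R = "{j - int i | i j. j \<in> set (a i)}"
  have "?R \<subseteq> (\<Union>i \<in> {..<3}. (\<lambda>j. j - int i) ` set (a i))"
    using degrees_ge_3 by (fastforce simp: not_le[symmetric])
  then have fin: "finite ?R" by (rule finite_subset) simp
  have mem: "int d \<in> ?R" using degrees_0 by (intro CollectI exI[of _ 0] exI[of _ "int d"]) simp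
  have low: "int d \<le> r" if r: "r \<in> ?R" for r
  proof -
    obtain i j where "r = j - int i" "j \<in> set (a i)" using r by blast
    then show ?thesis using degrees_lower by fastforce
  qed
  have "Max ?R = int d \<longleftrightarrow> (\<forall>r \<in> ?R. r = int d)"
  proof
    assume h: "Max ?R = int d"
    show "\<forall>r \<in> ?R. r = int d"
    proof
      fix r assume r: "r \<in> ?R"
      show "r = int d" using Max_ge[OF fin r] low[OF r] h by linarith
    qed
  next
    assume "\<forall>r \<in> ?R. r = int d"
    then show "Max ?R = int d" by (intro Max_eqI[OF fin _ mem]) simp
  qed
  also have "\<dots> \<longleftrightarrow> (\<forall>i. set (a i) \<subseteq> {int d + int i})"
  proof
    assume h: "\<forall>r \<in> ?R. r = int d"
    have "j = int d + int i" if "j \<in> set (a i)" for i j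
    proof -
      have "j - int i \<in> ?R" using that by blast
      then have "j - int i = int d" using h by blast
      then show ?thesis by linarith
    qed
    then show "\<forall>i. set (a i) \<subseteq> {int d + int i}" by blast
  next
    assume h: "\<forall>i. set (a i) \<subseteq> {int d + int i}"
    show "\<forall>r \<in> ?R. r = int d"
    proof
      fix r assume "r \<in> ?R"
      then obtain i j where "r = j - int i" "j \<in> set (a i)" by blast
      then show "r = int d" using h by fastforce
    qed
  qed
  finally show ?thesis .
qed

end

theorem theorem3p19:
  fixes I :: "'k::field poly3 set" and d :: nat
  assumes "monomial_ideal I" and "I \<noteq> {0}" and "equigenerated I d"
  shows "(reg I = int d \<longleftrightarrow> linear_resolution I d) \<and>
         (linear_resolution I d \<longleftrightarrow> linear_quotients I)"
proof -
  obtain M where M: "I = ideal_gen (monomial ` M)" using assms(1) unfolding monomial_ideal_def by blast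
  define G where "G = minimal_expos M"
  have gens: "min_mono_gens I = monomial ` G" unfolding M G_def by (rule min_mono_gens_eq)
  have I: "I = ideal_gen (monomial ` G)"
    unfolding M ideal_gen_eq_iff G_def by (rule upset_minimal_expos[symmetric])
  have deg: "mdeg u = d" if "u \<in> G" for u
    using assms(3) that unfolding equigenerated_def gens by blast
  have "finite G" using finite_subset[OF _ finite_mdeg[of d]] deg by blast
  have ne: "G \<noteq> {}"
  proof
    assume "G = {}"
    then have "f \<in> I \<longleftrightarrow> f = 0" for f unfolding I in_ideal_gen_monomial by (simp add: upset_def)
    then show False using assms(2) by blast
  qed
  \<comment> \<open>These are the degree lists selected in \<open>betti\<close>; the existence
    theorem makes them those of an actual minimal resolution.\<close>
  define a where "a = (SOME a. \<exists>D. minimal_graded_free_resolution I a D)"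
  have "\<exists>a D. minimal_graded_free_resolution I a D" unfolding I by (rule ex_minimal_resolution[OF \<open>finite G\<close>])
  then have "\<exists>D. minimal_graded_free_resolution I a D" unfolding a_def by (rule someI_ex)
  then obtain D where D: "minimal_graded_free_resolution I a D" by blast
  interpret equigen_res G d I a D
    by unfold_locales (use deg ne I D in auto)
  have betti: "betti I i j = 0 \<longleftrightarrow> j \<notin> set (a i)" for i j
    unfolding betti_def a_def[symmetric] by (simp add: count_list_0_iff)
  have lin: "linear_resolution I d \<longleftrightarrow> (\<forall>i. set (a i) \<subseteq> {int d + int i})"
    unfolding linear_resolution_def betti by (auto simp: add.commute)
  have "reg I = int d \<longleftrightarrow> linear_resolution I d"
    unfolding reg_def betti not_not lin by (rule Max_shift_iff)
  moreover have "linear_resolution I d \<longleftrightarrow> linear_quotients I"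
  proof
    assume "linear_resolution I d"
    then have "sq_connected d G" "no_socle d G" using lin linear_degrees_iff by blast+
    then have "\<exists>us. set us = G \<and> distinct us \<and> lin_ordered us"
      by (intro ex_lin_ordered[OF \<open>finite G\<close> deg] sq_connected_linearly_connected[OF _ deg])
    then show "linear_quotients I" by (simp only: linear_quotients_iff[OF deg gens])
  next
    assume "linear_quotients I"
    then have "\<exists>us. set us = G \<and> distinct us \<and> lin_ordered us" by (simp only: linear_quotients_iff[OF deg gens])
    then obtain us where us: "set us = G" "lin_ordered us" by blast
    then have "linearly_connected G \<and> no_socle d G" using lin_ordered_properties[of us d] deg by auto
    then have "sq_connected d G \<and> no_socle d G" using linearly_connected_sq_connected[OF _ deg] by simp
    then show "linear_resolution I d" by (simp only: lin linear_degrees_iff)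
  qed
  ultimately show ?thesis by blast
qed

end
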